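(* Let $0<k<\frac12$ and let $(X_t)_{t\ge1}$ solve $$\mathrm{d}X_t=k|X_t|\,\mathrm{d}t+e^{-t/2}\,\mathrm{d}B_t .$$ Define the events $A=\{X_t\to0 \text{ as } t\to\infty\}$ and $B=\{X_t\to\infty\text{ as } t\to\infty\}$. Then: (i) $\mathbb{P}(A\cup B)=1$; (ii) $\mathbb{P}(A)>0$ and $\mathbb{P}(B)>0$; (iii) almost surely on the event $\{X_t\ge0\ \text{i.o.}\}$, $X_t\to\infty$.
   Context: $(B_t)$ is a standard one-dimensional Brownian motion. For a time-indexed property, "i.o." (infinitely often) means that it holds for an unbounded set of times $t$. *)

theory Defs
  imports "HOL-Probability.Probability"
begin

text \<open>
  Standard one-dimensional Brownian motion \<open>W\<close> relative to a filtration \<open>F\<close>.  Time is the half-line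
  \<open>t \<ge> 0\<close>; no condition is imposed on \<open>W t\<close> for \<open>t < 0\<close>.  The usual conditions (completeness,
  right-continuity) are not assumed of \<open>F\<close>.
\<close>

locale brownian_motion = prob_space M + filtration "space M" F
  for M :: "'a measure" and F :: "real \<Rightarrow> 'a measure" +
  fixes W :: "real \<Rightarrow> 'a \<Rightarrow> real"
  assumes F_subalgebra: "0 \<le> t \<Longrightarrow> subalgebra M (F t)"
    and W_adapted: "0 \<le> t \<Longrightarrow> W t \<in> borel_measurable (F t)"
    and W_start: "AE \<omega> in M. W 0 \<omega> = 0"
    and W_increment: "\<lbrakk>0 \<le> s; s < t\<rbrakk> \<Longrightarrow>
      distributed M lborel (\<lambda>\<omega>. W t \<omega> - W s \<omega>) (normal_density 0 (sqrt (t - s)))"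
    and W_indep: "\<lbrakk>0 \<le> s; s < t\<rbrakk> \<Longrightarrow>
      indep_set (sets (F s)) {(\<lambda>\<omega>. W t \<omega> - W s \<omega>) -` S \<inter> space M | S. S \<in> sets borel}"
    and W_continuous: "AE \<omega> in M. continuous_on {0..} (\<lambda>t. W t \<omega>)"

text \<open>
  Simple integrands on \<open>[a, T]\<close>: a partition \<open>a = p 0 \<le> \<dots> \<le> p N = T\<close> and bounded weights \<open>\<xi> i\<close>
  measurable with respect to \<open>F (p i)\<close>, representing \<open>\<Sum>i<N. \<xi> i \<cdot> 1\<^bsub>(p i, p (i+1)]\<^esub>\<close>.
\<close>

definition simple_integrand ::
  "(real \<Rightarrow> 'a measure) \<Rightarrow> real \<Rightarrow> real \<Rightarrow> nat \<Rightarrow> (nat \<Rightarrow> real) \<Rightarrow> (nat \<Rightarrow> 'a \<Rightarrow> real) \<Rightarrow> bool" where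
  "simple_integrand F a T N p \<xi> \<longleftrightarrow>
     p 0 = a \<and> p N = T \<and> (\<forall>i<N. p i \<le> p (Suc i)) \<and>
     (\<forall>i<N. \<xi> i \<in> borel_measurable (F (p i)) \<and> (\<exists>C. \<forall>\<omega>\<in>space (F (p i)). \<bar>\<xi> i \<omega>\<bar> \<le> C))"

definition simple_process ::
  "nat \<Rightarrow> (nat \<Rightarrow> real) \<Rightarrow> (nat \<Rightarrow> 'a \<Rightarrow> real) \<Rightarrow> real \<Rightarrow> 'a \<Rightarrow> real" where
  "simple_process N p \<xi> s \<omega> = (\<Sum>i<N. \<xi> i \<omega> * indicator {p i<..p (Suc i)} s)"

definition simple_integral ::
  "(real \<Rightarrow> 'a \<Rightarrow> real) \<Rightarrow> nat \<Rightarrow> (nat \<Rightarrow> real) \<Rightarrow> (nat \<Rightarrow> 'a \<Rightarrow> real) \<Rightarrow> 'a \<Rightarrow> real" where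
  "simple_integral W N p \<xi> \<omega> = (\<Sum>i<N. \<xi> i \<omega> * (W (p (Suc i)) \<omega> - W (p i) \<omega>))"

definition progressively_measurable ::
  "(real \<Rightarrow> 'a measure) \<Rightarrow> real \<Rightarrow> real \<Rightarrow> (real \<Rightarrow> 'a \<Rightarrow> real) \<Rightarrow> bool" where
  "progressively_measurable F a T H \<longleftrightarrow>
     (\<forall>t\<in>{a..T}. (\<lambda>(s, \<omega>). H s \<omega>) \<in> borel_measurable (restrict_space borel {a..t} \<Otimes>\<^sub>M F t))"

text \<open>
  \<open>J\<close> is (a version of) the Ito integral of \<open>H\<close> against \<open>W\<close> over \<open>[a, T]\<close>: the \<open>L\<^sup>2(M)\<close> limit of the
  integrals of simple integrands that converge to \<open>H\<close> in \<open>L\<^sup>2([a, T] \<times> M)\<close>.  The random variable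
  \<open>J\<close> is determined up to a null set.
\<close>

definition ito_integral ::
  "'a measure \<Rightarrow> (real \<Rightarrow> 'a measure) \<Rightarrow> (real \<Rightarrow> 'a \<Rightarrow> real) \<Rightarrow> real \<Rightarrow> real \<Rightarrow>
   (real \<Rightarrow> 'a \<Rightarrow> real) \<Rightarrow> ('a \<Rightarrow> real) \<Rightarrow> bool" where
  "ito_integral M F W a T H J \<longleftrightarrow>
     progressively_measurable F a T H \<and>
     J \<in> borel_measurable M \<and>
     (\<exists>N p \<xi>.
        (\<forall>n. simple_integrand F a T (N n) (p n) (\<xi> n)) \<and>
        (\<lambda>n. \<integral>\<^sup>+\<omega>. (\<integral>\<^sup>+s\<in>{a..T}. ennreal ((simple_process (N n) (p n) (\<xi> n) s \<omega> - H s \<omega>)\<^sup>2) \<partial>lborel) \<partial>M)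
          \<longlonglongrightarrow> 0 \<and>
        (\<lambda>n. \<integral>\<^sup>+\<omega>. ennreal ((simple_integral W (N n) (p n) (\<xi> n) \<omega> - J \<omega>)\<^sup>2) \<partial>M) \<longlonglongrightarrow> 0)"

text \<open>
  \<open>(X t)\<close>, \<open>t \<ge> t0\<close>, solves \<open>dX = b(t, X) dt + \<sigma>(t) dW\<close> on \<open>[t0, \<infinity>)\<close>: it is a continuous adapted
  process satisfying the integrated equation almost surely, simultaneously for all \<open>t \<ge> t0\<close>.  The initial value
  \<open>X t0\<close> is an arbitrary \<open>F t0\<close>-measurable random variable.  The diffusion coefficient is
  deterministic, so the square-integrable Ito integral suffices.  The paths of \<open>I\<close> are
  almost surely continuous, since the other terms of the equation are continuous in \<open>t\<close>.
\<close>

definition sde_solution ::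
  "'a measure \<Rightarrow> (real \<Rightarrow> 'a measure) \<Rightarrow> (real \<Rightarrow> 'a \<Rightarrow> real) \<Rightarrow> real \<Rightarrow>
   (real \<Rightarrow> real \<Rightarrow> real) \<Rightarrow> (real \<Rightarrow> real) \<Rightarrow> (real \<Rightarrow> 'a \<Rightarrow> real) \<Rightarrow> bool" where
  "sde_solution M F W t0 b \<sigma> X \<longleftrightarrow>
     (\<forall>t\<ge>t0. X t \<in> borel_measurable (F t)) \<and>
     (\<forall>\<omega>\<in>space M. continuous_on {t0..} (\<lambda>t. X t \<omega>)) \<and>
     (\<exists>I. (\<forall>t\<ge>t0. ito_integral M F W t0 t (\<lambda>s \<omega>. \<sigma> s) (I t)) \<and>
          (AE \<omega> in M. \<forall>t\<ge>t0.
             set_integrable lborel {t0..t} (\<lambda>s. b s (X s \<omega>)) \<and>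
             X t \<omega> = X t0 \<omega> + (LBINT s:{t0..t}. b s (X s \<omega>)) + I t \<omega>))"

end

theory Submission
  imports Defs
begin

text \<open>
  Write \<open>V t\<close> for the stochastic integral of \<open>exp (-s/2)\<close> over \<open>[1, t]\<close>, so that
  \<open>X t = X 1 + k * \<integral>\<^sub>1\<^sup>t \<bar>X s\<bar> ds + V t\<close>.  Only three properties of \<open>V\<close> matter: it is continuous, it is adapted, and
  given \<open>F s\<close> the increment \<open>V t - V s\<close> is centred Gaussian with variance \<open>exp (-s) - exp (-t)\<close>
  (\<open>ito_increment_gauss_indep\<close>).  Since the total variance is finite, the maximal inequality \<open>levy_inequality\<close> makes
  \<open>V\<close> converge almost surely to some \<open>V_inf\<close>, and given \<open>F t\<close> the remainder \<open>V_inf - V t\<close> is centred Gaussian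
  with variance \<open>exp (-t)\<close>.

  The dichotomy is a statement about single paths.  The difference \<open>X - V\<close> is nondecreasing, so \<open>X\<close> has a limit in
  \<open>(-\<infinity>, \<infinity>]\<close>; a finite limit other than \<open>0\<close> would make the drift integral diverge
  (\<open>limit_zero_or_infinity\<close>).  Monotonicity gives more: if \<open>X\<close> tends to \<open>0\<close>, then \<open>X t + (V_inf - V t) \<le> 0\<close> at every
  time \<open>t\<close> (\<open>remainder_nonpos_if_limit_zero\<close>).

  Suppose now that \<open>X t > - exp (-t/2)\<close> at some late time.  If \<open>X\<close> is to converge to \<open>0\<close>, the remainder at that time
  must be less than one of its standard deviations, which has conditional probability \<open>\<Phi>(1) < 1\<close>.  Let \<open>D\<close> be the event that
  such times are unbounded and yet \<open>X\<close> tends to \<open>0\<close>.  Approximate \<open>D\<close> by an event of \<open>F n\<close> and stop at the first such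
  time after \<open>n\<close>: up to an arbitrarily small error \<open>P(D) \<le> \<Phi>(1) * P(D)\<close>, so \<open>D\<close> is null
  (\<open>zero_late_returns_null\<close>).  This gives divergence on the event that \<open>X \<ge> 0\<close> infinitely often.

  Divergence has positive probability because it occurs as soon as \<open>X 1 + (V_inf - V 1) > 0\<close>, and the remainder is
  unbounded and independent of \<open>X 1\<close>.  For convergence to \<open>0\<close>, the noise first carries the path to an arbitrarily low level
  within a short time \<open>h\<close> (\<open>reaches_deep_level\<close>).  From there, in each further step of length \<open>h\<close> the drift
  multiplies the distance to \<open>0\<close> by about \<open>1 - k * h\<close>, while the noise shrinks by the factor \<open>exp (-h/2)\<close>.  As
  \<open>k < 1/2\<close>, the second factor is the smaller one for small \<open>h\<close>, so with positive probability the path never reaches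
  \<open>0\<close> along this grid (\<open>to_zero_positive\<close>).
\<close>

section \<open>Random variables that are Gaussian and independent of a sigma-algebra\<close>

abbreviation std_gauss :: "real set \<Rightarrow> real" where
  "std_gauss \<equiv> measure std_normal_distribution"

lemma norm_iexp_diff_le: "norm (iexp x - iexp y) \<le> \<bar>x - y\<bar>"
proof -
  have "norm (iexp (x - y) - 1) \<le> \<bar>x - y\<bar>"
    using iexp_approx1[of "x - y" 0] by simp
  moreover have "iexp x - iexp y = iexp y * (iexp (x - y) - 1)"
    by (simp add: algebra_simps exp_diff)
  ultimately show ?thesis by (simp add: norm_mult)
qed

lemma le_add_square_divide:
  fixes a d :: real assumes "d > 0" "0 \<le> a" shows "a \<le> d + a\<^sup>2 / d"
proof -
  have "0 \<le> (a - d)\<^sup>2" "0 \<le> a * d" using assms by auto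
  then have "a * d \<le> d * d + a\<^sup>2"
    unfolding power2_eq_square by (simp add: algebra_simps)
  then show ?thesis using assms by (simp add: field_simps)
qed

context prob_space begin

text \<open>
  \<open>Y\<close> is independent of \<open>G\<close> and centred Gaussian with variance \<open>v\<close>.  The two properties are packed into one family
  of identities between characteristic functions because such identities survive limits and sums without any
  manipulation of generated sigma-algebras; \<open>gauss_indep_law\<close> translates them back.
\<close>

definition gauss_indep :: "'a measure \<Rightarrow> ('a \<Rightarrow> real) \<Rightarrow> real \<Rightarrow> bool" where
  "gauss_indep G Y v \<longleftrightarrow> Y \<in> borel_measurable M \<and>
     (\<forall>g\<in>sets G. \<forall>u. (CLINT \<omega>|M. indicator g \<omega> *\<^sub>R iexp (u * Y \<omega>)) =
        complex_of_real (prob g * exp (- v * u\<^sup>2 / 2)))"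

lemma gauss_indepD:
  assumes "gauss_indep G Y v"
  shows "Y \<in> borel_measurable M"
    and "g \<in> sets G \<Longrightarrow> (CLINT \<omega>|M. indicator g \<omega> *\<^sub>R iexp (u * Y \<omega>)) =
        complex_of_real (prob g * exp (- v * u\<^sup>2 / 2))"
  using assms unfolding gauss_indep_def by auto

lemma gauss_indep_AE_cong:
  assumes Y: "gauss_indep G Y v" and Z: "Z \<in> borel_measurable M" and eq: "AE \<omega> in M. Y \<omega> = Z \<omega>"
    and sub: "subalgebra M G"
  shows "gauss_indep G Z v"
  unfolding gauss_indep_def
proof (intro conjI ballI allI)
  fix g u assume g: "g \<in> sets G"
  have [measurable]: "g \<in> sets M" "Y \<in> borel_measurable M" "Z \<in> borel_measurable M"
    using g sub Z gauss_indepD(1)[OF Y] by (auto simp: subalgebra_def)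
  have "(CLINT \<omega>|M. indicator g \<omega> *\<^sub>R iexp (u * Z \<omega>)) = (CLINT \<omega>|M. indicator g \<omega> *\<^sub>R iexp (u * Y \<omega>))"
    by (rule integral_cong_AE) (use eq in auto)
  then show "(CLINT \<omega>|M. indicator g \<omega> *\<^sub>R iexp (u * Z \<omega>)) = complex_of_real (prob g * exp (- v * u\<^sup>2 / 2))"
    using gauss_indepD(2)[OF Y g] by simp
qed (fact Z)

lemma gauss_indep_uminus:
  assumes "gauss_indep G Y v" shows "gauss_indep G (\<lambda>\<omega>. - Y \<omega>) v"
  unfolding gauss_indep_def
proof (intro conjI ballI allI)
  show "(\<lambda>\<omega>. - Y \<omega>) \<in> borel_measurable M" using gauss_indepD(1)[OF assms] by simp
  fix g u assume "g \<in> sets G"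
  from gauss_indepD(2)[OF assms this, of "-u"]
  show "(CLINT \<omega>|M. indicator g \<omega> *\<^sub>R iexp (u * - Y \<omega>)) = complex_of_real (prob g * exp (- v * u\<^sup>2 / 2))"
    by simp
qed

lemma gauss_indep_AE_limit:
  assumes sub: "subalgebra M G" and Z: "\<And>n. gauss_indep G (Z n) (v n)" and Y: "Y \<in> borel_measurable M"
    and lim: "AE \<omega> in M. (\<lambda>n. Z n \<omega>) \<longlonglongrightarrow> Y \<omega>" and v: "v \<longlonglongrightarrow> w"
  shows "gauss_indep G Y w"
  unfolding gauss_indep_def
proof (intro conjI ballI allI)
  fix g u assume g: "g \<in> sets G"
  have [measurable]: "g \<in> sets M" "\<And>n. Z n \<in> borel_measurable M" "Y \<in> borel_measurable M"
    using g sub Y gauss_indepD(1)[OF Z] by (auto simp: subalgebra_def)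
  have "(\<lambda>n. CLINT \<omega>|M. indicator g \<omega> *\<^sub>R iexp (u * Z n \<omega>)) \<longlonglongrightarrow> (CLINT \<omega>|M. indicator g \<omega> *\<^sub>R iexp (u * Y \<omega>))"
  proof (rule integral_dominated_convergence[where w="\<lambda>_. 1"])
    show "AE \<omega> in M. (\<lambda>n. indicator g \<omega> *\<^sub>R iexp (u * Z n \<omega>)) \<longlonglongrightarrow> indicator g \<omega> *\<^sub>R iexp (u * Y \<omega>)"
      using lim
    proof eventually_elim
      case (elim \<omega>)
      have "(\<lambda>n. complex_of_real (u * Z n \<omega>)) \<longlonglongrightarrow> complex_of_real (u * Y \<omega>)"
        by (intro tendsto_of_real tendsto_mult tendsto_const elim)
      then show ?case
        by (rule tendsto_scaleR[OF tendsto_const tendsto_exp[OF tendsto_mult[OF tendsto_const]]])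
    qed
  qed (auto simp: indicator_def)
  moreover have "(\<lambda>n. CLINT \<omega>|M. indicator g \<omega> *\<^sub>R iexp (u * Z n \<omega>)) \<longlonglongrightarrow> complex_of_real (prob g * exp (- w * u\<^sup>2 / 2))"
    unfolding gauss_indepD(2)[OF Z g] by (intro tendsto_intros v)
      (simp_all)
  ultimately show "(CLINT \<omega>|M. indicator g \<omega> *\<^sub>R iexp (u * Y \<omega>)) = complex_of_real (prob g * exp (- w * u\<^sup>2 / 2))"
    by (rule LIMSEQ_unique)
qed (fact Y)

text \<open>
  The map \<open>y \<mapsto> exp (\<i> u y)\<close> is Lipschitz, so convergence in \<open>L\<^sup>2\<close> carries over to the
  characteristic functions restricted to any event.
\<close>

lemma gauss_indep_L2_limit:
  assumes sub: "subalgebra M G" and Z: "\<And>n. gauss_indep G (Z n) v" and Y: "Y \<in> borel_measurable M"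
    and lim: "(\<lambda>n. \<integral>\<^sup>+\<omega>. ennreal ((Z n \<omega> - Y \<omega>)\<^sup>2) \<partial>M) \<longlonglongrightarrow> 0"
  shows "gauss_indep G Y v"
  unfolding gauss_indep_def
proof (intro conjI ballI allI)
  fix g u assume g: "g \<in> sets G"
  have [measurable]: "g \<in> sets M" "\<And>n. Z n \<in> borel_measurable M" "Y \<in> borel_measurable M"
    using g sub Y gauss_indepD(1)[OF Z] by (auto simp: subalgebra_def)
  let ?f = "\<lambda>y \<omega>. indicator g \<omega> *\<^sub>R iexp (u * y \<omega>)"
  have "(\<lambda>n. CLINT \<omega>|M. ?f (Z n) \<omega>) \<longlonglongrightarrow> (CLINT \<omega>|M. ?f Y \<omega>)"
  proof (rule tendsto_L1_int)
    show "integrable M (?f (Z n))" "integrable M (?f Y)" for n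
      by (auto intro!: integrable_const_bound[where B=1] simp: indicator_def)
    have bd: "(\<integral>\<^sup>+\<omega>. norm (?f (Z n) \<omega> - ?f Y \<omega>) \<partial>M) \<le>
        ennreal d + ennreal (u\<^sup>2 / d) * (\<integral>\<^sup>+\<omega>. ennreal ((Z n \<omega> - Y \<omega>)\<^sup>2) \<partial>M)" if "d > 0" for n d
    proof -
      have "(\<integral>\<^sup>+\<omega>. norm (?f (Z n) \<omega> - ?f Y \<omega>) \<partial>M) \<le>
         (\<integral>\<^sup>+\<omega>. ennreal d + ennreal (u\<^sup>2 / d) * ennreal ((Z n \<omega> - Y \<omega>)\<^sup>2) \<partial>M)"
      proof (rule nn_integral_mono)
        fix \<omega>
        let ?a = "\<bar>u * Z n \<omega> - u * Y \<omega>\<bar>"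
        have "norm (?f (Z n) \<omega> - ?f Y \<omega>) \<le> ?a"
          using norm_iexp_diff_le[of "u * Z n \<omega>" "u * Y \<omega>"] by (auto simp: indicator_def)
        \<comment> \<open>trade the first moment for the second one at the price of a small constant, instead of using Cauchy-Schwarz\<close>
        also have "?a \<le> d + ?a\<^sup>2 / d"
          using that by (intro le_add_square_divide) auto
        also have "?a\<^sup>2 = u\<^sup>2 * (Z n \<omega> - Y \<omega>)\<^sup>2"
          by (simp add: power_mult_distrib[symmetric] algebra_simps)
        finally have "norm (?f (Z n) \<omega> - ?f Y \<omega>) \<le> d + u\<^sup>2 / d * (Z n \<omega> - Y \<omega>)\<^sup>2" by simp
        then show "ennreal (norm (?f (Z n) \<omega> - ?f Y \<omega>)) \<le> ennreal d + ennreal (u\<^sup>2 / d) * ennreal ((Z n \<omega> - Y \<omega>)\<^sup>2)"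
          using that by (simp add: ennreal_plus[symmetric] ennreal_mult[symmetric] del: ennreal_plus)
      qed
      also have "\<dots> = ennreal d + ennreal (u\<^sup>2 / d) * (\<integral>\<^sup>+\<omega>. ennreal ((Z n \<omega> - Y \<omega>)\<^sup>2) \<partial>M)"
        by (subst nn_integral_add) (auto simp: nn_integral_cmult emeasure_space_1)
      finally show ?thesis .
    qed
    show "(\<lambda>n. \<integral>\<^sup>+\<omega>. norm (?f (Z n) \<omega> - ?f Y \<omega>) \<partial>M) \<longlonglongrightarrow> 0"
    proof (rule tendsto_0_if_Limsup_eq_0_ennreal)
      have "Limsup sequentially (\<lambda>n. \<integral>\<^sup>+\<omega>. norm (?f (Z n) \<omega> - ?f Y \<omega>) \<partial>M) \<le> ennreal d" if "d > 0" for d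
      proof -
        have "(\<lambda>n. ennreal d + ennreal (u\<^sup>2 / d) * (\<integral>\<^sup>+\<omega>. ennreal ((Z n \<omega> - Y \<omega>)\<^sup>2) \<partial>M))
          \<longlonglongrightarrow> ennreal d + ennreal (u\<^sup>2 / d) * 0"
          by (intro tendsto_intros lim ennreal_tendsto_cmult) auto
        then have "Limsup sequentially (\<lambda>n. ennreal d + ennreal (u\<^sup>2 / d) * (\<integral>\<^sup>+\<omega>. ennreal ((Z n \<omega> - Y \<omega>)\<^sup>2) \<partial>M)) = ennreal d"
          by (intro lim_imp_Limsup) auto
        moreover have "Limsup sequentially (\<lambda>n. \<integral>\<^sup>+\<omega>. norm (?f (Z n) \<omega> - ?f Y \<omega>) \<partial>M) \<le>
            Limsup sequentially (\<lambda>n. ennreal d + ennreal (u\<^sup>2 / d) * (\<integral>\<^sup>+\<omega>. ennreal ((Z n \<omega> - Y \<omega>)\<^sup>2) \<partial>M))"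
          by (rule Limsup_mono, rule always_eventually, rule allI, rule bd[OF that])
        ultimately show ?thesis by simp
      qed
      then have "Limsup sequentially (\<lambda>n. \<integral>\<^sup>+\<omega>. norm (?f (Z n) \<omega> - ?f Y \<omega>) \<partial>M) \<le> 0"
        by - (rule ennreal_le_epsilon, unfold add_0)
      then show "Limsup sequentially (\<lambda>n. \<integral>\<^sup>+\<omega>. norm (?f (Z n) \<omega> - ?f Y \<omega>) \<partial>M) = 0"
        by (rule le_zero_eq[THEN iffD1])
    qed
  qed
  then show "(CLINT \<omega>|M. ?f Y \<omega>) = complex_of_real (prob g * exp (- v * u\<^sup>2 / 2))"
    unfolding gauss_indepD(2)[OF Z g] by (rule LIMSEQ_unique) (rule tendsto_const)
qed (fact Y)

text \<open>
  Condition on \<open>g\<close>: under the conditional measure the characteristic function of \<open>Y\<close> is Gaussian, and Levy's uniqueness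
  theorem identifies the law.
\<close>

lemma gauss_indep_law:
  assumes sub: "subalgebra M G" and Y: "gauss_indep G Y v" and v: "0 \<le> v"
    and g: "g \<in> sets G" and S[measurable]: "S \<in> sets borel"
  shows "prob (g \<inter> {\<omega>\<in>space M. Y \<omega> \<in> S}) = prob g * std_gauss {x. sqrt v * x \<in> S}"
proof (cases "prob g = 0")
  case True
  have "g \<in> sets M" using g sub by (auto simp: subalgebra_def)
  then have "prob (g \<inter> {\<omega>\<in>space M. Y \<omega> \<in> S}) \<le> prob g" by (intro finite_measure_mono) auto
  then show ?thesis using True measure_nonneg[of M "g \<inter> {\<omega>\<in>space M. Y \<omega> \<in> S}"] by simp
next
  case False
  then have pos: "prob g > 0" by (simp add: zero_less_measure_iff)
  have [measurable]: "g \<in> sets M" "Y \<in> borel_measurable M"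
    using g sub gauss_indepD(1)[OF Y] by (auto simp: subalgebra_def)
  let ?U = "uniform_measure M g"
  let ?N = "distr std_normal_distribution borel (\<lambda>x. sqrt v * x)"
  interpret U: prob_space ?U
    by (rule prob_space_uniform_measure) (use pos in \<open>auto simp: emeasure_eq_measure\<close>)
  interpret N: real_distribution std_normal_distribution by (rule real_dist_normal_dist)
  have "distr ?U borel Y = ?N"
  proof (rule Levy_uniqueness)
    show "real_distribution (distr ?U borel Y)"
      by (rule U.real_distribution_distr) simp
    show "real_distribution ?N"
      by (rule N.real_distribution_distr) simp
    show "char (distr ?U borel Y) = char ?N"
    proof
      fix u
      have "char (distr ?U borel Y) u = (CLINT \<omega>|?U. iexp (u * Y \<omega>))"
        unfolding char_def by (subst integral_distr) auto
      also have "\<dots> = (CLINT \<omega>|density M (\<lambda>\<omega>. ennreal (indicator g \<omega> / prob g)). iexp (u * Y \<omega>))"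
      proof (rule arg_cong[where f="\<lambda>N. CLINT \<omega>|N. iexp (u * Y \<omega>)"])
        show "?U = density M (\<lambda>\<omega>. ennreal (indicator g \<omega> / prob g))"
        unfolding uniform_measure_def
        by (rule density_cong) (use pos in \<open>auto simp: emeasure_eq_measure indicator_def divide_ennreal[symmetric]\<close>)
      qed
      also have "\<dots> =
          (CLINT \<omega>|M. (1 / prob g) *\<^sub>R (indicator g \<omega> *\<^sub>R iexp (u * Y \<omega>)))"
        by (subst integral_density) (use pos in auto)
      also have "\<dots> = (1 / prob g) *\<^sub>R complex_of_real (prob g * exp (- v * u\<^sup>2 / 2))"
        using gauss_indepD(2)[OF Y g] by (subst integral_scaleR_right) simp
      also have "\<dots> = complex_of_real (exp (- v * u\<^sup>2 / 2))"
        using pos by (simp add: scaleR_conv_of_real)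
      also have "\<dots> = char std_normal_distribution (u * sqrt v)"
        using v by (simp add: char_std_normal_distribution power_mult_distrib mult.commute)
      also have "\<dots> = char ?N u"
        unfolding char_def by (subst integral_distr) (auto simp: mult.assoc)
      finally show "char (distr ?U borel Y) u = char ?N u" .
    qed
  qed
  then have "measure (distr ?U borel Y) S = measure ?N S" by simp
  then have "measure ?U (Y -` S \<inter> space M) = std_gauss {x. sqrt v * x \<in> S}"
    by (subst (asm) measure_distr, simp, simp, subst (asm) measure_distr)
       (auto simp: vimage_def)
  moreover have "measure ?U (Y -` S \<inter> space M) = prob (g \<inter> (Y -` S \<inter> space M)) / prob g"
    by (rule measure_uniform_measure) (use pos in \<open>auto simp: emeasure_eq_measure\<close>)
  moreover have "Y -` S \<inter> space M = {\<omega>\<in>space M. Y \<omega> \<in> S}" by auto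
  ultimately show ?thesis using pos by (simp add: field_simps)
qed

end

section \<open>Brownian increments and the Ito isometry\<close>

context brownian_motion begin

lemma F_mono: "0 \<le> s \<Longrightarrow> s \<le> t \<Longrightarrow> subalgebra (F t) (F s)"
  using sets_F_mono[of s t] by (auto simp: subalgebra_def space_F)

lemma measurable_F_mono: "f \<in> measurable (F s) N \<Longrightarrow> 0 \<le> s \<Longrightarrow> s \<le> t \<Longrightarrow> f \<in> measurable (F t) N"
  by (rule measurable_from_subalg[OF F_mono])

lemma measurable_F_M: "f \<in> measurable (F s) N \<Longrightarrow> 0 \<le> s \<Longrightarrow> f \<in> measurable M N"
  by (rule measurable_from_subalg[OF F_subalgebra])

lemma increment_measurable:
  "0 \<le> s \<Longrightarrow> s \<le> t \<Longrightarrow> (\<lambda>\<omega>. W t \<omega> - W s \<omega>) \<in> borel_measurable M"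
  by (intro borel_measurable_diff measurable_F_M[OF W_adapted]) auto

lemma indep_increment:
  fixes Z :: "'a \<Rightarrow> 'b::topological_space" and \<phi> :: "real \<Rightarrow> 'b"
  assumes Z: "Z \<in> borel_measurable (F s)" and s: "0 \<le> s" "s < t"
    and \<phi>[measurable]: "\<phi> \<in> borel_measurable borel"
  shows "indep_var borel Z borel (\<lambda>\<omega>. \<phi> (W t \<omega> - W s \<omega>))"
  unfolding indep_var_eq
proof (intro conjI)
  let ?D = "\<lambda>\<omega>. W t \<omega> - W s \<omega>"
  show "random_variable borel Z" by (rule measurable_F_M[OF Z s(1)])
  have [measurable]: "random_variable borel ?D" using s by (intro increment_measurable) auto
  show "random_variable borel (\<lambda>\<omega>. \<phi> (?D \<omega>))" by measurable
  have "indep_set (sigma_sets (space M) (sets (F s)))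
     (sigma_sets (space M) {?D -` S \<inter> space M | S. S \<in> sets borel})"
  proof (rule indep_set_sigma_sets[OF W_indep[OF s]])
    show "Int_stable (sets (F s))" by (rule sets.Int_stable)
    show "Int_stable {?D -` S \<inter> space M | S. S \<in> sets borel}"
    proof (rule Int_stableI, clarsimp)
      fix S T :: "real set" assume "S \<in> sets borel" "T \<in> sets borel"
      then show "\<exists>U. ?D -` S \<inter> space M \<inter> (?D -` T \<inter> space M) = ?D -` U \<inter> space M \<and> U \<in> sets borel"
        by (intro exI[of _ "S \<inter> T"]) auto
    qed
  qed
  moreover have "sigma_sets (space M) {Z -` A \<inter> space M |A. A \<in> sets borel} \<subseteq> sigma_sets (space M) (sets (F s))"
  proof (rule sigma_sets_subseteq)
    show "{Z -` A \<inter> space M |A. A \<in> sets borel} \<subseteq> sets (F s)"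
      using measurable_sets[OF Z] by (auto simp: space_F)
  qed
  moreover have "sigma_sets (space M) {(\<lambda>\<omega>. \<phi> (?D \<omega>)) -` A \<inter> space M |A. A \<in> sets borel} \<subseteq>
      sigma_sets (space M) {?D -` S \<inter> space M | S. S \<in> sets borel}"
  proof (rule sigma_sets_subseteq, clarify)
    fix A :: "'b set" assume "A \<in> sets borel"
    then have "\<phi> -` A \<in> sets borel" using measurable_sets[OF \<phi>, of A] by simp
    then show "\<exists>S. (\<lambda>\<omega>. \<phi> (?D \<omega>)) -` A \<inter> space M = ?D -` S \<inter> space M \<and> S \<in> sets borel"
      by (intro exI[of _ "\<phi> -` A"]) auto
  qed
  ultimately show "indep_set (sigma_sets (space M) {Z -` A \<inter> space M |A. A \<in> sets borel})
     (sigma_sets (space M) {(\<lambda>\<omega>. \<phi> (?D \<omega>)) -` A \<inter> space M | A. A \<in> sets borel})"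
    unfolding indep_sets2_eq by blast
qed

lemma increment_char:
  assumes s: "0 \<le> s" "s < t"
  shows "(CLINT \<omega>|M. iexp (u * (W t \<omega> - W s \<omega>))) = complex_of_real (exp (- (t - s) * u\<^sup>2 / 2))"
proof -
  let ?\<sigma> = "sqrt (t - s)" and ?D = "\<lambda>\<omega>. W t \<omega> - W s \<omega>"
  have [measurable]: "?D \<in> borel_measurable M" using s by (intro increment_measurable) auto
  have \<sigma>: "?\<sigma> > 0" using s by simp
  have "distributed M lborel (\<lambda>\<omega>. ?D \<omega> / ?\<sigma>) std_normal_density"
    using W_increment[OF s] normal_standard_normal_convert[OF \<sigma>, of ?D 0] by simp
  then have eq: "distr M lborel (\<lambda>\<omega>. ?D \<omega> / ?\<sigma>) = std_normal_distribution"
    by (rule distributed_distr_eq_density)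
  have "(CLINT \<omega>|M. iexp (u * ?D \<omega>)) = (CLINT \<omega>|M. iexp ((u * ?\<sigma>) * (?D \<omega> / ?\<sigma>)))"
    using \<sigma> by simp
  also have "\<dots> = (CLINT x|distr M lborel (\<lambda>\<omega>. ?D \<omega> / ?\<sigma>). iexp ((u * ?\<sigma>) * x))"
    by (subst integral_distr) auto
  also have "\<dots> = char std_normal_distribution (u * ?\<sigma>)"
    unfolding eq char_def ..
  also have "\<dots> = complex_of_real (exp (- (t - s) * u\<^sup>2 / 2))"
    using s by (simp add: char_std_normal_distribution power_mult_distrib field_simps)
  finally show ?thesis .
qed

text \<open>
  The next increment is independent of everything up to time \<open>r\<close>, in particular of \<open>Y\<close> together with \<open>F s\<close>, so the
  characteristic functions multiply.
\<close>

lemma gauss_indep_add_increment: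
  assumes Y: "gauss_indep (F s) Y v" "Y \<in> borel_measurable (F r)" and r: "0 \<le> s" "s \<le> r" "r \<le> t"
  shows "gauss_indep (F s) (\<lambda>\<omega>. Y \<omega> + c * (W t \<omega> - W r \<omega>)) (v + c\<^sup>2 * (t - r))"
proof (cases "r = t")
  case False
  then have rt: "0 \<le> r" "r < t" using r by auto
  let ?D = "\<lambda>\<omega>. W t \<omega> - W r \<omega>"
  have Ym[measurable]: "Y \<in> borel_measurable M" using gauss_indepD(1)[OF Y(1)] .
  have Dm[measurable]: "?D \<in> borel_measurable M" using rt by (intro increment_measurable) auto
  show ?thesis
    unfolding gauss_indep_def
  proof (intro conjI ballI allI)
    show "(\<lambda>\<omega>. Y \<omega> + c * ?D \<omega>) \<in> borel_measurable M" by measurable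
    fix g u assume g: "g \<in> sets (F s)"
    have gr: "g \<in> sets (F r)" using g F_mono[OF r(1,2)] by (auto simp: subalgebra_def)
    have gM[measurable]: "g \<in> sets M" using g F_subalgebra[OF r(1)] by (auto simp: subalgebra_def)
    let ?Z = "\<lambda>\<omega>. indicator g \<omega> *\<^sub>R iexp (u * Y \<omega>)"
    have Z: "?Z \<in> borel_measurable (F r)" using gr Y(2) by measurable
    have ind: "indep_var borel ?Z borel (\<lambda>\<omega>. iexp (u * c * ?D \<omega>))"
      by (rule indep_increment[OF Z rt]) simp
    have "(CLINT \<omega>|M. indicator g \<omega> *\<^sub>R iexp (u * (Y \<omega> + c * ?D \<omega>))) = (CLINT \<omega>|M. ?Z \<omega> * iexp (u * c * ?D \<omega>))"
      by (rule Bochner_Integration.integral_cong)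
        (auto simp: mult_exp_exp distrib_left mult.left_commute mult.commute mult.assoc)
    also have "\<dots> = (CLINT \<omega>|M. ?Z \<omega>) * (CLINT \<omega>|M. iexp (u * c * ?D \<omega>))"
    proof (rule indep_var_lebesgue_integral[OF ind])
      show "integrable M ?Z"
        by (rule integrable_const_bound[where B=1]) (auto simp: indicator_def)
      show "integrable M (\<lambda>\<omega>. iexp (u * c * ?D \<omega>))"
      proof (rule integrable_const_bound[where B=1])
        show "(\<lambda>\<omega>. iexp (u * c * ?D \<omega>)) \<in> borel_measurable M" by measurable
      qed simp
    qed
    also have "\<dots> = complex_of_real (prob g * exp (- v * u\<^sup>2 / 2)) * complex_of_real (exp (- (t - r) * (u * c)\<^sup>2 / 2))"
      unfolding gauss_indepD(2)[OF Y(1) g] increment_char[OF rt] ..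
    also have "\<dots> = complex_of_real (prob g * exp (- (v + c\<^sup>2 * (t - r)) * u\<^sup>2 / 2))"
      unfolding of_real_mult[symmetric] mult.assoc exp_add[symmetric]
      by (simp add: power_mult_distrib field_simps)
    finally show "(CLINT \<omega>|M. indicator g \<omega> *\<^sub>R iexp (u * (Y \<omega> + c * ?D \<omega>))) =
       complex_of_real (prob g * exp (- (v + c\<^sup>2 * (t - r)) * u\<^sup>2 / 2))" .
  qed
qed (use Y in simp)

lemma increment_moments:
  assumes s: "0 \<le> s" "s \<le> t"
  shows "integrable M (\<lambda>\<omega>. W t \<omega> - W s \<omega>)" "expectation (\<lambda>\<omega>. W t \<omega> - W s \<omega>) = 0"
    and "integrable M (\<lambda>\<omega>. (W t \<omega> - W s \<omega>)\<^sup>2)" "expectation (\<lambda>\<omega>. (W t \<omega> - W s \<omega>)\<^sup>2) = t - s"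
proof -
  let ?D = "\<lambda>\<omega>. W t \<omega> - W s \<omega>"
  have "integrable M ?D \<and> expectation ?D = 0 \<and> integrable M (\<lambda>\<omega>. (?D \<omega>)\<^sup>2) \<and> expectation (\<lambda>\<omega>. (?D \<omega>)\<^sup>2) = t - s"
  proof (cases "s = t")
    case False
    then have st: "0 \<le> s" "s < t" using s by auto
    then have \<sigma>: "sqrt (t - s) > 0" by simp
    note D = W_increment[OF st]
    have "integrable M ?D"
      using distributed_integrable[OF D, of "\<lambda>x. x"] integrable_normal_moment[OF \<sigma>, of 0 1] by simp
    moreover have "integrable M (\<lambda>\<omega>. (?D \<omega>)\<^sup>2)"
      using distributed_integrable[OF D, of "\<lambda>x. x\<^sup>2"] integrable_normal_moment[OF \<sigma>, of 0 2] by simp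
    moreover have "expectation ?D = 0" by (rule normal_distributed_expectation[OF \<sigma> D])
    moreover have "variance ?D = t - s" using normal_distributed_variance[OF \<sigma> D] st by simp
    ultimately show ?thesis by simp
  qed simp
  then show "integrable M ?D" "expectation ?D = 0" "integrable M (\<lambda>\<omega>. (?D \<omega>)\<^sup>2)" "expectation (\<lambda>\<omega>. (?D \<omega>)\<^sup>2) = t - s"
    by auto
qed

lemma increment_orthogonal:
  assumes Z: "Z \<in> borel_measurable (F s)" "integrable M Z" and s: "0 \<le> s" "s \<le> t"
  shows "expectation (\<lambda>\<omega>. Z \<omega> * (W t \<omega> - W s \<omega>)) = 0"
proof (cases "s = t")
  case False
  then have st: "0 \<le> s" "s < t" using s by auto
  show ?thesis
    using indep_var_lebesgue_integral[OF indep_increment[OF Z(1) st, of "\<lambda>x. x"] Z(2) increment_moments(1)[OF s]]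
    by (simp add: increment_moments(2)[OF s])
qed simp

lemma increment_square:
  assumes Z: "Z \<in> borel_measurable (F s)" "integrable M Z" and s: "0 \<le> s" "s \<le> t"
  shows "expectation (\<lambda>\<omega>. Z \<omega> * (W t \<omega> - W s \<omega>)\<^sup>2) = expectation Z * (t - s)"
proof (cases "s = t")
  case False
  then have st: "0 \<le> s" "s < t" using s by auto
  have "indep_var borel Z borel (\<lambda>\<omega>. (W t \<omega> - W s \<omega>)\<^sup>2)"
    by (rule indep_increment[OF Z(1) st]) simp
  from indep_var_lebesgue_integral[OF this Z(2) increment_moments(3)[OF s]]
  show ?thesis by (simp add: increment_moments(4)[OF s])
qed simp

lemma increments_product_integrable:
  assumes Z: "Z \<in> borel_measurable M" "\<And>\<omega>. \<omega> \<in> space M \<Longrightarrow> \<bar>Z \<omega>\<bar> \<le> C"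
    and s: "0 \<le> a" "a \<le> b" "0 \<le> c" "c \<le> d"
  shows "integrable M (\<lambda>\<omega>. Z \<omega> * (W b \<omega> - W a \<omega>) * (W d \<omega> - W c \<omega>))"
proof (rule Bochner_Integration.integrable_bound)
  show "integrable M (\<lambda>\<omega>. C * ((W b \<omega> - W a \<omega>)\<^sup>2 + (W d \<omega> - W c \<omega>)\<^sup>2))"
    using increment_moments(3)[OF s(1,2)] increment_moments(3)[OF s(3,4)] by auto
  show "(\<lambda>\<omega>. Z \<omega> * (W b \<omega> - W a \<omega>) * (W d \<omega> - W c \<omega>)) \<in> borel_measurable M"
    using s Z(1) by (intro borel_measurable_times increment_measurable)
  show "AE \<omega> in M. norm (Z \<omega> * (W b \<omega> - W a \<omega>) * (W d \<omega> - W c \<omega>)) \<le>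
      norm (C * ((W b \<omega> - W a \<omega>)\<^sup>2 + (W d \<omega> - W c \<omega>)\<^sup>2))"
  proof (rule AE_I2)
    fix \<omega> assume \<omega>: "\<omega> \<in> space M"
    let ?x = "W b \<omega> - W a \<omega>" and ?y = "W d \<omega> - W c \<omega>"
    have "\<bar>?x\<bar> * \<bar>?y\<bar> \<le> ?x\<^sup>2 + ?y\<^sup>2"
      using sum_squares_bound[of "\<bar>?x\<bar>" "\<bar>?y\<bar>"] mult_nonneg_nonneg[of "\<bar>?x\<bar>" "\<bar>?y\<bar>"]
      unfolding power2_abs by linarith
    then have "\<bar>Z \<omega>\<bar> * (\<bar>?x\<bar> * \<bar>?y\<bar>) \<le> \<bar>C\<bar> * (?x\<^sup>2 + ?y\<^sup>2)"
      using Z(2)[OF \<omega>] by (intro mult_mono) auto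
    then show "norm (Z \<omega> * ?x * ?y) \<le> norm (C * (?x\<^sup>2 + ?y\<^sup>2))" by (simp add: abs_mult mult.assoc)
  qed
qed

text \<open>
  Overlapping increments are cut at the end points of the common interval.  Pieces over disjoint intervals are orthogonal,
  because the later one is independent of the past; the common piece contributes its length.
\<close>

lemma increments_covariance_ordered:
  assumes Z: "Z \<in> borel_measurable (F c)" "\<And>\<omega>. \<omega> \<in> space M \<Longrightarrow> \<bar>Z \<omega>\<bar> \<le> C"
    and ab: "0 \<le> a" "a \<le> b" and cd: "a \<le> c" "c \<le> d"
  shows "expectation (\<lambda>\<omega>. Z \<omega> * (W b \<omega> - W a \<omega>) * (W d \<omega> - W c \<omega>)) =
    expectation Z * measure lborel ({a<..b} \<inter> {c<..d})"
proof -
  have c0: "0 \<le> c" using ab cd by simp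
  have ZM: "Z \<in> borel_measurable M" by (rule measurable_F_M[OF Z(1) c0])
  have iZ: "integrable M Z" by (rule integrable_const_bound[where B=C]) (use Z ZM in auto)
  define e where "e = max c (min b d)"
  have e: "c \<le> e" "e \<le> d" using cd by (auto simp: e_def)
  have int: "integrable M (\<lambda>\<omega>. Z \<omega> * (W y \<omega> - W x \<omega>) * (W y' \<omega> - W x' \<omega>))"
    if "0 \<le> x" "x \<le> y" "0 \<le> x'" "x' \<le> y'" for x y x' y'
    by (rule increments_product_integrable[OF ZM Z(2)]) (use that in auto)
  have iZW: "integrable M (\<lambda>\<omega>. Z \<omega> * (W y \<omega> - W x \<omega>))" if "0 \<le> x" "x \<le> y" for x y
  proof (rule Bochner_Integration.integrable_bound)
    show "integrable M (\<lambda>\<omega>. C * (W y \<omega> - W x \<omega>))" using increment_moments(1)[OF that] by simp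
    show "(\<lambda>\<omega>. Z \<omega> * (W y \<omega> - W x \<omega>)) \<in> borel_measurable M"
      by (intro borel_measurable_times ZM increment_measurable that)
    show "AE \<omega> in M. norm (Z \<omega> * (W y \<omega> - W x \<omega>)) \<le> norm (C * (W y \<omega> - W x \<omega>))"
      using Z(2) by (intro AE_I2) (fastforce simp: abs_mult intro!: mult_right_mono)
  qed
  have adapted: "(\<lambda>\<omega>. Z \<omega> * (W y \<omega> - W x \<omega>)) \<in> borel_measurable (F r)"
    if "0 \<le> x" "x \<le> y" "y \<le> r" "c \<le> r" for x y r
    using that c0 by (intro borel_measurable_times borel_measurable_diff measurable_F_mono[OF Z(1)]
      measurable_F_mono[OF W_adapted]) auto
  have orth: "expectation (\<lambda>\<omega>. Z \<omega> * (W y \<omega> - W x \<omega>) * (W y' \<omega> - W x' \<omega>)) = 0"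
    if "0 \<le> x" "x \<le> y" "y \<le> x'" "c \<le> x'" "x' \<le> y'" for x y x' y'
    by (rule increment_orthogonal[OF adapted iZW]) (use that in auto)
  show ?thesis
  proof (cases "b \<le> c")
    case True
    then have "{a<..b} \<inter> {c<..d} = {}" by auto
    then show ?thesis using orth[of a b c d] True ab cd by simp
  next
    case False
    then have e': "e = min b d" "e \<le> b" using cd by (auto simp: e_def)
    have "{a<..b} \<inter> {c<..d} = {c<..e}" using e e' cd by auto
    then have meas: "measure lborel ({a<..b} \<inter> {c<..d}) = e - c" using e by simp
    \<comment> \<open>after time e at most one of the two intervals continues, so no product of two later pieces remains\<close>
    have eq: "Z \<omega> * (W b \<omega> - W a \<omega>) * (W d \<omega> - W c \<omega>) =
       Z \<omega> * (W c \<omega> - W a \<omega>) * (W d \<omega> - W c \<omega>) + Z \<omega> * (W e \<omega> - W c \<omega>) * (W e \<omega> - W c \<omega>)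
       + Z \<omega> * (W e \<omega> - W c \<omega>) * (W d \<omega> - W e \<omega>) + Z \<omega> * (W e \<omega> - W c \<omega>) * (W b \<omega> - W e \<omega>)" for \<omega>
    proof -
      have "(W b \<omega> - W e \<omega>) * (W d \<omega> - W e \<omega>) = 0" using e' by (auto simp: min_def)
      then have "Z \<omega> * ((W b \<omega> - W e \<omega>) * (W d \<omega> - W e \<omega>)) = 0" by simp
      then show ?thesis by (simp add: algebra_simps)
    qed
    have "expectation (\<lambda>\<omega>. Z \<omega> * (W b \<omega> - W a \<omega>) * (W d \<omega> - W c \<omega>)) =
      expectation (\<lambda>\<omega>. Z \<omega> * (W c \<omega> - W a \<omega>) * (W d \<omega> - W c \<omega>))
      + expectation (\<lambda>\<omega>. Z \<omega> * (W e \<omega> - W c \<omega>) * (W e \<omega> - W c \<omega>))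
      + expectation (\<lambda>\<omega>. Z \<omega> * (W e \<omega> - W c \<omega>) * (W d \<omega> - W e \<omega>))
      + expectation (\<lambda>\<omega>. Z \<omega> * (W e \<omega> - W c \<omega>) * (W b \<omega> - W e \<omega>))"
      unfolding eq using ab cd c0 e e'
      by (subst Bochner_Integration.integral_add, (intro Bochner_Integration.integrable_add int; simp), (intro int; simp))+ simp
    also have "expectation (\<lambda>\<omega>. Z \<omega> * (W c \<omega> - W a \<omega>) * (W d \<omega> - W c \<omega>)) = 0"
      by (rule orth) (use ab cd in auto)
    also have "expectation (\<lambda>\<omega>. Z \<omega> * (W e \<omega> - W c \<omega>) * (W d \<omega> - W e \<omega>)) = 0"
      by (rule orth) (use c0 e in auto)
    also have "expectation (\<lambda>\<omega>. Z \<omega> * (W e \<omega> - W c \<omega>) * (W b \<omega> - W e \<omega>)) = 0"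
      by (rule orth) (use c0 e e' in auto)
    also have "expectation (\<lambda>\<omega>. Z \<omega> * (W e \<omega> - W c \<omega>) * (W e \<omega> - W c \<omega>)) = expectation Z * (e - c)"
      using increment_square[OF Z(1) iZ c0 e(1)] by (simp add: power2_eq_square mult.assoc)
    finally show ?thesis unfolding meas by simp
  qed
qed

lemma increments_covariance:
  assumes \<xi>: "\<xi> \<in> borel_measurable (F a)" "\<And>\<omega>. \<omega> \<in> space M \<Longrightarrow> \<bar>\<xi> \<omega>\<bar> \<le> C"
    and \<eta>: "\<eta> \<in> borel_measurable (F c)" "\<And>\<omega>. \<omega> \<in> space M \<Longrightarrow> \<bar>\<eta> \<omega>\<bar> \<le> C'"
    and ab: "0 \<le> a" "a \<le> b" and cd: "0 \<le> c" "c \<le> d"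
  shows "expectation (\<lambda>\<omega>. \<xi> \<omega> * (W b \<omega> - W a \<omega>) * (\<eta> \<omega> * (W d \<omega> - W c \<omega>))) =
    expectation (\<lambda>\<omega>. \<xi> \<omega> * \<eta> \<omega>) * measure lborel ({a<..b} \<inter> {c<..d})"
    and "integrable M (\<lambda>\<omega>. \<xi> \<omega> * (W b \<omega> - W a \<omega>) * (\<eta> \<omega> * (W d \<omega> - W c \<omega>)))"
proof -
  let ?Z = "\<lambda>\<omega>. \<xi> \<omega> * \<eta> \<omega>"
  have bd: "\<bar>?Z \<omega>\<bar> \<le> C * C'" if "\<omega> \<in> space M" for \<omega>
    using \<xi>(2)[OF that] \<eta>(2)[OF that] by (auto simp: abs_mult intro!: mult_mono)
  have eq1: "\<xi> \<omega> * (W b \<omega> - W a \<omega>) * (\<eta> \<omega> * (W d \<omega> - W c \<omega>)) = ?Z \<omega> * (W b \<omega> - W a \<omega>) * (W d \<omega> - W c \<omega>)"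
    and eq2: "?Z \<omega> * (W b \<omega> - W a \<omega>) * (W d \<omega> - W c \<omega>) = ?Z \<omega> * (W d \<omega> - W c \<omega>) * (W b \<omega> - W a \<omega>)" for \<omega>
    by simp_all
  have m: "?Z \<in> borel_measurable (F r)" if "a \<le> r" "c \<le> r" for r
    using that ab cd by (intro borel_measurable_times measurable_F_mono[OF \<xi>(1)] measurable_F_mono[OF \<eta>(1)])
  have mM: "?Z \<in> borel_measurable M"
    using ab cd by (intro borel_measurable_times measurable_F_M[OF \<xi>(1)] measurable_F_M[OF \<eta>(1)])
  show "integrable M (\<lambda>\<omega>. \<xi> \<omega> * (W b \<omega> - W a \<omega>) * (\<eta> \<omega> * (W d \<omega> - W c \<omega>)))"
    unfolding eq1 by (rule increments_product_integrable[OF mM bd ab cd])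
  show "expectation (\<lambda>\<omega>. \<xi> \<omega> * (W b \<omega> - W a \<omega>) * (\<eta> \<omega> * (W d \<omega> - W c \<omega>))) =
    expectation ?Z * measure lborel ({a<..b} \<inter> {c<..d})"
  proof (cases "a \<le> c")
    case True
    show ?thesis unfolding eq1
      by (rule increments_covariance_ordered[OF m bd ab True cd(2)]) (use True in auto)
  next
    case False
    then have "c \<le> a" by simp
    have "{a<..b} \<inter> {c<..d} = {c<..d} \<inter> {a<..b}" by auto
    then show ?thesis unfolding eq1 eq2 using \<open>c \<le> a\<close>
      by (simp only: increments_covariance_ordered[OF m bd cd \<open>c \<le> a\<close> ab(2)])
  qed
qed

text \<open>
  The isometry is stated for an arbitrary finite family of weighted intervals, which may overlap: both sides are quadratic
  forms in the weights, and \<open>increments_covariance\<close> compares them entry by entry.  No common refinement of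
  partitions is needed in order to compare two step functions.
\<close>

lemma ito_isometry:
  assumes K: "finite K" and \<zeta>: "\<And>i. i \<in> K \<Longrightarrow> \<zeta> i \<in> borel_measurable (F (a i))"
    "\<And>i. i \<in> K \<Longrightarrow> \<exists>C. \<forall>\<omega>\<in>space M. \<bar>\<zeta> i \<omega>\<bar> \<le> C"
    and ab: "\<And>i. i \<in> K \<Longrightarrow> 0 \<le> a i" "\<And>i. i \<in> K \<Longrightarrow> a i \<le> b i"
  shows "(\<integral>\<^sup>+\<omega>. ennreal ((\<Sum>i\<in>K. \<zeta> i \<omega> * (W (b i) \<omega> - W (a i) \<omega>))\<^sup>2) \<partial>M) =
    (\<integral>\<^sup>+\<omega>. (\<integral>\<^sup>+s. ennreal ((\<Sum>i\<in>K. \<zeta> i \<omega> * indicator {a i<..b i} s)\<^sup>2) \<partial>lborel) \<partial>M)"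
proof -
  from \<zeta>(2) obtain C where C: "\<And>i \<omega>. i \<in> K \<Longrightarrow> \<omega> \<in> space M \<Longrightarrow> \<bar>\<zeta> i \<omega>\<bar> \<le> C i" by metis
  have \<zeta>M: "\<zeta> i \<in> borel_measurable M" if "i \<in> K" for i
    by (rule measurable_F_M[OF \<zeta>(1)]) (use that ab in auto)
  let ?l = "\<lambda>i j. measure lborel ({a i<..b i} \<inter> {a j<..b j})"
  let ?D = "\<lambda>i \<omega>. \<zeta> i \<omega> * (W (b i) \<omega> - W (a i) \<omega>)"
  have fin: "emeasure lborel ({a i<..b i} \<inter> {a j<..b j}) \<noteq> \<infinity>" if "i \<in> K" for i j
  proof -
    have "emeasure lborel ({a i<..b i} \<inter> {a j<..b j}) \<le> emeasure lborel {a i<..b i}"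
      by (rule emeasure_mono) auto
    then show ?thesis using ab(2)[OF that] by (auto simp: top_unique)
  qed
  note cov = increments_covariance[OF \<zeta>(1) C \<zeta>(1) C ab(1) ab(2) ab(1) ab(2)]
  have sq1: "(\<Sum>i\<in>K. ?D i \<omega>)\<^sup>2 = (\<Sum>i\<in>K. \<Sum>j\<in>K. ?D i \<omega> * ?D j \<omega>)" for \<omega>
    by (simp add: power2_eq_square sum_product)
  have int1: "integrable M (\<lambda>\<omega>. (\<Sum>i\<in>K. ?D i \<omega>)\<^sup>2)"
    unfolding sq1 by (intro Bochner_Integration.integrable_sum cov(2))
  have "expectation (\<lambda>\<omega>. (\<Sum>i\<in>K. ?D i \<omega>)\<^sup>2) = (\<Sum>i\<in>K. \<Sum>j\<in>K. expectation (\<lambda>\<omega>. ?D i \<omega> * ?D j \<omega>))"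
    unfolding sq1 by (subst Bochner_Integration.integral_sum,
        (intro Bochner_Integration.integrable_sum cov(2); assumption))
      (intro sum.cong refl Bochner_Integration.integral_sum cov(2))
  also have "\<dots> = (\<Sum>i\<in>K. \<Sum>j\<in>K. expectation (\<lambda>\<omega>. \<zeta> i \<omega> * \<zeta> j \<omega>) * ?l i j)"
    by (intro sum.cong refl cov(1))
  also have "\<dots> = expectation (\<lambda>\<omega>. \<Sum>i\<in>K. \<Sum>j\<in>K. \<zeta> i \<omega> * \<zeta> j \<omega> * ?l i j)"
  proof -
    have "integrable M (\<lambda>\<omega>. \<zeta> i \<omega> * \<zeta> j \<omega>)" if "i \<in> K" "j \<in> K" for i j
      by (rule integrable_const_bound[where B="C i * C j"])
        (use that C \<zeta>M in \<open>auto simp: abs_mult intro!: mult_mono AE_I2 borel_measurable_times intro: order_trans[OF abs_ge_zero]\<close>)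
    then show ?thesis
      by (subst Bochner_Integration.integral_sum; (intro Bochner_Integration.integrable_sum)?; simp)
  qed
  finally have E: "expectation (\<lambda>\<omega>. (\<Sum>i\<in>K. ?D i \<omega>)\<^sup>2) = expectation (\<lambda>\<omega>. \<Sum>i\<in>K. \<Sum>j\<in>K. \<zeta> i \<omega> * \<zeta> j \<omega> * ?l i j)" .
  have inner: "(\<integral>\<^sup>+s. ennreal ((\<Sum>i\<in>K. \<zeta> i \<omega> * indicator {a i<..b i} s)\<^sup>2) \<partial>lborel) =
      ennreal (\<Sum>i\<in>K. \<Sum>j\<in>K. \<zeta> i \<omega> * \<zeta> j \<omega> * ?l i j) \<and> 0 \<le> (\<Sum>i\<in>K. \<Sum>j\<in>K. \<zeta> i \<omega> * \<zeta> j \<omega> * ?l i j)" for \<omega>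
  proof -
    have sq2: "(\<Sum>i\<in>K. \<zeta> i \<omega> * indicator {a i<..b i} s)\<^sup>2 =
       (\<Sum>i\<in>K. \<Sum>j\<in>K. \<zeta> i \<omega> * \<zeta> j \<omega> * indicator ({a i<..b i} \<inter> {a j<..b j}) s)" for s :: real
      unfolding power2_eq_square sum_product indicator_inter_arith by (simp only: mult_ac)
    have i2: "integrable lborel (\<lambda>s. \<zeta> i \<omega> * \<zeta> j \<omega> * indicator ({a i<..b i} \<inter> {a j<..b j}) s)" if "i \<in> K" for i j
      by (intro integrable_mult_right integrable_real_indicator) (use fin[OF that, of j] in \<open>auto simp: less_top\<close>)
    have i3: "integrable lborel (\<lambda>s. (\<Sum>i\<in>K. \<zeta> i \<omega> * indicator {a i<..b i} s)\<^sup>2)"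
      unfolding sq2 by (intro Bochner_Integration.integrable_sum i2)
    have i4: "(\<integral>s. (\<Sum>i\<in>K. \<zeta> i \<omega> * indicator {a i<..b i} s)\<^sup>2 \<partial>lborel) = (\<Sum>i\<in>K. \<Sum>j\<in>K. \<zeta> i \<omega> * \<zeta> j \<omega> * ?l i j)"
      unfolding sq2 by (subst Bochner_Integration.integral_sum,
        (intro Bochner_Integration.integrable_sum i2; assumption))
        (intro sum.cong refl, subst Bochner_Integration.integral_sum, erule i2,
         simp only: integral_mult_right_zero Bochner_Integration.integral_indicator space_lborel space_borel Int_UNIV_right)
    have "0 \<le> (\<Sum>i\<in>K. \<Sum>j\<in>K. \<zeta> i \<omega> * \<zeta> j \<omega> * ?l i j)"
      unfolding i4[symmetric] by (rule integral_nonneg_AE) simp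
    moreover have "(\<integral>\<^sup>+s. ennreal ((\<Sum>i\<in>K. \<zeta> i \<omega> * indicator {a i<..b i} s)\<^sup>2) \<partial>lborel) =
      ennreal (\<Sum>i\<in>K. \<Sum>j\<in>K. \<zeta> i \<omega> * \<zeta> j \<omega> * ?l i j)"
      by (subst nn_integral_eq_integral[OF i3]) (auto simp: i4)
    ultimately show ?thesis by simp
  qed
  have int5: "integrable M (\<lambda>\<omega>. \<Sum>i\<in>K. \<Sum>j\<in>K. \<zeta> i \<omega> * \<zeta> j \<omega> * ?l i j)"
  proof (intro Bochner_Integration.integrable_sum integrable_mult_left)
    fix i j assume "i \<in> K" "j \<in> K"
    then show "integrable M (\<lambda>\<omega>. \<zeta> i \<omega> * \<zeta> j \<omega>)"
      by (intro integrable_const_bound[where B="C i * C j"])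
        (use C \<zeta>M in \<open>auto simp: abs_mult intro!: mult_mono AE_I2 borel_measurable_times intro: order_trans[OF abs_ge_zero]\<close>)
  qed
  have "(\<integral>\<^sup>+\<omega>. ennreal ((\<Sum>i\<in>K. ?D i \<omega>)\<^sup>2) \<partial>M) = ennreal (expectation (\<lambda>\<omega>. (\<Sum>i\<in>K. ?D i \<omega>)\<^sup>2))"
    by (rule nn_integral_eq_integral[OF int1]) simp
  also have "\<dots> = (\<integral>\<^sup>+\<omega>. ennreal (\<Sum>i\<in>K. \<Sum>j\<in>K. \<zeta> i \<omega> * \<zeta> j \<omega> * ?l i j) \<partial>M)"
    unfolding E by (rule nn_integral_eq_integral[symmetric, OF int5]) (use inner in auto)
  also have "\<dots> = (\<integral>\<^sup>+\<omega>. (\<integral>\<^sup>+s. ennreal ((\<Sum>i\<in>K. \<zeta> i \<omega> * indicator {a i<..b i} s)\<^sup>2) \<partial>lborel) \<partial>M)"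
    using inner by simp
  finally show ?thesis .
qed

end

section \<open>Step functions approximating an Ito integral\<close>

lemma ennreal_square_add_le: "ennreal ((x + y)\<^sup>2) \<le> 2 * ennreal (x\<^sup>2) + 2 * ennreal (y\<^sup>2)"
proof -
  have "(x + y)\<^sup>2 \<le> 2 * x\<^sup>2 + 2 * y\<^sup>2"
    using sum_squares_bound[of x y] by (simp add: power2_sum)
  then have "ennreal ((x + y)\<^sup>2) \<le> ennreal (2 * x\<^sup>2 + 2 * y\<^sup>2)" by (rule ennreal_leI)
  also have "\<dots> = 2 * ennreal (x\<^sup>2) + 2 * ennreal (y\<^sup>2)" by (simp add: ennreal_mult)
  finally show ?thesis .
qed

lemma nn_integral_square_add_le:
  assumes [measurable]: "f \<in> borel_measurable M" "g \<in> borel_measurable M"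
  shows "(\<integral>\<^sup>+x. ennreal ((f x + g x)\<^sup>2) \<partial>M) \<le>
    2 * (\<integral>\<^sup>+x. ennreal ((f x)\<^sup>2) \<partial>M) + 2 * (\<integral>\<^sup>+x. ennreal ((g x)\<^sup>2) \<partial>M)"
proof -
  have "(\<integral>\<^sup>+x. ennreal ((f x + g x)\<^sup>2) \<partial>M) \<le> (\<integral>\<^sup>+x. 2 * ennreal ((f x)\<^sup>2) + 2 * ennreal ((g x)\<^sup>2) \<partial>M)"
    by (intro nn_integral_mono ennreal_square_add_le)
  also have "\<dots> = 2 * (\<integral>\<^sup>+x. ennreal ((f x)\<^sup>2) \<partial>M) + 2 * (\<integral>\<^sup>+x. ennreal ((g x)\<^sup>2) \<partial>M)"
    by (simp add: nn_integral_add nn_integral_cmult)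
  finally show ?thesis .
qed

lemma simple_integrand_mono:
  assumes "simple_integrand F a T N p \<xi>" "i \<le> N"
  shows "a \<le> p i" "p i \<le> T"
proof -
  have step: "\<And>i. i < N \<Longrightarrow> p i \<le> p (Suc i)" and ends: "p 0 = a" "p N = T"
    using assms(1) by (auto simp: simple_integrand_def)
  have "i \<le> N \<Longrightarrow> p 0 \<le> p i" for i
  proof (induction i)
    case (Suc i) then show ?case using step[of i] by simp
  qed simp
  then show "a \<le> p i" using assms(2) ends by auto
  have "i \<le> N \<Longrightarrow> p (N - i) \<le> p N" for i
  proof (induction i)
    case (Suc i)
    then show ?case using step[of "N - Suc i"] by (simp add: Suc_diff_Suc)
  qed simp
  from this[of "N - i"] show "p i \<le> T" using assms(2) ends by simp
qed

context brownian_motion begin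

text \<open>
  The difference of a simple integral with random weights and a step integral with constant weights is the integral of the
  disjoint union of the two families of intervals.
\<close>

lemma simple_minus_step_isometry:
  assumes S: "simple_integrand F a T N p \<xi>" and a: "0 \<le> a"
    and K: "finite K" and q: "\<And>i. i \<in> K \<Longrightarrow> a \<le> q i" "\<And>i. i \<in> K \<Longrightarrow> q i \<le> q' i"
  shows "(\<integral>\<^sup>+\<omega>. ennreal ((simple_integral W N p \<xi> \<omega> - (\<Sum>i\<in>K. c i * (W (q' i) \<omega> - W (q i) \<omega>)))\<^sup>2) \<partial>M) =
    (\<integral>\<^sup>+\<omega>. (\<integral>\<^sup>+s. ennreal ((simple_process N p \<xi> s \<omega> - (\<Sum>i\<in>K. c i * indicator {q i<..q' i} s))\<^sup>2) \<partial>lborel) \<partial>M)"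
proof -
  let ?K = "{..<N} <+> K"
  let ?a = "case_sum p q" and ?b = "case_sum (\<lambda>i. p (Suc i)) q'" and ?\<zeta> = "case_sum \<xi> (\<lambda>i \<omega>. - c i)"
  have "(\<integral>\<^sup>+\<omega>. ennreal ((\<Sum>i\<in>?K. ?\<zeta> i \<omega> * (W (?b i) \<omega> - W (?a i) \<omega>))\<^sup>2) \<partial>M) =
    (\<integral>\<^sup>+\<omega>. (\<integral>\<^sup>+s. ennreal ((\<Sum>i\<in>?K. ?\<zeta> i \<omega> * indicator {?a i<..?b i} s)\<^sup>2) \<partial>lborel) \<partial>M)"
  proof (rule ito_isometry)
    show "finite ?K" using K by simp
    fix i assume i: "i \<in> ?K"
    show "?\<zeta> i \<in> borel_measurable (F (?a i))" "\<exists>C. \<forall>\<omega>\<in>space M. \<bar>?\<zeta> i \<omega>\<bar> \<le> C" "?a i \<le> ?b i"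
      using i S q by (auto simp: simple_integrand_def space_F)
    show "0 \<le> ?a i"
    proof (cases i)
      case (Inl j)
      then show ?thesis using i simple_integrand_mono(1)[OF S, of j] a by auto
    next
      case (Inr j)
      then show ?thesis using i q(1)[of j] a by auto
    qed
  qed
  moreover have "(\<Sum>i\<in>?K. ?\<zeta> i \<omega> * (W (?b i) \<omega> - W (?a i) \<omega>)) =
     simple_integral W N p \<xi> \<omega> - (\<Sum>i\<in>K. c i * (W (q' i) \<omega> - W (q i) \<omega>))" for \<omega>
    using K by (simp add: sum.Plus simple_integral_def comp_def sum_negf)
  moreover have "(\<Sum>i\<in>?K. ?\<zeta> i \<omega> * indicator {?a i<..?b i} s) =
     simple_process N p \<xi> s \<omega> - (\<Sum>i\<in>K. c i * indicator {q i<..q' i} s)" for s \<omega>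
    by (simp only: sum.Plus[OF finite_lessThan K] simple_process_def comp_def sum.case mult_minus_left sum_negf add_uminus_conv_diff)
  ultimately show ?thesis by simp
qed

text \<open>
  The Ito integral of a deterministic integrand is only given as a limit of simple integrals whose weights may be random.
  This bound makes it accessible by deterministic step functions, whose integrals are Gaussian.  The
  factor \<open>4\<close> comes from two uses of \<open>(x + y)\<^sup>2 \<le> 2 x\<^sup>2 + 2 y\<^sup>2\<close>.
\<close>

lemma ito_integral_step_distance:
  assumes ito: "ito_integral M F W a T (\<lambda>s \<omega>. \<sigma> s) J" and a: "0 \<le> a" and \<sigma>[measurable]: "\<sigma> \<in> borel_measurable borel"
    and K: "finite K" and q: "\<And>i. i \<in> K \<Longrightarrow> a \<le> q i" "\<And>i. i \<in> K \<Longrightarrow> q i \<le> q' i" "\<And>i. i \<in> K \<Longrightarrow> q' i \<le> T"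
  shows "(\<integral>\<^sup>+\<omega>. ennreal (((\<Sum>i\<in>K. c i * (W (q' i) \<omega> - W (q i) \<omega>)) - J \<omega>)\<^sup>2) \<partial>M) \<le>
    4 * (\<integral>\<^sup>+s\<in>{a..T}. ennreal (((\<Sum>i\<in>K. c i * indicator {q i<..q' i} s) - \<sigma> s)\<^sup>2) \<partial>lborel)"
proof -
  let ?T = "\<lambda>\<omega>. \<Sum>i\<in>K. c i * (W (q' i) \<omega> - W (q i) \<omega>)"
  let ?st = "\<lambda>s. \<Sum>i\<in>K. c i * indicator {q i<..q' i} s :: real"
  let ?D = "\<integral>\<^sup>+s\<in>{a..T}. ennreal ((?st s - \<sigma> s)\<^sup>2) \<partial>lborel"
  from ito obtain N p \<xi> where J[measurable]: "J \<in> borel_measurable M"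
    and S: "\<And>n. simple_integrand F a T (N n) (p n) (\<xi> n)"
    and e: "(\<lambda>n. \<integral>\<^sup>+\<omega>. (\<integral>\<^sup>+s\<in>{a..T}. ennreal ((simple_process (N n) (p n) (\<xi> n) s \<omega> - \<sigma> s)\<^sup>2) \<partial>lborel) \<partial>M) \<longlonglongrightarrow> 0"
      (is "?e \<longlonglongrightarrow> 0")
    and d: "(\<lambda>n. \<integral>\<^sup>+\<omega>. ennreal ((simple_integral W (N n) (p n) (\<xi> n) \<omega> - J \<omega>)\<^sup>2) \<partial>M) \<longlonglongrightarrow> 0"
      (is "?d \<longlonglongrightarrow> 0")
    unfolding ito_integral_def by auto
  have bound: "(\<integral>\<^sup>+\<omega>. ennreal ((?T \<omega> - J \<omega>)\<^sup>2) \<partial>M) \<le> 2 * (2 * ?e n + 2 * ?D) + 2 * ?d n" for n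
  proof -
    let ?S = "simple_integral W (N n) (p n) (\<xi> n)" and ?h = "\<lambda>s \<omega>. simple_process (N n) (p n) (\<xi> n) s \<omega>"
    have p: "a \<le> p n i" "p n i \<le> T" if "i \<le> N n" for i
      using simple_integrand_mono[OF S that] by auto
    have \<xi>[measurable]: "\<xi> n i \<in> borel_measurable M" if "i < N n" for i
      using S[of n] p(1)[of i] a that by (intro measurable_F_M[of _ "p n i"]) (auto simp: simple_integrand_def)
    have inc: "(\<lambda>\<omega>. W (p n (Suc i)) \<omega> - W (p n i) \<omega>) \<in> borel_measurable M" if "i < N n" for i
      using S[of n] p(1)[of i] a that by (intro increment_measurable) (auto simp: simple_integrand_def)
    have incq: "(\<lambda>\<omega>. W (q' i) \<omega> - W (q i) \<omega>) \<in> borel_measurable M" if "i \<in> K" for i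
      using q(1)[OF that] q(2)[OF that] a by (intro increment_measurable) auto
    have Sm[measurable]: "?S \<in> borel_measurable M"
      unfolding simple_integral_def by (intro borel_measurable_sum borel_measurable_times \<xi> inc) auto
    have Tm[measurable]: "?T \<in> borel_measurable M"
      by (intro borel_measurable_sum borel_measurable_times incq) auto
    have hm[measurable]: "(\<lambda>(\<omega>, s). ?h s \<omega>) \<in> borel_measurable (M \<Otimes>\<^sub>M lborel)"
      unfolding simple_process_def by measurable
    have "(\<integral>\<^sup>+s. ennreal ((?h s \<omega> - ?st s)\<^sup>2) \<partial>lborel) \<le>
        2 * (\<integral>\<^sup>+s\<in>{a..T}. ennreal ((?h s \<omega> - \<sigma> s)\<^sup>2) \<partial>lborel) + 2 * ?D" if \<omega>: "\<omega> \<in> space M" for \<omega>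
    proof -
      have [measurable]: "(\<lambda>s. ?h s \<omega>) \<in> borel_measurable borel" unfolding simple_process_def by measurable
      have "(\<integral>\<^sup>+s. ennreal ((?h s \<omega> - ?st s)\<^sup>2) \<partial>lborel) \<le>
        (\<integral>\<^sup>+s. 2 * (ennreal ((?h s \<omega> - \<sigma> s)\<^sup>2) * indicator {a..T} s) + 2 * (ennreal ((?st s - \<sigma> s)\<^sup>2) * indicator {a..T} s) \<partial>lborel)"
      proof (rule nn_integral_mono)
        fix s :: real
        show "ennreal ((?h s \<omega> - ?st s)\<^sup>2) \<le>
          2 * (ennreal ((?h s \<omega> - \<sigma> s)\<^sup>2) * indicator {a..T} s) + 2 * (ennreal ((?st s - \<sigma> s)\<^sup>2) * indicator {a..T} s)"
        proof (cases "s \<in> {a..T}")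
          case True
          then show ?thesis
            using ennreal_square_add_le[of "?h s \<omega> - \<sigma> s" "- (?st s - \<sigma> s)"] unfolding power2_minus by simp
        next
          case False
          have "s \<notin> {p n i<..p n (Suc i)}" if "i < N n" for i
            using False p[of i] p[of "Suc i"] that by auto
          then have "?h s \<omega> = 0" by (simp add: simple_process_def)
          moreover have "s \<notin> {q i<..q' i}" if "i \<in> K" for i
            using False q(1)[OF that] q(3)[OF that] by auto
          then have "?st s = 0" by simp
          ultimately show ?thesis by simp
        qed
      qed
      also have "\<dots> = 2 * (\<integral>\<^sup>+s\<in>{a..T}. ennreal ((?h s \<omega> - \<sigma> s)\<^sup>2) \<partial>lborel) + 2 * ?D"
        by (simp add: nn_integral_add nn_integral_cmult)
      finally show ?thesis .
    qed
    then have "(\<integral>\<^sup>+\<omega>. (\<integral>\<^sup>+s. ennreal ((?h s \<omega> - ?st s)\<^sup>2) \<partial>lborel) \<partial>M) \<le>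
       (\<integral>\<^sup>+\<omega>. 2 * (\<integral>\<^sup>+s\<in>{a..T}. ennreal ((?h s \<omega> - \<sigma> s)\<^sup>2) \<partial>lborel) + 2 * ?D \<partial>M)"
      by (intro nn_integral_mono)
    also have "\<dots> = 2 * ?e n + 2 * ?D"
      by (simp add: nn_integral_add nn_integral_cmult emeasure_space_1)
    finally have "(\<integral>\<^sup>+\<omega>. (\<integral>\<^sup>+s. ennreal ((?h s \<omega> - ?st s)\<^sup>2) \<partial>lborel) \<partial>M) \<le> 2 * ?e n + 2 * ?D" .
    moreover have "(\<integral>\<^sup>+\<omega>. ennreal ((?S \<omega> - ?T \<omega>)\<^sup>2) \<partial>M) = (\<integral>\<^sup>+\<omega>. (\<integral>\<^sup>+s. ennreal ((?h s \<omega> - ?st s)\<^sup>2) \<partial>lborel) \<partial>M)"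
      by (rule simple_minus_step_isometry[OF S a K q(1,2)])
    ultimately have 1: "(\<integral>\<^sup>+\<omega>. ennreal ((?S \<omega> - ?T \<omega>)\<^sup>2) \<partial>M) \<le> 2 * ?e n + 2 * ?D" by simp
    have "(\<integral>\<^sup>+\<omega>. ennreal ((?T \<omega> - J \<omega>)\<^sup>2) \<partial>M) = (\<integral>\<^sup>+\<omega>. ennreal ((- (?S \<omega> - ?T \<omega>) + (?S \<omega> - J \<omega>))\<^sup>2) \<partial>M)"
      by (simp add: algebra_simps)
    also have "\<dots> \<le> 2 * (\<integral>\<^sup>+\<omega>. ennreal ((- (?S \<omega> - ?T \<omega>))\<^sup>2) \<partial>M) + 2 * ?d n"
      by (rule nn_integral_square_add_le) measurable
    also have "(\<integral>\<^sup>+\<omega>. ennreal ((- (?S \<omega> - ?T \<omega>))\<^sup>2) \<partial>M) = (\<integral>\<^sup>+\<omega>. ennreal ((?S \<omega> - ?T \<omega>)\<^sup>2) \<partial>M)"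
      unfolding power2_minus ..
    also have "2 * \<dots> + 2 * ?d n \<le> 2 * (2 * ?e n + 2 * ?D) + 2 * ?d n"
      by (intro add_right_mono mult_left_mono 1) simp
    finally show ?thesis .
  qed
  have "(\<lambda>n. 2 * (2 * ?e n + 2 * ?D) + 2 * ?d n) \<longlonglongrightarrow> 2 * (2 * 0 + 2 * ?D) + 2 * 0"
    by (intro tendsto_add ennreal_tendsto_cmult e d tendsto_const) auto
  then have "(\<integral>\<^sup>+\<omega>. ennreal ((?T \<omega> - J \<omega>)\<^sup>2) \<partial>M) \<le> 2 * (2 * 0 + 2 * ?D) + 2 * 0"
    by (rule LIMSEQ_le_const) (use bound in auto)
  then show ?thesis by (simp add: mult.assoc[symmetric])
qed

end

definition grid :: "real \<Rightarrow> real \<Rightarrow> nat \<Rightarrow> nat \<Rightarrow> real" where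
  "grid s t m j = s + (t - s) * real j / real m"

text \<open>
  The weight on a cell \<open>(g, g']\<close> is the root mean square of \<open>exp (-r/2)\<close> over the cell.  With this choice the
  step function has exactly the same \<open>L\<^sup>2\<close> norm as \<open>exp (-r/2)\<close>, so that the variance of the step integral needs no limit.
\<close>

definition cell_weight :: "real \<Rightarrow> real \<Rightarrow> nat \<Rightarrow> nat \<Rightarrow> real" where
  "cell_weight s t m j =
     sqrt ((exp (- grid s t m j) - exp (- grid s t m (Suc j))) / (grid s t m (Suc j) - grid s t m j))"

lemma grid_props:
  assumes "s \<le> t" "m > 0"
  shows "grid s t m 0 = s" "grid s t m m = t" "grid s t m j \<le> grid s t m (Suc j)"
    "s \<le> grid s t m j" "j \<le> m \<Longrightarrow> grid s t m j \<le> t"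
    "grid s t m (Suc j) - grid s t m j = (t - s) / m"
proof -
  show "j \<le> m \<Longrightarrow> grid s t m j \<le> t"
  proof -
    assume "j \<le> m"
    then have "(t - s) * (real j / real m) \<le> (t - s) * 1"
      using assms by (intro mult_left_mono) auto
    then show ?thesis by (simp add: grid_def)
  qed
qed (use assms in \<open>auto simp: grid_def field_simps mult_right_mono\<close>)

lemma cell_weight_square:
  assumes "s \<le> t" "m > 0"
  shows "(cell_weight s t m j)\<^sup>2 * (grid s t m (Suc j) - grid s t m j) =
    exp (- grid s t m j) - exp (- grid s t m (Suc j))"
proof -
  have "grid s t m j \<le> grid s t m (Suc j)" using grid_props(3)[OF assms] .
  then show ?thesis
    by (cases "grid s t m j = grid s t m (Suc j)") (auto simp: cell_weight_def)
qed

text \<open>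
  The root mean square and the value at \<open>r\<close> both lie between the values of \<open>exp (-x/2)\<close> at the two end points of the cell.
\<close>

lemma sqrt_exp_slope_near:
  fixes g g' r :: real
  assumes "0 \<le> g" "g < r" "r \<le> g'"
  shows "\<bar>sqrt ((exp (- g) - exp (- g')) / (g' - g)) - exp (- r / 2)\<bar> \<le> g' - g"
proof -
  let ?d = "g' - g" and ?w = "sqrt ((exp (- g) - exp (- g')) / (g' - g))"
  have d: "?d > 0" using assms by simp
  have half: "exp (- x) = (exp (- x / 2))\<^sup>2" for x :: real
    by (simp add: power2_eq_square exp_add[symmetric])
  have "1 + ?d \<le> exp ?d" "1 - ?d \<le> exp (- ?d)"
    using exp_ge_add_one_self[of ?d] exp_ge_add_one_self[of "- ?d"] by (auto simp: algebra_simps)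
  then have "exp (- g') * (1 + ?d) \<le> exp (- g') * exp ?d" "exp (- g) * (1 - ?d) \<le> exp (- g) * exp (- ?d)"
    by auto
  then have "exp (- g') * ?d \<le> exp (- g) - exp (- g')" "exp (- g) - exp (- g') \<le> exp (- g) * ?d"
    unfolding mult_exp_exp by (auto simp: algebra_simps)
  then have "exp (- g') \<le> (exp (- g) - exp (- g')) / ?d" "(exp (- g) - exp (- g')) / ?d \<le> exp (- g)"
    using d by (auto simp: field_simps)
  then have "sqrt (exp (- g')) \<le> ?w" "?w \<le> sqrt (exp (- g))" by auto
  then have w: "exp (- g' / 2) \<le> ?w" "?w \<le> exp (- g / 2)"
    unfolding half[of g] half[of g'] by auto
  have r: "exp (- g' / 2) \<le> exp (- r / 2)" "exp (- r / 2) \<le> exp (- g / 2)" using assms by auto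
  have "exp (- g / 2) - exp (- g' / 2) \<le> ?d"
  proof -
    have "exp (- g' / 2) = exp (- g / 2) * exp (- ?d / 2)" unfolding mult_exp_exp by (simp add: field_simps)
    moreover have "1 - ?d / 2 \<le> exp (- ?d / 2)" using exp_ge_add_one_self[of "- ?d / 2"] by argo
    ultimately have "exp (- g / 2) - exp (- g' / 2) \<le> exp (- g / 2) * (?d / 2)"
      using mult_left_mono[of "1 - ?d / 2" "exp (- ?d / 2)" "exp (- g / 2)"]
      by (simp only: right_diff_distrib mult_1_right exp_ge_zero simp_thms True_implies_equals)
    also have "\<dots> \<le> 1 * (?d / 2)" using assms d by (intro mult_right_mono) auto
    finally show ?thesis using d by simp
  qed
  then show ?thesis using w r by linarith
qed

definition step_fun :: "real \<Rightarrow> real \<Rightarrow> nat \<Rightarrow> real \<Rightarrow> real" where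
  "step_fun s t m r = (\<Sum>j<m. cell_weight s t m j * indicator {grid s t m j<..grid s t m (Suc j)} r)"

lemma step_fun_outside:
  assumes "s \<le> t" "m > 0" "r \<notin> {s<..t}"
  shows "step_fun s t m r = 0"
proof -
  have "r \<notin> {grid s t m j<..grid s t m (Suc j)}" if "j < m" for j
    using grid_props(4)[OF assms(1,2), of j] grid_props(5)[OF assms(1,2), of "Suc j"] that assms(3) by auto
  then show ?thesis unfolding step_fun_def by simp
qed

lemma step_fun_near:
  assumes st: "0 \<le> s" "s \<le> t" "m > 0" and r: "r \<in> {s<..t}"
  shows "\<bar>step_fun s t m r - exp (- r / 2)\<bar> \<le> (t - s) / m"
proof -
  let ?I = "\<lambda>j. indicator {grid s t m j<..grid s t m (Suc j)} r :: real"
  note g = grid_props[OF st(2,3)]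
  have "?I j = (if r \<le> grid s t m (Suc j) then 1 else 0) - (if r \<le> grid s t m j then 1 else 0)" for j
    using g(3)[of j] by (auto simp: indicator_def)
  \<comment> \<open>the indicators of the cells telescope\<close>
  then have sum1: "(\<Sum>j<m. ?I j) = 1"
    using r g(1,2) by (simp add: sum_lessThan_telescope[of "\<lambda>j. if r \<le> grid s t m j then 1 else 0"])
  have "step_fun s t m r - exp (- r / 2) = (\<Sum>j<m. cell_weight s t m j * ?I j) - exp (- r / 2) * (\<Sum>j<m. ?I j)"
    by (simp only: sum1 step_fun_def)
  also have "\<dots> = (\<Sum>j<m. (cell_weight s t m j - exp (- r / 2)) * ?I j)"
    unfolding sum_distrib_left left_diff_distrib sum_subtractf ..
  finally have "\<bar>step_fun s t m r - exp (- r / 2)\<bar> = \<bar>\<Sum>j<m. (cell_weight s t m j - exp (- r / 2)) * ?I j\<bar>"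
    by (rule arg_cong)
  also have "\<dots> \<le> (\<Sum>j<m. \<bar>(cell_weight s t m j - exp (- r / 2)) * ?I j\<bar>)" by (rule sum_abs)
  also have "\<dots> \<le> (\<Sum>j<m. (t - s) / m * ?I j)"
  proof (rule sum_mono)
    fix j assume "j \<in> {..<m}"
    show "\<bar>(cell_weight s t m j - exp (- r / 2)) * ?I j\<bar> \<le> (t - s) / m * ?I j"
    proof (cases "r \<in> {grid s t m j<..grid s t m (Suc j)}")
      case True
      have "0 \<le> grid s t m j" using g(4)[of j] st by linarith
      then have "\<bar>cell_weight s t m j - exp (- r / 2)\<bar> \<le> grid s t m (Suc j) - grid s t m j"
        unfolding cell_weight_def using True by (intro sqrt_exp_slope_near) auto
      then show ?thesis using True unfolding g(6) by simp
    qed simp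
  qed
  also have "\<dots> = (t - s) / m" by (simp only: sum_distrib_left[symmetric] sum1 mult_1_right)
  finally show ?thesis .
qed

context brownian_motion begin

definition step_integral :: "real \<Rightarrow> real \<Rightarrow> nat \<Rightarrow> 'a \<Rightarrow> real" where
  "step_integral s t m \<omega> =
     (\<Sum>j<m. cell_weight s t m j * (W (grid s t m (Suc j)) \<omega> - W (grid s t m j) \<omega>))"

lemma step_integral_measurable:
  assumes "0 \<le> s" "s \<le> t" "m > 0"
  shows "step_integral s t m \<in> borel_measurable M"
  unfolding step_integral_def
  by (intro borel_measurable_sum borel_measurable_times increment_measurable borel_measurable_const
      order_trans[OF assms(1) grid_props(4)[OF assms(2,3)]] grid_props(3)[OF assms(2,3)])

text \<open>
  By induction along the grid; the variances telescope.
\<close>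

lemma gauss_indep_step_integral:
  assumes st: "0 \<le> s" "s \<le> t" "m > 0"
  shows "gauss_indep (F s) (step_integral s t m) (exp (- s) - exp (- t))"
proof -
  let ?g = "grid s t m"
  note g = grid_props[OF st(2,3)]
  have "gauss_indep (F s) (\<lambda>\<omega>. \<Sum>j<n. cell_weight s t m j * (W (?g (Suc j)) \<omega> - W (?g j) \<omega>)) (exp (- s) - exp (- ?g n)) \<and>
     (\<lambda>\<omega>. \<Sum>j<n. cell_weight s t m j * (W (?g (Suc j)) \<omega> - W (?g j) \<omega>)) \<in> borel_measurable (F (?g n))" for n
  proof (induction n)
    case 0
    have "sets (F s) \<subseteq> sets M" using F_subalgebra[OF st(1)] by (auto simp: subalgebra_def)
    then show ?case unfolding gauss_indep_def g(1) by (auto simp: scaleR_conv_of_real)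
  next
    case (Suc n)
    have n0: "0 \<le> ?g n" "s \<le> ?g n" using g(4)[of n] st by auto
    have "gauss_indep (F s) (\<lambda>\<omega>. (\<Sum>j<n. cell_weight s t m j * (W (?g (Suc j)) \<omega> - W (?g j) \<omega>)) +
       cell_weight s t m n * (W (?g (Suc n)) \<omega> - W (?g n) \<omega>))
       (exp (- s) - exp (- ?g n) + (cell_weight s t m n)\<^sup>2 * (?g (Suc n) - ?g n))"
      by (rule gauss_indep_add_increment[OF conjunct1[OF Suc] conjunct2[OF Suc] st(1) n0(2) g(3)])
    moreover have "(\<lambda>\<omega>. \<Sum>j<Suc n. cell_weight s t m j * (W (?g (Suc j)) \<omega> - W (?g j) \<omega>)) \<in> borel_measurable (F (?g (Suc n)))"
      unfolding sum.lessThan_Suc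
    proof (rule borel_measurable_add)
      show "(\<lambda>\<omega>. \<Sum>j<n. cell_weight s t m j * (W (?g (Suc j)) \<omega> - W (?g j) \<omega>)) \<in> borel_measurable (F (?g (Suc n)))"
        by (rule measurable_F_mono[OF conjunct2[OF Suc] n0(1) g(3)])
      have "W (?g (Suc n)) \<in> borel_measurable (F (?g (Suc n)))"
        by (rule W_adapted[OF order_trans[OF n0(1) g(3)]])
      moreover have "W (?g n) \<in> borel_measurable (F (?g (Suc n)))"
        by (rule measurable_F_mono[OF W_adapted[OF n0(1)] n0(1) g(3)])
      ultimately show "(\<lambda>\<omega>. cell_weight s t m n * (W (?g (Suc n)) \<omega> - W (?g n) \<omega>)) \<in> borel_measurable (F (?g (Suc n)))"
        by simp
    qed
    ultimately show ?case unfolding cell_weight_square[OF st(2,3)] by simp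
  qed
  from conjunct1[OF this[of m]] show ?thesis unfolding step_integral_def[abs_def] g(2) .
qed

text \<open>
  Both grids have mesh at most \<open>t / m\<close>, so the squared \<open>L\<^sup>2\<close> distance of the integrands is at most
  \<open>t * (t / m)\<^sup>2\<close>.
\<close>

lemma step_integral_distance:
  assumes ito: "ito_integral M F W 1 t (\<lambda>r \<omega>. exp (- r / 2)) J" and st: "1 \<le> s" "s \<le> t" "m > 0"
  shows "(\<integral>\<^sup>+\<omega>. ennreal ((step_integral 1 s m \<omega> + step_integral s t m \<omega> - J \<omega>)\<^sup>2) \<partial>M) \<le> ennreal (4 * t ^ 3 / m\<^sup>2)"
proof -
  let ?K = "{..<m} <+> {..<m}"
  let ?c = "case_sum (cell_weight 1 s m) (cell_weight s t m)"
  let ?q = "case_sum (grid 1 s m) (grid s t m)"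
  let ?q' = "case_sum (\<lambda>j. grid 1 s m (Suc j)) (\<lambda>j. grid s t m (Suc j))"
  note g1 = grid_props[OF st(1,3)] and g2 = grid_props[OF st(2,3)]
  have q: "1 \<le> ?q i" "?q i \<le> ?q' i" "?q' i \<le> t" if i: "i \<in> ?K" for i
  proof -
    consider j where "i = Inl j" "j < m" | j where "i = Inr j" "j < m" using i by (elim PlusE) auto
    then have "1 \<le> ?q i \<and> ?q i \<le> ?q' i \<and> ?q' i \<le> t"
    proof cases
      case 1
      then show ?thesis using g1(3,4)[of j] g1(5)[of "Suc j"] st by auto
    next
      case 2
      then show ?thesis using g2(3,4)[of j] g2(5)[of "Suc j"] st by auto
    qed
    then show "1 \<le> ?q i" "?q i \<le> ?q' i" "?q' i \<le> t" by auto
  qed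
  have e1: "(\<Sum>i\<in>?K. ?c i * (W (?q' i) \<omega> - W (?q i) \<omega>)) = step_integral 1 s m \<omega> + step_integral s t m \<omega>" for \<omega>
    by (simp only: sum.Plus[OF finite_lessThan finite_lessThan] step_integral_def comp_def sum.case)
  have e2: "(\<Sum>i\<in>?K. ?c i * indicator {?q i<..?q' i} r) = step_fun 1 s m r + step_fun s t m r" for r
    by (simp only: sum.Plus[OF finite_lessThan finite_lessThan] step_fun_def comp_def sum.case)
  have "(\<integral>\<^sup>+\<omega>. ennreal (((\<Sum>i\<in>?K. ?c i * (W (?q' i) \<omega> - W (?q i) \<omega>)) - J \<omega>)\<^sup>2) \<partial>M) \<le>
    4 * (\<integral>\<^sup>+r\<in>{1..t}. ennreal (((\<Sum>i\<in>?K. ?c i * indicator {?q i<..?q' i} r) - exp (- r / 2))\<^sup>2) \<partial>lborel)"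
    by (rule ito_integral_step_distance[OF ito _ _ _ q]) simp_all
  then have "(\<integral>\<^sup>+\<omega>. ennreal ((step_integral 1 s m \<omega> + step_integral s t m \<omega> - J \<omega>)\<^sup>2) \<partial>M) \<le>
    4 * (\<integral>\<^sup>+r\<in>{1..t}. ennreal ((step_fun 1 s m r + step_fun s t m r - exp (- r / 2))\<^sup>2) \<partial>lborel)"
    unfolding e1 e2 .
  moreover have le: "(\<integral>\<^sup>+r\<in>{1..t}. ennreal ((step_fun 1 s m r + step_fun s t m r - exp (- r / 2))\<^sup>2) \<partial>lborel) \<le>
     (\<integral>\<^sup>+r. ennreal ((t / m)\<^sup>2) * indicator {1..t} r \<partial>lborel)"
  proof (rule nn_integral_mono_AE)
    show "AE r in lborel. ennreal ((step_fun 1 s m r + step_fun s t m r - exp (- r / 2))\<^sup>2) * indicator {1..t} r \<le>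
      ennreal ((t / m)\<^sup>2) * indicator {1..t} r"
      using AE_lborel_singleton[of 1]
    proof eventually_elim
      case (elim r)
      have near: "\<bar>step_fun 1 s m r + step_fun s t m r - exp (- r / 2)\<bar> \<le> t / m" if "r \<in> {1..t}"
      proof (cases "r \<le> s")
        case True
        then have "step_fun s t m r = 0" by (intro step_fun_outside st) auto
        moreover have "\<bar>step_fun 1 s m r - exp (- r / 2)\<bar> \<le> (s - 1) / m"
          using True that elim by (intro step_fun_near st) auto
        moreover have "(s - 1) / m \<le> t / m" using st by (intro divide_right_mono) auto
        ultimately show ?thesis by simp
      next
        case False
        then have "step_fun 1 s m r = 0" by (intro step_fun_outside st) auto
        moreover have "\<bar>step_fun s t m r - exp (- r / 2)\<bar> \<le> (t - s) / m"
          using False that st by (intro step_fun_near) auto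
        moreover have "(t - s) / m \<le> t / m" using st by (intro divide_right_mono) auto
        ultimately show ?thesis by simp
      qed
      have "(step_fun 1 s m r + step_fun s t m r - exp (- r / 2))\<^sup>2 \<le> (t / m)\<^sup>2" if "r \<in> {1..t}"
        by (rule abs_le_square_iff[THEN iffD1, OF order_trans[OF near[OF that] abs_ge_self]])
      then show ?case by (cases "r \<in> {1..t}") (simp_all add: ennreal_leI)
    qed
  qed
  moreover have eq: "(\<integral>\<^sup>+r. ennreal ((t / m)\<^sup>2) * indicator {1..t} r \<partial>lborel) = ennreal ((t / m)\<^sup>2) * ennreal (t - 1)"
    using st by (subst nn_integral_cmult_indicator) auto
  moreover have "4 * (ennreal ((t / m)\<^sup>2) * ennreal (t - 1)) \<le> ennreal (4 * t ^ 3 / m\<^sup>2)"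
  proof -
    have "4 * (ennreal ((t / m)\<^sup>2) * ennreal (t - 1)) = ennreal (4 * ((t / m)\<^sup>2 * (t - 1)))"
      using st by (simp add: ennreal_mult'')
    also have "\<dots> \<le> ennreal (4 * ((t / m)\<^sup>2 * t))" by (intro ennreal_leI mult_left_mono) auto
    finally show ?thesis by (simp add: power_divide power2_eq_square power3_eq_cube)
  qed
  ultimately show ?thesis
    by (elim order_trans) (rule order_trans[OF mult_left_mono[OF le zero_le]], unfold eq)
qed

text \<open>
  The step integrals over \<open>[s, t]\<close> all have the same conditional law given \<open>F s\<close>, and converge in \<open>L\<^sup>2\<close> to the increment.
\<close>

lemma ito_increment_gauss_indep:
  assumes Is: "ito_integral M F W 1 s (\<lambda>r \<omega>. exp (- r / 2)) Is"
    and It: "ito_integral M F W 1 t (\<lambda>r \<omega>. exp (- r / 2)) It" and st: "1 \<le> s" "s \<le> t"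
  shows "gauss_indep (F s) (\<lambda>\<omega>. It \<omega> - Is \<omega>) (exp (- s) - exp (- t))"
proof (rule gauss_indep_L2_limit[where Z="\<lambda>n. step_integral s t (Suc n)"])
  show "subalgebra M (F s)" using F_subalgebra st by simp
  have Im[measurable]: "Is \<in> borel_measurable M" "It \<in> borel_measurable M"
    using Is It by (auto simp: ito_integral_def)
  then show "(\<lambda>\<omega>. It \<omega> - Is \<omega>) \<in> borel_measurable M" by simp
  show "gauss_indep (F s) (step_integral s t (Suc n)) (exp (- s) - exp (- t))" for n
    using st by (intro gauss_indep_step_integral) auto
  have bound: "(\<integral>\<^sup>+\<omega>. ennreal ((step_integral s t (Suc n) \<omega> - (It \<omega> - Is \<omega>))\<^sup>2) \<partial>M) \<le> ennreal (16 * t ^ 3 / (Suc n)\<^sup>2)" for n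
  proof -
    let ?m = "Suc n"
    have [measurable]: "step_integral 1 s ?m \<in> borel_measurable M" "step_integral s t ?m \<in> borel_measurable M"
      using st by (intro step_integral_measurable; simp)+
    have z: "step_integral s s ?m \<omega> = 0" for \<omega> by (simp add: step_integral_def grid_def)
    \<comment> \<open>compare the two integrals over [1, t] and [1, s] with the same steps up to s, which then cancel\<close>
    have "(\<integral>\<^sup>+\<omega>. ennreal ((step_integral s t ?m \<omega> - (It \<omega> - Is \<omega>))\<^sup>2) \<partial>M) =
      (\<integral>\<^sup>+\<omega>. ennreal (((step_integral 1 s ?m \<omega> + step_integral s t ?m \<omega> - It \<omega>) +
         (- (step_integral 1 s ?m \<omega> + step_integral s s ?m \<omega> - Is \<omega>)))\<^sup>2) \<partial>M)"
      by (simp add: z algebra_simps)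
    also have "\<dots> \<le> 2 * (\<integral>\<^sup>+\<omega>. ennreal ((step_integral 1 s ?m \<omega> + step_integral s t ?m \<omega> - It \<omega>)\<^sup>2) \<partial>M) +
       2 * (\<integral>\<^sup>+\<omega>. ennreal ((- (step_integral 1 s ?m \<omega> + step_integral s s ?m \<omega> - Is \<omega>))\<^sup>2) \<partial>M)"
      by (rule nn_integral_square_add_le) (simp_all add: z)
    also have "\<dots> \<le> 2 * ennreal (4 * t ^ 3 / ?m\<^sup>2) + 2 * ennreal (4 * s ^ 3 / ?m\<^sup>2)"
      unfolding power2_minus
      by (intro add_mono mult_left_mono step_integral_distance Is It st order_refl) auto
    also have "\<dots> = ennreal (8 * t ^ 3 / ?m\<^sup>2 + 8 * s ^ 3 / ?m\<^sup>2)"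
    proof -
      have "2 * ennreal x + 2 * ennreal y = ennreal (2 * x + 2 * y)" if "0 \<le> x" "0 \<le> y" for x y
        using that by (simp add: ennreal_mult)
      from this[of "4 * t ^ 3 / ?m\<^sup>2" "4 * s ^ 3 / ?m\<^sup>2"] show ?thesis using st by simp
    qed
    also have "\<dots> \<le> ennreal (16 * t ^ 3 / ?m\<^sup>2)"
    proof (rule ennreal_leI)
      have "s ^ 3 \<le> t ^ 3" using st by (intro power_mono) auto
      then have "8 * s ^ 3 / ?m\<^sup>2 \<le> 8 * t ^ 3 / ?m\<^sup>2" by (intro divide_right_mono) auto
      then show "8 * t ^ 3 / ?m\<^sup>2 + 8 * s ^ 3 / ?m\<^sup>2 \<le> 16 * t ^ 3 / ?m\<^sup>2" by simp
    qed
    finally show ?thesis .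
  qed
  have "(\<lambda>n. 16 * t ^ 3 * (inverse (real (Suc n)))\<^sup>2) \<longlonglongrightarrow> 16 * t ^ 3 * 0\<^sup>2"
    by (rule tendsto_mult[OF tendsto_const tendsto_power[OF LIMSEQ_inverse_real_of_nat]])
  then have "(\<lambda>n. ennreal (16 * t ^ 3 / (Suc n)\<^sup>2)) \<longlonglongrightarrow> ennreal 0"
    by (intro tendsto_ennrealI) (simp add: divide_inverse power_inverse)
  then have lim: "(\<lambda>n. ennreal (16 * t ^ 3 / (Suc n)\<^sup>2)) \<longlonglongrightarrow> 0" by simp
  show "(\<lambda>n. \<integral>\<^sup>+\<omega>. ennreal ((step_integral s t (Suc n) \<omega> - (It \<omega> - Is \<omega>))\<^sup>2) \<partial>M) \<longlonglongrightarrow> 0"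
    by (rule tendsto_sandwich[OF _ _ tendsto_const lim]) (rule always_eventually, rule allI, rule zero_le bound)+
qed

end

section \<open>Estimates for the standard normal law\<close>

text \<open>
  The characteristic function of the standard normal law is even.
\<close>

lemma std_normal_symmetric:
  assumes [measurable]: "S \<in> sets borel"
  shows "std_gauss {x. - x \<in> S} = std_gauss S"
proof -
  interpret N: real_distribution std_normal_distribution by (rule real_dist_normal_dist)
  have "distr std_normal_distribution borel uminus = std_normal_distribution"
  proof (rule Levy_uniqueness[OF N.real_distribution_distr real_dist_normal_dist])
    show "char (distr std_normal_distribution borel uminus) = char std_normal_distribution"
    proof
      fix t
      have "char (distr std_normal_distribution borel uminus) t = char std_normal_distribution (- t)"
        unfolding char_def by (subst integral_distr) auto
      then show "char (distr std_normal_distribution borel uminus) t = char std_normal_distribution t"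
        by (simp add: char_std_normal_distribution)
    qed
  qed simp
  then have "std_gauss S = measure (distr std_normal_distribution borel uminus) S" by simp
  also have "\<dots> = std_gauss {x. - x \<in> S}" by (subst measure_distr) (auto simp: vimage_def)
  finally show ?thesis ..
qed

lemma std_normal_negative_le_half:
  assumes "0 \<le> v" shows "std_gauss {x. sqrt v * x < 0} \<le> 1 / 2"
proof -
  interpret N: real_distribution std_normal_distribution by (rule real_dist_normal_dist)
  have "std_gauss {x. sqrt v * x < 0} \<le> std_gauss {..<0}"
    using assms by (intro N.finite_measure_mono) (auto simp: mult_less_0_iff)
  moreover have "std_gauss {..<0} = std_gauss {0<..}"
  proof -
    have "{x::real. - x \<in> {0<..}} = {..<0}" by auto
    then show ?thesis using std_normal_symmetric[of "{0<..}"] by simp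
  qed
  moreover have "std_gauss {..<0} + std_gauss {0<..} = std_gauss ({..<0} \<union> {0<..})"
    by (rule N.finite_measure_Union[symmetric]) auto
  moreover have "std_gauss ({..<0} \<union> {0<..}) \<le> 1" by (rule N.prob_le_1)
  ultimately show ?thesis by linarith
qed

lemma std_normal_tail_le:
  assumes "0 \<le> v" "a > 0" shows "std_gauss {x. sqrt v * x > a} \<le> v / a\<^sup>2"
proof -
  interpret N: real_distribution std_normal_distribution by (rule real_dist_normal_dist)
  have "std_gauss {x. sqrt v * x > a} \<le> std_gauss {x \<in> space std_normal_distribution. v * x\<^sup>2 \<ge> a\<^sup>2}"
  proof (rule N.finite_measure_mono)
    show "{x. sqrt v * x > a} \<subseteq> {x \<in> space std_normal_distribution. v * x\<^sup>2 \<ge> a\<^sup>2}"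
    proof clarsimp
      fix x assume "a < sqrt v * x"
      then have "a\<^sup>2 \<le> (sqrt v * x)\<^sup>2" using assms by (intro power_mono) auto
      then show "a\<^sup>2 \<le> v * x\<^sup>2" using assms by (simp add: power_mult_distrib)
    qed
  qed measurable
  also have "\<dots> \<le> (\<integral>x. v * x\<^sup>2 \<partial>std_normal_distribution) / a\<^sup>2"
    by (rule integral_Markov_inequality_measure[where A="{}"])
      (use assms integrable_std_normal_distribution_moment[of 2] in auto)
  also have "(\<integral>x. v * x\<^sup>2 \<partial>std_normal_distribution) = v"
    using std_normal_distribution_even_moments(1)[of 1] by simp
  finally show ?thesis .
qed

lemma std_normal_interval_positive:
  assumes "a < b" shows "std_gauss {a<..<b} > 0"
proof -
  have "emeasure std_normal_distribution {a<..<b} \<noteq> 0"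
  proof
    assume "emeasure std_normal_distribution {a<..<b} = 0"
    then have "{a<..<b} \<in> null_sets std_normal_distribution" by auto
    then have "AE x in lborel. x \<in> {a<..<b} \<longrightarrow> ennreal (std_normal_density x) = 0"
      by (subst (asm) null_sets_density_iff) auto
    then have "AE x in lborel. x \<notin> {a<..<b}"
      by eventually_elim (use normal_density_pos[of 1 0] in \<open>force simp: ennreal_eq_0_iff not_le[symmetric]\<close>)
    then have "{a<..<b} \<in> null_sets lborel" by (subst AE_iff_null_sets) auto
    then show False using assms by (auto simp: null_sets_def)
  qed
  interpret N: real_distribution std_normal_distribution by (rule real_dist_normal_dist)
  show ?thesis using \<open>emeasure std_normal_distribution {a<..<b} \<noteq> 0\<close>
    by (simp add: N.emeasure_eq_measure zero_less_measure_iff)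
qed

lemma std_normal_fourth_moment_tail:
  assumes "a > 0" shows "std_gauss {a<..} \<le> 3 / a ^ 4"
proof -
  interpret N: real_distribution std_normal_distribution by (rule real_dist_normal_dist)
  have "std_gauss {a<..} \<le> std_gauss {x \<in> space std_normal_distribution. x ^ 4 \<ge> a ^ 4}"
  proof (rule N.finite_measure_mono)
    show "{a<..} \<subseteq> {x \<in> space std_normal_distribution. x ^ 4 \<ge> a ^ 4}"
      using assms by (auto intro!: power_mono)
  qed measurable
  also have "\<dots> \<le> (\<integral>x. x ^ 4 \<partial>std_normal_distribution) / a ^ 4"
    by (rule integral_Markov_inequality_measure[where A="{}"])
      (use assms integrable_std_normal_distribution_moment[of 4] in auto)
  also have "(\<integral>x. x ^ 4 \<partial>std_normal_distribution) = 3"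
    using std_normal_distribution_even_moments(1)[of 2] by (simp add: fact_numeral)
  finally show ?thesis .
qed

lemma std_normal_ray_positive: "std_gauss {a<..} > 0"
proof -
  interpret N: real_distribution std_normal_distribution by (rule real_dist_normal_dist)
  have "std_gauss {a<..<a + 1} \<le> std_gauss {a<..}" by (intro N.finite_measure_mono) auto
  then show ?thesis using std_normal_interval_positive[of a "a + 1"] by simp
qed

text \<open>
  Otherwise the tail would decay at most like \<open>a powr (-2)\<close> along a sequence of doubled levels, in contradiction to
  the finite fourth moment.
\<close>

lemma std_normal_tail_drops:
  shows "\<exists>a\<ge>b. std_gauss {a<..} > 4 * std_gauss {2 * a<..}"
proof (rule ccontr)
  assume "\<not> ?thesis"
  then have le: "std_gauss {a<..} \<le> 4 * std_gauss {2 * a<..}" if "a \<ge> b" for a using that by (meson not_less)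
  define a where "a = max 1 b"
  have a: "a \<ge> b" "a > 0" by (auto simp: a_def)
  have iter: "std_gauss {a<..} \<le> 4 ^ n * std_gauss {2 ^ n * a<..}" for n
  proof (induction n)
    case (Suc n)
    have "1 * a \<le> 2 ^ n * a" using a by (intro mult_right_mono) auto
    then have "std_gauss {2 ^ n * a<..} \<le> 4 * std_gauss {2 * (2 ^ n * a)<..}" using a by (intro le) linarith
    then have "4 ^ n * std_gauss {2 ^ n * a<..} \<le> 4 ^ n * (4 * std_gauss {2 * (2 ^ n * a)<..})" by (intro mult_left_mono) auto
    also have "4 ^ n * (4 * std_gauss {2 * (2 ^ n * a)<..}) = 4 ^ Suc n * std_gauss {2 ^ Suc n * a<..}" by (simp add: mult_ac)
    finally show ?case using Suc by linarith
  qed simp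
  have bound: "std_gauss {a<..} \<le> 3 / a ^ 4 * (1 / 4) ^ n" for n
  proof -
    have "4 ^ n * std_gauss {2 ^ n * a<..} \<le> 4 ^ n * (3 / (2 ^ n * a) ^ 4)"
      using a by (intro mult_left_mono std_normal_fourth_moment_tail) auto
    also have "(2 ^ n * a) ^ 4 = 4 ^ n * 4 ^ n * a ^ 4"
    proof -
      have "((2::real) ^ n) ^ 4 = (2 ^ 4) ^ n" by (metis power_commutes power_mult mult.commute)
      also have "\<dots> = (4 * 4) ^ n" by simp
      finally show ?thesis by (simp only: power_mult_distrib)
    qed
    also have "4 ^ n * (3 / (4 ^ n * 4 ^ n * a ^ 4)) = 3 / a ^ 4 * (1 / 4) ^ n"
      by (simp add: power_one_over field_simps)
    finally show ?thesis using iter[of n] by linarith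
  qed
  have "(\<lambda>n. 3 / a ^ 4 * (1 / 4 :: real) ^ n) \<longlonglongrightarrow> 3 / a ^ 4 * 0"
    by (intro tendsto_mult tendsto_const LIMSEQ_realpow_zero) auto
  then have "std_gauss {a<..} \<le> 3 / a ^ 4 * 0" by (rule LIMSEQ_le_const) (use bound in blast)
  then show False using std_normal_ray_positive[of a] by simp
qed

section \<open>First passage and approximation by the past\<close>

text \<open>
  A discrete strong Markov argument: let the events \<open>E t\<close> be watched in order of time.  If, at the time of the
  first one that occurs, \<open>G\<close> has conditional probability at most \<open>q\<close>, then the same bound holds given that any of them occurs.
\<close>

lemma (in prob_space) first_passage_finite:
  fixes F :: "'t::linorder \<Rightarrow> 'a measure"
  assumes T: "finite T"
    and mono: "\<And>s t. s \<in> T \<Longrightarrow> t \<in> T \<Longrightarrow> s \<le> t \<Longrightarrow> sets (F s) \<subseteq> sets (F t)"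
    and sub: "\<And>t. t \<in> T \<Longrightarrow> sets (F t) \<subseteq> sets M"
    and E: "\<And>t. t \<in> T \<Longrightarrow> E t \<in> sets (F t)" and G: "G \<in> sets M"
    and q: "\<And>t D. t \<in> T \<Longrightarrow> D \<in> sets (F t) \<Longrightarrow> D \<subseteq> E t \<Longrightarrow> prob (D \<inter> G) \<le> q * prob D"
  shows "prob ((\<Union>t\<in>T. E t) \<inter> G) \<le> q * prob (\<Union>t\<in>T. E t)"
  using T mono sub E q
proof (induction T rule: finite_linorder_max_induct)
  case (insert b A)
  let ?U = "\<Union>t\<in>A. E t" and ?D = "E b - (\<Union>t\<in>A. E t)"
  have "E t \<in> sets (F b)" if "t \<in> A" for t
    using insert.prems(3)[of t] insert.prems(1)[of t b] insert.hyps(2) that by (auto simp: less_imp_le)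
  then have UF: "?U \<in> sets (F b)" using insert.hyps(1) by (intro sets.finite_UN) auto
  have DF: "?D \<in> sets (F b)" using UF insert.prems(3)[of b] by auto
  have [measurable]: "?U \<in> sets M" "?D \<in> sets M" using UF DF insert.prems(2)[of b] by auto
  have split: "(\<Union>t\<in>insert b A. E t) = ?U \<union> ?D" by auto
  have "prob ((\<Union>t\<in>insert b A. E t) \<inter> G) = prob ((?U \<inter> G) \<union> (?D \<inter> G))"
    unfolding split by (rule arg_cong[where f=prob]) auto
  also have "\<dots> = prob (?U \<inter> G) + prob (?D \<inter> G)"
    using G by (intro finite_measure_Union) auto
  also have "\<dots> \<le> q * prob ?U + q * prob ?D"
  proof (rule add_mono)
    show "prob (?U \<inter> G) \<le> q * prob ?U"
    proof (rule insert.IH)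
      show "prob (D \<inter> G) \<le> q * prob D" if "t \<in> A" "D \<in> sets (F t)" "D \<subseteq> E t" for t D
        by (rule insert.prems(4)[of t]) (use that in auto)
    qed (use insert.prems(1-3) in auto)
    show "prob (?D \<inter> G) \<le> q * prob ?D"
      by (rule insert.prems(4)[OF _ DF]) auto
  qed
  also have "\<dots> = q * prob (\<Union>t\<in>insert b A. E t)"
    unfolding split by (subst finite_measure_Union) (auto simp: algebra_simps)
  finally show ?case .
qed simp

text \<open>
  The set of times need not be well-ordered, for instance it may consist of rationals; finite subsets exhaust it.
\<close>

lemma (in prob_space) first_passage:
  fixes F :: "'t::linorder \<Rightarrow> 'a measure"
  assumes T: "countable T"
    and mono: "\<And>s t. s \<in> T \<Longrightarrow> t \<in> T \<Longrightarrow> s \<le> t \<Longrightarrow> sets (F s) \<subseteq> sets (F t)"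
    and sub: "\<And>t. t \<in> T \<Longrightarrow> sets (F t) \<subseteq> sets M"
    and E: "\<And>t. t \<in> T \<Longrightarrow> E t \<in> sets (F t)" and G: "G \<in> sets M"
    and q: "\<And>t D. t \<in> T \<Longrightarrow> D \<in> sets (F t) \<Longrightarrow> D \<subseteq> E t \<Longrightarrow> prob (D \<inter> G) \<le> q * prob D"
  shows "prob ((\<Union>t\<in>T. E t) \<inter> G) \<le> q * prob (\<Union>t\<in>T. E t)"
proof (cases "T = {}")
  case False
  let ?f = "from_nat_into T"
  have f: "?f i \<in> T" for i by (rule from_nat_into[OF False])
  have ran: "T = range ?f" using range_from_nat_into[OF False T] ..
  define A where "A n = (\<Union>i\<le>n. E (?f i))" for n
  have A_image: "A n = (\<Union>t\<in>?f ` {..n}. E t)" for n by (simp add: A_def)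
  have [measurable]: "E (?f i) \<in> sets M" for i using E[OF f] sub[OF f] by auto
  have [measurable]: "A n \<in> sets M" for n unfolding A_def by measurable
  have inc: "incseq A" unfolding incseq_def A_def by (intro allI impI UN_mono) auto
  have "(\<Union>n. A n) = (\<Union>t\<in>range ?f. E t)" unfolding A_def by auto
  then have U: "(\<Union>n. A n) = (\<Union>t\<in>T. E t)" unfolding ran[symmetric] .
  have "(\<lambda>n. prob (A n)) \<longlonglongrightarrow> prob (\<Union>n. A n)"
    by (rule finite_Lim_measure_incseq[OF _ inc]) auto
  then have "(\<lambda>n. q * prob (A n)) \<longlonglongrightarrow> q * prob (\<Union>t\<in>T. E t)"
    unfolding U by (rule tendsto_mult[OF tendsto_const])
  moreover have "(\<lambda>n. prob (A n \<inter> G)) \<longlonglongrightarrow> prob (\<Union>n. A n \<inter> G)"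
  proof (rule finite_Lim_measure_incseq)
    show "range (\<lambda>n. A n \<inter> G) \<subseteq> events" using G by auto
    show "incseq (\<lambda>n. A n \<inter> G)" using inc unfolding incseq_def by blast
  qed
  moreover have "(\<Union>n. A n \<inter> G) = (\<Union>t\<in>T. E t) \<inter> G" using U by blast
  moreover have "prob (A n \<inter> G) \<le> q * prob (A n)" for n
  proof -
    have inT: "t \<in> T" if "t \<in> ?f ` {..n}" for t using that f by auto
    show ?thesis unfolding A_image
      by (rule first_passage_finite[where F=F, OF _ mono[OF inT inT] sub[OF inT] E[OF inT] G q[OF inT]]) auto
  qed
  ultimately show ?thesis by (auto intro: LIMSEQ_le)
qed simp

text \<open>
  The events that can be approximated form a sigma-algebra.  This serves in place of the convergence of conditional
  probabilities in Levy's zero-one law.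
\<close>

lemma (in prob_space) filtration_approximation:
  fixes F :: "nat \<Rightarrow> 'a measure"
  assumes mono: "\<And>m n. m \<le> n \<Longrightarrow> sets (F m) \<subseteq> sets (F n)" and sub: "\<And>n. sets (F n) \<subseteq> sets M"
    and D: "D \<in> sigma_sets (space M) (\<Union>n. sets (F n))" and sp: "\<And>n. space (F n) = space M" and e: "e > 0"
  shows "\<exists>n. \<exists>A\<in>sets (F n). prob (sym_diff D A) < e"
  using D e
proof (induction arbitrary: e rule: sigma_sets.induct)
  case (Basic a)
  then obtain n where "a \<in> sets (F n)" by auto
  then show ?case using Basic(2) by (intro exI[of _ n] bexI[of _ a]) auto
next
  case Empty
  have "{} \<in> sets (F 0)" by simp
  then show ?case using Empty by (metis Un_empty_left Diff_empty measure_empty)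
next
  case (Compl a)
  then obtain n A where A: "A \<in> sets (F n)" "prob (sym_diff a A) < e" by blast
  have "a \<subseteq> space M"
    using Compl(1) sigma_sets_into_sp[of "\<Union>n. sets (F n)" "space M"] sets.sets_into_space sp by blast
  moreover have "A \<subseteq> space M" using sets.sets_into_space[OF A(1)] sp by simp
  ultimately have "sym_diff (space M - a) (space M - A) = sym_diff a A" by auto
  moreover have "space M - A \<in> sets (F n)" using sets.compl_sets[OF A(1)] sp by simp
  ultimately show ?case using A by metis
next
  case (Union a)
  have aM: "a i \<in> sets M" for i
    using Union(1)[of i] sub sets.sigma_sets_subset[of "\<Union>n. sets (F n)" M] by blast
  let ?U = "\<Union>i. a i"
  have "(\<lambda>N. prob (\<Union>i\<le>N. a i)) \<longlonglongrightarrow> prob (\<Union>N. \<Union>i\<le>N. a i)"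
  proof (rule finite_Lim_measure_incseq)
    show "range (\<lambda>N. \<Union>i\<le>N. a i) \<subseteq> events" using aM by auto
    show "incseq (\<lambda>N. \<Union>i\<le>N. a i)" unfolding incseq_def by (intro allI impI UN_mono) auto
  qed
  also have "(\<Union>N. \<Union>i\<le>N. a i) = ?U" by auto
  finally have "\<forall>\<^sub>F N in sequentially. prob ?U - e / 2 < prob (\<Union>i\<le>N. a i)"
    using Union.prems by (intro order_tendstoD(1)) auto
  then obtain N where N: "prob ?U - e / 2 < prob (\<Union>i\<le>N. a i)" unfolding eventually_sequentially by auto
  define d where "d = e / (2 * real (Suc N))"
  have d: "d > 0" using Union.prems by (simp add: d_def)
  have "\<forall>i. \<exists>n A. A \<in> sets (F n) \<and> prob (sym_diff (a i) A) < d" using Union.IH[OF d] by blast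
  then obtain n A where A: "\<And>i. A i \<in> sets (F (n i))" "\<And>i. prob (sym_diff (a i) (A i)) < d" by metis
  define m where "m = Max (n ` {..N})"
  have Am: "A i \<in> sets (F m)" if "i \<le> N" for i
    using A(1)[of i] mono[of "n i" m] that unfolding m_def by (auto intro!: Max_ge)
  then have Bm: "(\<Union>i\<le>N. A i) \<in> sets (F m)" by (intro sets.finite_UN) auto
  have sdM: "sym_diff (a i) (A i) \<in> sets M" for i using aM A(1) sub by blast
  have UM: "(\<Union>i\<le>N. a i) \<in> sets M" "?U \<in> sets M" using aM by auto
  have R: "(\<Union>i\<le>N. sym_diff (a i) (A i)) \<in> sets M"
    by (rule sets.finite_UN[OF finite_atMost sdM])
  have L: "?U - (\<Union>i\<le>N. a i) \<in> sets M" by (rule sets.Diff[OF UM(2,1)])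
  have "prob (sym_diff ?U (\<Union>i\<le>N. A i)) \<le> prob ((?U - (\<Union>i\<le>N. a i)) \<union> (\<Union>i\<le>N. sym_diff (a i) (A i)))"
    by (rule finite_measure_mono[OF _ sets.Un[OF L R]]) auto
  also have "\<dots> \<le> prob (?U - (\<Union>i\<le>N. a i)) + prob (\<Union>i\<le>N. sym_diff (a i) (A i))"
    by (rule measure_Un_le[OF L R])
  also have "prob (?U - (\<Union>i\<le>N. a i)) = prob ?U - prob (\<Union>i\<le>N. a i)"
    by (rule finite_measure_Diff) (use UM in auto)
  also have "prob (\<Union>i\<le>N. sym_diff (a i) (A i)) \<le> (\<Sum>i\<le>N. prob (sym_diff (a i) (A i)))"
    by (rule finite_measure_subadditive_finite) (use sdM in auto)
  also have "(\<Sum>i\<le>N. prob (sym_diff (a i) (A i))) \<le> (\<Sum>i\<le>N. d)"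
    by (intro sum_mono less_imp_le A(2))
  also have "(\<Sum>i\<le>N. d) = e / 2" by (simp add: d_def field_simps del: of_nat_Suc)
  finally have "prob (sym_diff ?U (\<Union>i\<le>N. A i)) < e" using N by linarith
  then show ?case using Bm by blast
qed

section \<open>Continuous functions observed at countably many times\<close>

lemma rational_witness:
  fixes h :: "real \<Rightarrow> real"
  assumes h: "continuous_on {s..t} h" and st: "s < t" and r: "r \<in> {s..t}" "h r > 0"
  obtains q where "q \<in> \<rat>" "q \<in> {s..t}" "h q > 0"
proof -
  obtain d where d: "d > 0" "\<And>x. x \<in> {s..t} \<Longrightarrow> dist x r < d \<Longrightarrow> dist (h x) (h r) < h r"
    using h r unfolding continuous_on_iff by metis
  have "max s (r - d) < min t (r + d)" using st r d by auto
  then obtain q where q: "q \<in> \<rat>" "max s (r - d) < q" "q < min t (r + d)"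
    using Rats_dense_in_real by blast
  then have "dist (h q) (h r) < h r" by (intro d(2)) (auto simp: dist_real_def)
  then show thesis using q by (intro that[of q]) (auto simp: dist_real_def)
qed

lemma rational_witness_at_top:
  fixes h :: "real \<Rightarrow> real"
  assumes h: "continuous_on {1..} h" and a: "1 \<le> a" and r: "a \<le> r" "h r > 0"
  obtains q where "q \<in> \<rat>" "a \<le> q" "h q > 0"
proof (rule rational_witness[of a "r + 1" h r])
  show "continuous_on {a..r + 1} h" by (rule continuous_on_subset[OF h]) (use a in auto)
qed (use r that in auto)

text \<open>
  For continuous functions, this and the next equivalence describe the asymptotic behaviour by countably many
  times, which makes the corresponding events measurable.
\<close>

lemma continuous_tendsto_0_rational_iff:
  assumes h: "continuous_on {1..} (h :: real \<Rightarrow> real)"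
  shows "(h \<longlongrightarrow> 0) at_top \<longleftrightarrow> (\<forall>j::nat. \<exists>n::nat. \<forall>q\<in>\<rat> \<inter> {real (Suc n)..}. \<bar>h q\<bar> \<le> 1 / real (Suc j))"
proof
  assume lim: "(h \<longlongrightarrow> 0) at_top"
  show "\<forall>j::nat. \<exists>n::nat. \<forall>q\<in>\<rat> \<inter> {real (Suc n)..}. \<bar>h q\<bar> \<le> 1 / real (Suc j)"
  proof
    fix j :: nat
    have "\<forall>\<^sub>F t in at_top. dist (h t) 0 < 1 / real (Suc j)" by (rule tendstoD[OF lim]) simp
    then obtain t0 where t0: "\<And>t. t \<ge> t0 \<Longrightarrow> \<bar>h t\<bar> < 1 / real (Suc j)"
      unfolding eventually_at_top_linorder by auto
    obtain n :: nat where "t0 \<le> real n" using real_arch_simple by blast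
    then show "\<exists>n::nat. \<forall>q\<in>\<rat> \<inter> {real (Suc n)..}. \<bar>h q\<bar> \<le> 1 / real (Suc j)"
      using t0 by (intro exI[of _ n]) (force intro: less_imp_le)
  qed
next
  assume R: "\<forall>j::nat. \<exists>n::nat. \<forall>q\<in>\<rat> \<inter> {real (Suc n)..}. \<bar>h q\<bar> \<le> 1 / real (Suc j)"
  show "(h \<longlongrightarrow> 0) at_top"
  proof (rule tendstoI)
    fix e :: real assume "e > 0"
    then obtain j :: nat where j: "1 / real (Suc j) < e" using nat_approx_posE by metis
    from R obtain n where "\<forall>q\<in>\<rat> \<inter> {real (Suc n)..}. \<bar>h q\<bar> \<le> 1 / real (Suc j)" by blast
    then have n: "\<And>q. q \<in> \<rat> \<Longrightarrow> real (Suc n) \<le> q \<Longrightarrow> \<bar>h q\<bar> \<le> 1 / real (Suc j)" by blast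
    have "\<bar>h t\<bar> \<le> 1 / real (Suc j)" if t: "real (Suc n) \<le> t" for t
    proof (rule ccontr)
      assume "\<not> ?thesis"
      then have "\<bar>h t\<bar> - 1 / real (Suc j) > 0" by simp
      moreover have "continuous_on {1..} (\<lambda>t. \<bar>h t\<bar> - 1 / real (Suc j))" by (intro continuous_intros h) 
      ultimately obtain q where "q \<in> \<rat>" "real (Suc n) \<le> q" "\<bar>h q\<bar> - 1 / real (Suc j) > 0"
        using rational_witness_at_top[of "\<lambda>t. \<bar>h t\<bar> - 1 / real (Suc j)" "real (Suc n)" t] t by auto
      then show False using n[of q] by linarith
    qed
    then have "dist (h t) 0 < e" if "real (Suc n) \<le> t" for t using j that by (fastforce simp: dist_real_def)
    then show "\<forall>\<^sub>F t in at_top. dist (h t) 0 < e" unfolding eventually_at_top_linorder by blast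
  qed
qed

lemma continuous_at_top_rational_iff:
  assumes h: "continuous_on {1..} (h :: real \<Rightarrow> real)"
  shows "filterlim h at_top at_top \<longleftrightarrow> (\<forall>j::nat. \<exists>n::nat. \<forall>q\<in>\<rat> \<inter> {real (Suc n)..}. real j \<le> h q)"
proof
  assume lim: "filterlim h at_top at_top"
  show "\<forall>j::nat. \<exists>n::nat. \<forall>q\<in>\<rat> \<inter> {real (Suc n)..}. real j \<le> h q"
  proof
    fix j :: nat
    have "\<forall>\<^sub>F t in at_top. real j \<le> h t" using lim unfolding filterlim_at_top by blast
    then obtain t0 where t0: "\<And>t. t \<ge> t0 \<Longrightarrow> real j \<le> h t" unfolding eventually_at_top_linorder by auto
    obtain n :: nat where "t0 \<le> real n" using real_arch_simple by blast
    then show "\<exists>n::nat. \<forall>q\<in>\<rat> \<inter> {real (Suc n)..}. real j \<le> h q" using t0 by (intro exI[of _ n]) force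
  qed
next
  assume R: "\<forall>j::nat. \<exists>n::nat. \<forall>q\<in>\<rat> \<inter> {real (Suc n)..}. real j \<le> h q"
  show "filterlim h at_top at_top"
    unfolding filterlim_at_top
  proof
    fix C :: real
    obtain j :: nat where j: "C \<le> real j" using real_arch_simple by blast
    from R obtain n where "\<forall>q\<in>\<rat> \<inter> {real (Suc n)..}. real j \<le> h q" by blast
    then have n: "\<And>q. q \<in> \<rat> \<Longrightarrow> real (Suc n) \<le> q \<Longrightarrow> real j \<le> h q" by blast
    have "real j \<le> h t" if t: "real (Suc n) \<le> t" for t
    proof (rule ccontr)
      assume "\<not> ?thesis"
      then have "real j - h t > 0" by simp
      moreover have "continuous_on {1..} (\<lambda>t. real j - h t)" by (intro continuous_intros h) 
      ultimately obtain q where "q \<in> \<rat>" "real (Suc n) \<le> q" "real j - h q > 0"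
        using rational_witness_at_top[of "\<lambda>t. real j - h t" "real (Suc n)" t] t by auto
      then show False using n[of q] by linarith
    qed
    then have "\<forall>t\<ge>real (Suc n). C \<le> h t" using j order_trans by blast
    then show "\<forall>\<^sub>F t in at_top. C \<le> h t" unfolding eventually_at_top_linorder by blast
  qed
qed

lemma riemann_sums_tendsto:
  fixes g :: "real \<Rightarrow> real"
  assumes g: "continuous_on {a..b} g" and ab: "a \<le> b"
  shows "(\<lambda>n. \<Sum>j<Suc n. (b - a) / real (Suc n) * g (grid a b (Suc n) j)) \<longlonglongrightarrow> integral {a..b} g"
proof (rule LIMSEQ_I)
  fix e :: real assume e: "0 < e"
  define e' where "e' = e / (b - a + 1)"
  have e': "e' > 0" "e' * (b - a) < e" using e ab by (auto simp: e'_def field_simps)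
  have "uniformly_continuous_on {a..b} g" by (rule compact_uniformly_continuous[OF g]) simp
  then obtain d where d: "d > 0" "\<And>x y. x \<in> {a..b} \<Longrightarrow> y \<in> {a..b} \<Longrightarrow> dist y x < d \<Longrightarrow> dist (g y) (g x) < e'"
    using e'(1) unfolding uniformly_continuous_on_def by metis
  obtain N :: nat where N: "(b - a) / d < real N" using reals_Archimedean2 by blast
  have close: "norm ((\<Sum>j<m. (b - a) / real m * g (grid a b m j)) - integral {a..b} g) < e" if m: "m > 0" "N \<le> m" for m
  proof -
    note G = grid_props[OF ab m(1)]
    have "(b - a) / d < real m" using N m(2) by (meson less_le_trans of_nat_le_iff)
    then have mesh: "(b - a) / real m < d" using d m by (simp add: pos_divide_less_eq mult.commute)
    have sub: "{grid a b m i..grid a b m j} \<subseteq> {a..b}" if "j \<le> m" for i j using G(4)[of i] G(5)[OF that] by auto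
    have "\<bar>(\<Sum>j<n. (b - a) / real m * g (grid a b m j)) - integral {a..grid a b m n} g\<bar> \<le> e' * (grid a b m n - a)" if "n \<le> m" for n
      using that
    proof (induction n)
      case 0
      then show ?case by (simp add: G(1))
    next
      case (Suc n)
      let ?x = "grid a b m n" and ?y = "grid a b m (Suc n)"
      have xy: "?x \<le> ?y" "a \<le> ?x" using G(3,4) by auto
      have contxy: "continuous_on {?x..?y} g" by (rule continuous_on_subset[OF g sub]) (use Suc in auto)
      have "integral {a..?x} g + integral {?x..?y} g = integral {a..?y} g"
      proof (rule Henstock_Kurzweil_Integration.integral_combine[OF xy(2,1)])
        have "continuous_on {a..?y} g" by (rule continuous_on_subset[OF g]) (use G(5)[OF Suc.prems] in auto)
        then show "g integrable_on {a..?y}" by (rule integrable_continuous_interval)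
      qed
      moreover have "\<bar>integral {?x..?y} g - (b - a) / real m * g ?x\<bar> \<le> e' * (?y - ?x)"
      proof -
        have "norm (integral {?x..?y} (\<lambda>u. g u - g ?x)) \<le> e' * (?y - ?x)"
        proof (rule integral_bound[OF xy(1)])
          show "continuous_on {?x..?y} (\<lambda>u. g u - g ?x)" by (intro continuous_intros contxy)
          fix u assume u: "u \<in> {?x..?y}"
          have "dist u ?x < d" using u mesh G(6)[of n] by (simp add: dist_real_def)
          moreover have "u \<in> {a..b}" using u sub[OF Suc.prems, of n] by blast
          moreover have "?x \<in> {a..b}" using sub[OF Suc.prems, of n] xy by auto
          ultimately show "norm (g u - g ?x) \<le> e'" using d(2)[of ?x u] by (simp add: dist_real_def)
        qed
        moreover have "integral {?x..?y} (\<lambda>u. g u - g ?x) = integral {?x..?y} g - (?y - ?x) * g ?x"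
          using xy by (subst Henstock_Kurzweil_Integration.integral_diff) (auto intro!: integrable_continuous_interval contxy)
        ultimately show ?thesis by (simp add: G(6))
      qed
      moreover have "\<bar>(\<Sum>j<n. (b - a) / real m * g (grid a b m j)) - integral {a..?x} g\<bar> \<le> e' * (?x - a)"
        using Suc by simp
      moreover have "e' * (?y - a) = e' * (?x - a) + e' * (?y - ?x)" by (simp add: algebra_simps)
      ultimately show ?case unfolding sum.lessThan_Suc by linarith
    qed
    from this[of m] have "\<bar>(\<Sum>j<m. (b - a) / real m * g (grid a b m j)) - integral {a..b} g\<bar> \<le> e' * (b - a)"
      by (simp add: G(2))
    then show ?thesis using e'(2) by simp
  qed
  show "\<exists>n0. \<forall>n\<ge>n0. norm ((\<Sum>j<Suc n. (b - a) / real (Suc n) * g (grid a b (Suc n) j)) - integral {a..b} g) < e"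
    by (intro exI[of _ N] allI impI close) auto
qed

text \<open>
  Riemann sums exhibit the pathwise integral of an adapted continuous process as a limit of adapted variables.
\<close>

lemma borel_measurable_pathwise_integral:
  fixes f :: "real \<Rightarrow> 'a \<Rightarrow> real"
  assumes ab: "a \<le> b" and f: "\<And>s. s \<in> {a..b} \<Longrightarrow> f s \<in> borel_measurable N"
    and cont: "\<And>\<omega>. \<omega> \<in> space N \<Longrightarrow> continuous_on {a..b} (\<lambda>s. f s \<omega>)"
  shows "(\<lambda>\<omega>. integral {a..b} (\<lambda>s. f s \<omega>)) \<in> borel_measurable N"
proof (rule borel_measurable_LIMSEQ_metric)
  show "(\<lambda>n. \<Sum>j<Suc n. (b - a) / real (Suc n) * f (grid a b (Suc n) j) \<omega>) \<longlonglongrightarrow> integral {a..b} (\<lambda>s. f s \<omega>)"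
    if "\<omega> \<in> space N" for \<omega>
    by (rule riemann_sums_tendsto[OF cont[OF that] ab])
  fix n
  have "f (grid a b (Suc n) j) \<in> borel_measurable N" if "j < Suc n" for j
    using grid_props(4,5)[OF ab, of "Suc n" j] that by (intro f) auto
  then show "(\<lambda>\<omega>. \<Sum>j<Suc n. (b - a) / real (Suc n) * f (grid a b (Suc n) j) \<omega>) \<in> borel_measurable N"
    by (intro borel_measurable_sum borel_measurable_times borel_measurable_const) auto
qed

section \<open>Convergence of a Gaussian noise with finite total variance\<close>

text \<open>
  The abstract properties of the stochastic integral of \<open>exp (-s/2)\<close>.  Continuity is required of every path; the
  noise of a solution is recovered from the integrated equation, where this holds.
\<close>

locale gaussian_noise = prob_space M + filtration "space M" F
  for M :: "'a measure" and F :: "real \<Rightarrow> 'a measure" +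
  fixes V :: "real \<Rightarrow> 'a \<Rightarrow> real"
  assumes sub: "1 \<le> t \<Longrightarrow> subalgebra M (F t)"
    and V_adapted: "1 \<le> t \<Longrightarrow> V t \<in> borel_measurable (F t)"
    and V_continuous: "\<omega> \<in> space M \<Longrightarrow> continuous_on {1..} (\<lambda>t. V t \<omega>)"
    and V_gauss: "1 \<le> s \<Longrightarrow> s \<le> t \<Longrightarrow> gauss_indep (F s) (\<lambda>\<omega>. V t \<omega> - V s \<omega>) (exp (- s) - exp (- t))"
begin

lemma sets_F: "1 \<le> t \<Longrightarrow> A \<in> sets (F t) \<Longrightarrow> A \<in> sets M"
  using sub by (auto simp: subalgebra_def)

lemma adapted_mono: "f \<in> borel_measurable (F s) \<Longrightarrow> s \<le> t \<Longrightarrow> f \<in> borel_measurable (F t)"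
  using sets_F_mono[of s t] measurable_mono[of borel borel "F s" "F t"] by (auto simp: space_F)

lemma V_measurable: "1 \<le> t \<Longrightarrow> V t \<in> borel_measurable M"
  using measurable_from_subalg[OF sub V_adapted] .

lemma V_increment_law:
  assumes st: "1 \<le> s" "s \<le> t" and g: "g \<in> sets (F s)" and S: "S \<in> sets borel" and \<epsilon>: "\<epsilon> \<in> {1, -1::real}"
  shows "prob (g \<inter> {\<omega>\<in>space M. \<epsilon> * (V t \<omega> - V s \<omega>) \<in> S}) = prob g * std_gauss {x. sqrt (exp (- s) - exp (- t)) * x \<in> S}"
proof -
  have "gauss_indep (F s) (\<lambda>\<omega>. \<epsilon> * (V t \<omega> - V s \<omega>)) (exp (- s) - exp (- t))"
    using V_gauss[OF st] gauss_indep_uminus[OF V_gauss[OF st]] \<epsilon> by auto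
  from gauss_indep_law[OF sub[OF st(1)] this _ g S] st show ?thesis by simp
qed

text \<open>
  Levy's maximal inequality.  When \<open>V\<close> first exceeds the level, the remaining increment up to \<open>t\<close> is symmetric, so the
  process is back below the level at time \<open>t\<close> with conditional probability at most one half.  The sign \<open>\<epsilon>\<close> covers upward
  and downward excursions together.
\<close>

lemma levy_one_sided:
  assumes st: "1 \<le> s" "s \<le> t" and g: "g \<in> sets (F s)" and \<epsilon>: "\<epsilon> \<in> {1, -1::real}"
    and T: "countable T" "T \<subseteq> {s..t}"
  shows "prob (g \<inter> {\<omega>\<in>space M. \<exists>r\<in>T. \<epsilon> * (V r \<omega> - V s \<omega>) > a}) \<le>
    2 * (prob g * std_gauss {x. sqrt (exp (- s) - exp (- t)) * x > a})"
proof -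
  let ?E = "\<lambda>r. g \<inter> {\<omega>\<in>space M. \<epsilon> * (V r \<omega> - V s \<omega>) > a}"
  let ?G = "{\<omega>\<in>space M. \<not> \<epsilon> * (V t \<omega> - V s \<omega>) > a}"
  have E: "?E r \<in> sets (F r)" if "r \<in> T" for r
  proof -
    have r: "s \<le> r" "1 \<le> r" using that T st by auto
    have [measurable]: "V r \<in> borel_measurable (F r)" "V s \<in> borel_measurable (F r)" "g \<in> sets (F r)"
      using V_adapted r st adapted_mono[OF V_adapted, of s r] g sets_F_mono[of s r] by auto
    have "{\<omega>\<in>space (F r). \<epsilon> * (V r \<omega> - V s \<omega>) > a} \<in> sets (F r)" by measurable
    then show ?thesis by (auto simp: space_F)
  qed
  have [measurable]: "V s \<in> borel_measurable M" "V t \<in> borel_measurable M" using V_measurable st by auto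
  have G: "?G \<in> sets M" by measurable
  have EM: "?E r \<in> sets M" if "r \<in> T" for r using E[OF that] sets_F[of r] T that st by auto
  have UM: "(\<Union>r\<in>T. ?E r) \<in> sets M" using T EM by (intro sets.countable_UN') auto
  have "prob ((\<Union>r\<in>T. ?E r) \<inter> ?G) \<le> 1 / 2 * prob (\<Union>r\<in>T. ?E r)"
  proof (rule first_passage[where F=F, OF T(1)])
    fix r D assume r: "r \<in> T" and D: "D \<in> sets (F r)" "D \<subseteq> ?E r"
    have rt: "1 \<le> r" "r \<le> t" using r T st by auto
    have [measurable]: "V r \<in> borel_measurable M" "D \<in> sets M" using V_measurable rt D sets_F by auto
    have "prob (D \<inter> ?G) \<le> prob (D \<inter> {\<omega>\<in>space M. \<epsilon> * (V t \<omega> - V r \<omega>) \<in> {..<0}})"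
    proof (rule finite_measure_mono)
      show "D \<inter> ?G \<subseteq> D \<inter> {\<omega>\<in>space M. \<epsilon> * (V t \<omega> - V r \<omega>) \<in> {..<0}}"
        using D(2) by (auto simp: algebra_simps)
    qed measurable
    also have "\<dots> = prob D * std_gauss {x. sqrt (exp (- r) - exp (- t)) * x \<in> {..<0}}"
      by (rule V_increment_law[OF rt D(1) _ \<epsilon>]) simp
    also have "\<dots> \<le> prob D * (1 / 2)"
      using std_normal_negative_le_half[of "exp (- r) - exp (- t)"] rt by (intro mult_left_mono) auto
    finally show "prob (D \<inter> ?G) \<le> 1 / 2 * prob D" by simp
  next
    fix r r' :: real assume "r \<le> r'" then show "sets (F r) \<subseteq> sets (F r')" by (rule sets_F_mono)
  next
    fix r assume "r \<in> T" then show "sets (F r) \<subseteq> sets M" using sets_F[of r] T st by auto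
  qed (use E G in auto)
  moreover have "prob (\<Union>r\<in>T. ?E r) = prob ((\<Union>r\<in>T. ?E r) \<inter> ?G) + prob ((\<Union>r\<in>T. ?E r) - ?G)"
    unfolding finite_measure_Diff'[OF UM G] by linarith
  moreover have "prob ((\<Union>r\<in>T. ?E r) - ?G) \<le> prob (g \<inter> {\<omega>\<in>space M. \<epsilon> * (V t \<omega> - V s \<omega>) \<in> {a<..}})"
  proof (rule finite_measure_mono)
    show "(\<Union>r\<in>T. ?E r) - ?G \<subseteq> g \<inter> {\<omega>\<in>space M. \<epsilon> * (V t \<omega> - V s \<omega>) \<in> {a<..}}" by auto
    have "{\<omega>\<in>space M. \<epsilon> * (V t \<omega> - V s \<omega>) \<in> {a<..}} \<in> sets M" by measurable
    then show "g \<inter> {\<omega>\<in>space M. \<epsilon> * (V t \<omega> - V s \<omega>) \<in> {a<..}} \<in> sets M"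
      using sets_F[OF st(1) g] by auto
  qed
  moreover have "prob (g \<inter> {\<omega>\<in>space M. \<epsilon> * (V t \<omega> - V s \<omega>) \<in> {a<..}}) = prob g * std_gauss {x. sqrt (exp (- s) - exp (- t)) * x \<in> {a<..}}"
    by (rule V_increment_law[OF st g _ \<epsilon>]) simp
  moreover have eqU: "(\<Union>r\<in>T. ?E r) = g \<inter> {\<omega>\<in>space M. \<exists>r\<in>T. \<epsilon> * (V r \<omega> - V s \<omega>) > a}" by auto
  ultimately show ?thesis unfolding eqU[symmetric] greaterThan_iff by linarith
qed

definition oscillates :: "real \<Rightarrow> real \<Rightarrow> real \<Rightarrow> 'a set" where
  "oscillates s t a = {\<omega>\<in>space M. \<exists>r\<in>{s..t}. \<bar>V r \<omega> - V s \<omega>\<bar> > a}"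

lemma oscillates_rational:
  assumes st: "1 \<le> s" "s < t"
  shows "oscillates s t a = {\<omega>\<in>space M. \<exists>r\<in>{s..t} \<inter> \<rat>. \<bar>V r \<omega> - V s \<omega>\<bar> > a}"
proof -
  have "\<exists>q\<in>{s..t} \<inter> \<rat>. \<bar>V q \<omega> - V s \<omega>\<bar> > a"
    if \<omega>: "\<omega> \<in> space M" and r: "r \<in> {s..t}" "\<bar>V r \<omega> - V s \<omega>\<bar> > a" for \<omega> r
  proof -
    have "continuous_on {s..t} (\<lambda>x. \<bar>V x \<omega> - V s \<omega>\<bar> - a)"
      by (intro continuous_intros continuous_on_subset[OF V_continuous[OF \<omega>]]) (use st in auto)
    from rational_witness[OF this st(2) r(1)] r(2) obtain q where "q \<in> \<rat>" "q \<in> {s..t}" "\<bar>V q \<omega> - V s \<omega>\<bar> - a > 0" by auto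
    then show ?thesis by auto
  qed
  then show ?thesis unfolding oscillates_def by auto
qed

lemma oscillates_measurable:
  assumes st: "1 \<le> s" "s < t" shows "oscillates s t a \<in> sets M"
proof -
  have "{\<omega>\<in>space M. \<bar>V r \<omega> - V s \<omega>\<bar> > a} \<in> sets M" if "r \<in> {s..t}" for r
  proof -
    have [measurable]: "V r \<in> borel_measurable M" "V s \<in> borel_measurable M" using V_measurable st that by auto
    show ?thesis by measurable
  qed
  then have "(\<Union>r\<in>{s..t} \<inter> \<rat>. {\<omega>\<in>space M. \<bar>V r \<omega> - V s \<omega>\<bar> > a}) \<in> sets M"
    by (intro sets.countable_UN' countable_Int2 countable_rat) auto
  also have "(\<Union>r\<in>{s..t} \<inter> \<rat>. {\<omega>\<in>space M. \<bar>V r \<omega> - V s \<omega>\<bar> > a}) = oscillates s t a"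
    unfolding oscillates_rational[OF st] by auto
  finally show ?thesis .
qed

lemma levy_inequality:
  assumes st: "1 \<le> s" "s < t" and g: "g \<in> sets (F s)"
  shows "prob (g \<inter> oscillates s t a) \<le> 4 * (prob g * std_gauss {x. sqrt (exp (- s) - exp (- t)) * x > a})"
proof -
  let ?T = "{s..t} \<inter> \<rat>"
  let ?B = "\<lambda>\<epsilon>. g \<inter> {\<omega>\<in>space M. \<exists>r\<in>?T. \<epsilon> * (V r \<omega> - V s \<omega>) > a}"
  have T: "countable ?T" "?T \<subseteq> {s..t}" by (auto intro: countable_Int2 countable_rat)
  have BM: "?B \<epsilon> \<in> sets M" for \<epsilon>
  proof -
    have "{\<omega>\<in>space M. \<epsilon> * (V r \<omega> - V s \<omega>) > a} \<in> sets M" if "r \<in> {s..t}" for r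
    proof -
      have [measurable]: "V r \<in> borel_measurable M" "V s \<in> borel_measurable M" using V_measurable st that by auto
      show ?thesis by measurable
    qed
    then have "(\<lambda>r. {\<omega>\<in>space M. \<epsilon> * (V r \<omega> - V s \<omega>) > a}) ` ?T \<subseteq> sets M" by blast
    then have "g \<inter> (\<Union>r\<in>?T. {\<omega>\<in>space M. \<epsilon> * (V r \<omega> - V s \<omega>) > a}) \<in> sets M"
      by (intro sets.Int[OF sets_F[OF st(1) g]] sets.countable_UN'[OF T(1)])
    also have "g \<inter> (\<Union>r\<in>?T. {\<omega>\<in>space M. \<epsilon> * (V r \<omega> - V s \<omega>) > a}) = ?B \<epsilon>" by auto
    finally show ?thesis .
  qed
  have "g \<inter> oscillates s t a = ?B 1 \<union> ?B (-1)"
  proof -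
    have "\<bar>x\<bar> > a \<longleftrightarrow> 1 * x > a \<or> - 1 * x > a" for x :: real by linarith
    then show ?thesis unfolding oscillates_rational[OF st] by blast
  qed
  then have "prob (g \<inter> oscillates s t a) \<le> prob (?B 1) + prob (?B (-1))"
    using measure_Un_le[OF BM BM, of 1 "-1"] by simp
  then show ?thesis
    using levy_one_sided[OF st(1) less_imp_le[OF st(2)] g insertI1 T, of a]
      levy_one_sided[OF st(1) less_imp_le[OF st(2)] g insertI2[OF singletonI] T, of a] by linarith
qed

text \<open>
  Levy's inequality combined with Chebyshev's.
\<close>

lemma oscillation_bound:
  assumes st: "1 \<le> s" "s < t" and g: "g \<in> sets (F s)" and a: "a > 0"
  shows "prob (g \<inter> oscillates s t a) \<le> 4 * prob g * exp (- s) / a\<^sup>2"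
proof -
  have "std_gauss {x. sqrt (exp (- s) - exp (- t)) * x > a} \<le> (exp (- s) - exp (- t)) / a\<^sup>2"
    using st a by (intro std_normal_tail_le) auto
  also have "\<dots> \<le> exp (- s) / a\<^sup>2" by (intro divide_right_mono) auto
  finally have "4 * (prob g * std_gauss {x. sqrt (exp (- s) - exp (- t)) * x > a}) \<le> 4 * (prob g * (exp (- s) / a\<^sup>2))"
    by (intro mult_left_mono) auto
  with levy_inequality[OF st g, of a] show ?thesis by simp
qed

text \<open>
  The oscillation after time \<open>n\<close> exceeds \<open>e\<close> with probability of order \<open>exp (-n)\<close>, so almost surely it fails to do so for
  some \<open>n\<close>.
\<close>

lemma AE_oscillations_vanish:
  assumes e: "e > 0"
  shows "AE \<omega> in M. \<exists>n\<ge>1::nat. \<forall>r\<ge>real n. \<bar>V r \<omega> - V (real n) \<omega>\<bar> \<le> e"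
proof -
  define B where "B n = (\<Union>m. oscillates (real (Suc n)) (real (Suc n) + real (Suc m)) e)" for n
  have osc: "oscillates (real (Suc n)) (real (Suc n) + real (Suc m)) e \<in> sets M" for n m
    by (rule oscillates_measurable) auto
  have BM[measurable]: "B n \<in> sets M" for n unfolding B_def using osc by blast
  have bound: "prob (B n) \<le> 4 * exp (- real (Suc n)) / e\<^sup>2" for n
  proof -
    have "(\<lambda>m. prob (oscillates (real (Suc n)) (real (Suc n) + real (Suc m)) e)) \<longlonglongrightarrow> prob (B n)"
      unfolding B_def
    proof (rule finite_Lim_measure_incseq)
      show "range (\<lambda>m. oscillates (real (Suc n)) (real (Suc n) + real (Suc m)) e) \<subseteq> events" using osc by blast
      show "incseq (\<lambda>m. oscillates (real (Suc n)) (real (Suc n) + real (Suc m)) e)"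
        unfolding incseq_def oscillates_def by fastforce
    qed
    moreover have "prob (oscillates (real (Suc n)) (real (Suc n) + real (Suc m)) e) \<le> 4 * exp (- real (Suc n)) / e\<^sup>2" for m
    proof -
      have sp: "space M \<in> sets (F (real (Suc n)))" using sets.top[of "F (real (Suc n))"] by (simp add: space_F)
      have "space M \<inter> oscillates (real (Suc n)) (real (Suc n) + real (Suc m)) e = oscillates (real (Suc n)) (real (Suc n) + real (Suc m)) e"
        by (auto simp: oscillates_def)
      then show ?thesis
        using oscillation_bound[OF _ _ sp e, of "real (Suc n) + real (Suc m)"] by (simp add: prob_space)
    qed
    ultimately show ?thesis by (intro LIMSEQ_le_const2) auto
  qed
  have "prob (\<Inter>n. B n) \<le> 0"
  proof (rule LIMSEQ_le_const)
    have "(\<lambda>n. 4 * exp (- real (Suc n)) / e\<^sup>2) \<longlonglongrightarrow> 4 * 0 / e\<^sup>2"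
    proof (intro tendsto_divide tendsto_mult tendsto_const)
      have "filterlim (\<lambda>n. real (Suc n)) at_top sequentially"
        by (rule filterlim_compose[OF filterlim_real_sequentially filterlim_Suc])
      then show "(\<lambda>n. exp (- real (Suc n))) \<longlonglongrightarrow> 0"
        by (intro filterlim_compose[OF exp_at_bot] filterlim_compose[OF filterlim_uminus_at_bot_at_top])
      show "e\<^sup>2 \<noteq> 0" using e by simp
    qed
    then show "(\<lambda>n. 4 * exp (- real (Suc n)) / e\<^sup>2) \<longlonglongrightarrow> 0" by simp
    have "prob (\<Inter>n. B n) \<le> prob (B n)" for n by (intro finite_measure_mono) auto
    then show "\<exists>N. \<forall>n\<ge>N. prob (\<Inter>n. B n) \<le> 4 * exp (- real (Suc n)) / e\<^sup>2" using bound order_trans by blast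
  qed
  then have "prob (\<Inter>n. B n) = 0" using measure_nonneg[of M "\<Inter>n. B n"] by linarith
  then have "(\<Inter>n. B n) \<in> null_sets M" by (auto simp: null_sets_def emeasure_eq_measure)
  then have "AE \<omega> in M. \<omega> \<notin> (\<Inter>n. B n)" by (rule AE_not_in)
  then show ?thesis
    using AE_space
  proof eventually_elim
    case (elim \<omega>)
    then obtain n where n: "\<omega> \<notin> B n" by auto
    have "\<bar>V r \<omega> - V (real (Suc n)) \<omega>\<bar> \<le> e" if r: "r \<ge> real (Suc n)" for r
    proof (rule ccontr)
      assume neg: "\<not> ?thesis"
      obtain m :: nat where "r - real (Suc n) \<le> real m" using real_arch_simple by blast
      then have "\<omega> \<in> oscillates (real (Suc n)) (real (Suc n) + real (Suc m)) e"
        unfolding oscillates_def using neg r elim(2) by (auto intro!: bexI[of _ r])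
      then show False using n unfolding B_def by blast
    qed
    then show ?case by (intro exI[of _ "Suc n"]) simp
  qed
qed

definition V_inf :: "'a \<Rightarrow> real" where
  "V_inf \<omega> = lim (\<lambda>n. V (real (Suc n)) \<omega>)"

lemma V_inf_measurable[measurable]: "V_inf \<in> borel_measurable M"
  unfolding V_inf_def[abs_def] by (rule borel_measurable_lim_metric) (rule V_measurable, simp)

lemma AE_V_converges: "AE \<omega> in M. ((\<lambda>t. V t \<omega>) \<longlongrightarrow> V_inf \<omega>) at_top"
proof -
  have "AE \<omega> in M. \<forall>j::nat. \<exists>n\<ge>1::nat. \<forall>r\<ge>real n. \<bar>V r \<omega> - V (real n) \<omega>\<bar> \<le> 1 / real (Suc j)"
    unfolding AE_all_countable by (intro allI AE_oscillations_vanish) simp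
  then show ?thesis
  proof eventually_elim
    case (elim \<omega>)
    have osc: "\<exists>n\<ge>1::nat. \<forall>r\<ge>real n. \<bar>V r \<omega> - V (real n) \<omega>\<bar> < e" if e: "e > 0" for e
    proof -
      obtain j :: nat where "1 / real (Suc j) < e" using nat_approx_posE[OF e] by metis
      then show ?thesis using elim by (meson order_le_less_trans)
    qed
    have "Cauchy (\<lambda>n. V (real (Suc n)) \<omega>)"
    proof (rule metric_CauchyI)
      fix e :: real assume "0 < e"
      then obtain n :: nat where n: "\<forall>r\<ge>real n. \<bar>V r \<omega> - V (real n) \<omega>\<bar> < e / 2" using osc[of "e / 2"] by auto
      have "dist (V (real (Suc m)) \<omega>) (V (real (Suc m')) \<omega>) < e" if "m \<ge> n" "m' \<ge> n" for m m'
      proof -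
        have "\<bar>V (real (Suc m)) \<omega> - V (real n) \<omega>\<bar> < e / 2" "\<bar>V (real (Suc m')) \<omega> - V (real n) \<omega>\<bar> < e / 2"
          using that by (intro n[rule_format]; simp)+
        then show ?thesis unfolding dist_real_def by linarith
      qed
      then show "\<exists>M. \<forall>m\<ge>M. \<forall>n\<ge>M. dist (V (real (Suc m)) \<omega>) (V (real (Suc n)) \<omega>) < e" by blast
    qed
    then have lim: "(\<lambda>n. V (real (Suc n)) \<omega>) \<longlonglongrightarrow> V_inf \<omega>"
      unfolding V_inf_def by (simp add: Cauchy_convergent_iff convergent_LIMSEQ_iff)
    show ?case
    proof (rule tendstoI)
      fix e :: real assume "0 < e"
      then obtain n :: nat where n: "\<forall>r\<ge>real n. \<bar>V r \<omega> - V (real n) \<omega>\<bar> < e / 2" using osc[of "e / 2"] by auto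
      have "(\<lambda>m. \<bar>V (real (Suc m)) \<omega> - V (real n) \<omega>\<bar>) \<longlonglongrightarrow> \<bar>V_inf \<omega> - V (real n) \<omega>\<bar>"
        by (intro tendsto_intros lim)
      then have le: "\<bar>V_inf \<omega> - V (real n) \<omega>\<bar> \<le> e / 2"
        by (rule LIMSEQ_le_const2) (use n in \<open>auto intro!: exI[of _ n] less_imp_le\<close>)
      have "dist (V t \<omega>) (V_inf \<omega>) < e" if "t \<ge> real n" for t
        using n[rule_format, OF that] le unfolding dist_real_def by linarith
      then show "\<forall>\<^sub>F t in at_top. dist (V t \<omega>) (V_inf \<omega>) < e"
        unfolding eventually_at_top_linorder by blast
    qed
  qed
qed

lemma remainder_gauss_indep:
  assumes t: "1 \<le> t"
  shows "gauss_indep (F t) (\<lambda>\<omega>. V_inf \<omega> - V t \<omega>) (exp (- t))"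
proof (rule gauss_indep_AE_limit[where Z="\<lambda>n \<omega>. V (t + real n) \<omega> - V t \<omega>" and v="\<lambda>n. exp (- t) - exp (- (t + real n))"])
  show "subalgebra M (F t)" by (rule sub[OF t])
  show "gauss_indep (F t) (\<lambda>\<omega>. V (t + real n) \<omega> - V t \<omega>) (exp (- t) - exp (- (t + real n)))" for n
    by (rule V_gauss) (use t in auto)
  show "(\<lambda>\<omega>. V_inf \<omega> - V t \<omega>) \<in> borel_measurable M"
    using V_measurable[OF t] by measurable
  have ft: "filterlim (\<lambda>n. t + real n) at_top sequentially"
    by (rule filterlim_tendsto_add_at_top[OF tendsto_const filterlim_real_sequentially])
  show "AE \<omega> in M. (\<lambda>n. V (t + real n) \<omega> - V t \<omega>) \<longlonglongrightarrow> V_inf \<omega> - V t \<omega>"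
    using AE_V_converges
  proof eventually_elim
    case (elim \<omega>)
    show ?case by (intro tendsto_diff tendsto_const filterlim_compose[OF elim ft])
  qed
  have "(\<lambda>n. exp (- (t + real n))) \<longlonglongrightarrow> 0"
    by (intro filterlim_compose[OF exp_at_bot] filterlim_compose[OF filterlim_uminus_at_bot_at_top] ft)
  from tendsto_diff[OF tendsto_const[of "exp (- t)"] this]
  show "(\<lambda>n. exp (- t) - exp (- (t + real n))) \<longlonglongrightarrow> exp (- t)" by simp
qed

lemma remainder_law:
  assumes t: "1 \<le> t" and g: "g \<in> sets (F t)" and S: "S \<in> sets borel"
  shows "prob (g \<inter> {\<omega>\<in>space M. V_inf \<omega> - V t \<omega> \<in> S}) = prob g * std_gauss {x. exp (- t / 2) * x \<in> S}"
proof -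
  have "sqrt (exp (- t)) = exp (- t / 2)"
    by (rule real_sqrt_unique) (auto simp: power2_eq_square mult_exp_exp)
  then show ?thesis using gauss_indep_law[OF sub[OF t] remainder_gauss_indep[OF t] _ g S] by simp
qed

end

section \<open>Deterministic behaviour of the paths\<close>

text \<open>
  The integrated equation along a single path \<open>x\<close> with noise \<open>v\<close>.
\<close>

locale driven_path =
  fixes k :: real and x v :: "real \<Rightarrow> real"
  assumes k_pos: "0 < k"
    and x_continuous: "continuous_on {1..} x"
    and x_eq: "1 \<le> t \<Longrightarrow> x t = x 1 + k * integral {1..t} (\<lambda>s. \<bar>x s\<bar>) + v t"
begin

lemma abs_x_integrable: "1 \<le> s \<Longrightarrow> (\<lambda>u. \<bar>x u\<bar>) integrable_on {s..t}"
  by (intro integrable_continuous_interval continuous_intros continuous_on_subset[OF x_continuous]) auto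

lemma drift_increment:
  assumes "1 \<le> s" "s \<le> t"
  shows "(x t - v t) - (x s - v s) = k * integral {s..t} (\<lambda>u. \<bar>x u\<bar>)"
proof -
  have "integral {1..s} (\<lambda>u. \<bar>x u\<bar>) + integral {s..t} (\<lambda>u. \<bar>x u\<bar>) = integral {1..t} (\<lambda>u. \<bar>x u\<bar>)"
    by (rule Henstock_Kurzweil_Integration.integral_combine) (use assms abs_x_integrable[of 1 t] in auto)
  then have "k * integral {1..t} (\<lambda>u. \<bar>x u\<bar>) = k * integral {1..s} (\<lambda>u. \<bar>x u\<bar>) + k * integral {s..t} (\<lambda>u. \<bar>x u\<bar>)"
    by (metis distrib_left)
  then show ?thesis using x_eq[of s] x_eq[of t] assms by linarith
qed

lemma drift_mono: "1 \<le> s \<Longrightarrow> s \<le> t \<Longrightarrow> x s - v s \<le> x t - v t"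
  using drift_increment[of s t] k_pos integral_nonneg[OF abs_x_integrable, of s t]
  by (smt (verit) mult_nonneg_nonneg abs_ge_zero)

lemma drift_increment_ge:
  assumes "1 \<le> s" "s \<le> t" and c: "\<And>u. s \<le> u \<Longrightarrow> c \<le> \<bar>x u\<bar>"
  shows "k * c * (t - s) \<le> (x t - v t) - (x s - v s)"
proof -
  have "integral {s..t} (\<lambda>u. c) \<le> integral {s..t} (\<lambda>u. \<bar>x u\<bar>)"
    by (rule integral_le) (use abs_x_integrable assms in auto)
  then have "k * (c * (t - s)) \<le> k * integral {s..t} (\<lambda>u. \<bar>x u\<bar>)"
    using assms(2) k_pos by (intro mult_left_mono) (auto simp: mult.commute)
  then show ?thesis using drift_increment[OF assms(1,2)] by (simp add: mult.assoc)
qed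

text \<open>
  Here \<open>x - v\<close> is nondecreasing and \<open>v\<close> converges, so \<open>x\<close> converges or diverges to infinity.  At a nonzero finite limit the
  slope of \<open>x - v\<close> would stay bounded away from \<open>0\<close>.
\<close>

lemma limit_zero_or_infinity:
  assumes v: "(v \<longlongrightarrow> l) at_top"
  shows "(x \<longlongrightarrow> 0) at_top \<or> filterlim x at_top at_top"
proof (cases "\<exists>C. \<forall>t\<ge>1. x t - v t \<le> C")
  case False
  have "filterlim (\<lambda>t. x t - v t) at_top at_top"
    unfolding filterlim_at_top
  proof
    fix C
    obtain t0 where t0: "t0 \<ge> 1" "x t0 - v t0 > C" using False by (meson not_le)
    have "x t - v t \<ge> C" if "t \<ge> t0" for t using drift_mono[of t0 t] t0 that by linarith
    then show "\<forall>\<^sub>F t in at_top. C \<le> x t - v t" unfolding eventually_at_top_linorder by blast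
  qed
  from filterlim_tendsto_add_at_top[OF v this] show ?thesis by simp
next
  case True
  then obtain C where C: "\<And>t. t \<ge> 1 \<Longrightarrow> x t - v t \<le> C" by blast
  define Y where "Y = (SUP t\<in>{1..}. x t - v t)"
  have bdd: "bdd_above ((\<lambda>t. x t - v t) ` {1..})" using C by (intro bdd_aboveI2) auto
  have "((\<lambda>t. x t - v t) \<longlongrightarrow> Y) at_top"
  proof (rule order_tendstoI)
    fix a assume "a < Y"
    then obtain t0 where "t0 \<in> {1..}" "a < x t0 - v t0"
      unfolding Y_def using bdd by (subst (asm) less_cSUP_iff) auto
    then have "\<forall>t\<ge>t0. a < x t - v t" using drift_mono[of t0] by (auto intro: less_le_trans)
    then show "\<forall>\<^sub>F t in at_top. a < x t - v t" unfolding eventually_at_top_linorder by blast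
  next
    fix a assume a: "Y < a"
    have "x t - v t < a" if "t \<ge> 1" for t
      using cSUP_upper[OF _ bdd, of t] that a unfolding Y_def by auto
    then show "\<forall>\<^sub>F t in at_top. x t - v t < a" unfolding eventually_at_top_linorder by blast
  qed
  from tendsto_add[OF this v] have lim: "(x \<longlongrightarrow> Y + l) at_top" by simp
  have "Y + l = 0"
  proof (rule ccontr)
    assume "Y + l \<noteq> 0"
    then have c: "\<bar>Y + l\<bar> / 2 < \<bar>Y + l\<bar>" "\<bar>Y + l\<bar> > 0" by auto
    have "\<forall>\<^sub>F t in at_top. \<bar>Y + l\<bar> / 2 < \<bar>x t\<bar>"
      by (rule order_tendstoD(1)[OF tendsto_rabs[OF lim] c(1)])
    then obtain t0 where t0: "\<And>t. t \<ge> t0 \<Longrightarrow> \<bar>Y + l\<bar> / 2 < \<bar>x t\<bar>" unfolding eventually_at_top_linorder by blast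
    define s where "s = max 1 t0"
    define d where "d = k * (\<bar>Y + l\<bar> / 2)"
    have d: "d > 0" using k_pos c unfolding d_def by simp
    \<comment> \<open>by this time the minimal slope d has raised x - v above its bound C\<close>
    define t where "t = s + (C - (x s - v s) + 1) / d"
    have s1: "1 \<le> s" by (simp add: s_def)
    have st: "s \<le> t" using C[OF s1] d unfolding t_def by (simp add: field_simps)
    have "d * (t - s) \<le> (x t - v t) - (x s - v s)"
      unfolding d_def by (rule drift_increment_ge[OF s1 st]) (use t0 in \<open>auto simp: s_def intro: less_imp_le\<close>)
    moreover have "d * (t - s) = C - (x s - v s) + 1" using d unfolding t_def by simp
    ultimately show False using C[of t] s1 st by linarith
  qed
  with lim show ?thesis by simp
qed

text \<open>
  The limit \<open>-l\<close> of the nondecreasing function \<open>x - v\<close> dominates all its values.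
\<close>

lemma remainder_nonpos_if_limit_zero:
  assumes v: "(v \<longlongrightarrow> l) at_top" and x: "(x \<longlongrightarrow> 0) at_top" and t: "1 \<le> t"
  shows "x t + (l - v t) \<le> 0"
proof -
  have "((\<lambda>u. x u - v u) \<longlongrightarrow> 0 - l) at_top" by (intro tendsto_diff x v)
  moreover have "\<forall>\<^sub>F u in at_top. x t - v t \<le> x u - v u"
    unfolding eventually_at_top_linorder using drift_mono[OF t] by blast
  ultimately have "x t - v t \<le> 0 - l" by (rule tendsto_lowerbound) simp
  then show ?thesis by simp
qed

text \<open>
  If \<open>m\<close> is the maximum of \<open>\<bar>x\<bar>\<close> over the step, then \<open>m \<le> \<bar>x a\<bar> + s + k h m\<close>.  Solving for \<open>m\<close> bounds
  the drift \<open>k h m\<close> without any knowledge of the sign of \<open>x\<close>.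
\<close>

lemma drift_over_step:
  assumes a: "1 \<le> a" and h: "0 \<le> h" "k * h < 1"
    and s: "\<And>t. t \<in> {a..a + h} \<Longrightarrow> \<bar>v t - v a\<bar> \<le> s"
  shows "x (a + h) \<le> x a + (v (a + h) - v a) + k * h / (1 - k * h) * (\<bar>x a\<bar> + s)"
proof -
  have "continuous_on {a..a + h} (\<lambda>t. \<bar>x t\<bar>)"
    by (intro continuous_intros continuous_on_subset[OF x_continuous]) (use a in auto)
  then obtain u where u: "u \<in> {a..a + h}" "\<And>t. t \<in> {a..a + h} \<Longrightarrow> \<bar>x t\<bar> \<le> \<bar>x u\<bar>"
    using continuous_attains_sup[of "{a..a + h}" "\<lambda>t. \<bar>x t\<bar>"] h by auto
  have bound: "k * integral {a..t} (\<lambda>r. \<bar>x r\<bar>) \<le> k * h * \<bar>x u\<bar>" if t: "t \<in> {a..a + h}" for t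
  proof -
    have "integral {a..t} (\<lambda>r. \<bar>x r\<bar>) \<le> integral {a..t} (\<lambda>r. \<bar>x u\<bar>)"
      by (rule integral_le) (use abs_x_integrable a u t in auto)
    also have "\<dots> = (t - a) * \<bar>x u\<bar>" using t by simp
    also have "\<dots> \<le> h * \<bar>x u\<bar>" using t by (intro mult_right_mono) auto
    finally show ?thesis using k_pos by (simp add: mult.assoc)
  qed
  have "x u = x a + (v u - v a) + k * integral {a..u} (\<lambda>r. \<bar>x r\<bar>)"
    using drift_increment[of a u] a u by auto
  moreover have "0 \<le> k * integral {a..u} (\<lambda>r. \<bar>x r\<bar>)"
    using k_pos a by (intro mult_nonneg_nonneg integral_nonneg abs_x_integrable) auto
  ultimately have "\<bar>x u\<bar> \<le> \<bar>x a\<bar> + s + k * h * \<bar>x u\<bar>"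
    using s[OF u(1)] bound[OF u(1)] by linarith
  then have "(1 - k * h) * \<bar>x u\<bar> \<le> \<bar>x a\<bar> + s" by (simp add: algebra_simps)
  then have "\<bar>x u\<bar> \<le> (\<bar>x a\<bar> + s) / (1 - k * h)" using h by (simp add: pos_le_divide_eq mult.commute)
  then have "k * h * \<bar>x u\<bar> \<le> k * h * ((\<bar>x a\<bar> + s) / (1 - k * h))"
    using k_pos h by (intro mult_left_mono) auto
  then have "k * integral {a..a + h} (\<lambda>r. \<bar>x r\<bar>) \<le> k * h / (1 - k * h) * (\<bar>x a\<bar> + s)"
    using bound[of "a + h"] h by simp
  then show ?thesis using drift_increment[of a "a + h"] a h by linarith
qed

text \<open>
  Over one step a negative value is multiplied by at most \<open>1 - \<kappa>\<close> and then perturbed by at most \<open>2 c r\<^sup>n\<close>.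
  Because \<open>r < 1 - \<kappa>\<close>, a geometric bound with ratio \<open>r\<close> reproduces itself; \<open>K\<close> is chosen to make the induction step exact.
\<close>

lemma stays_negative:
  assumes a: "1 \<le> a" and h: "0 \<le> h" "k * h < 1" and \<kappa>: "\<kappa> = k * h / (1 - k * h)" "\<kappa> \<le> 1"
    and r: "0 < r" "r < 1 - \<kappa>" and c: "0 < c" and K: "K * (1 - \<kappa> - r) = 2 * c"
    and start: "x a \<le> - K"
    and s: "\<And>n t. t \<in> {a + real n * h..a + real n * h + h} \<Longrightarrow> \<bar>v t - v (a + real n * h)\<bar> \<le> c * r ^ n"
  shows "x (a + real n * h) \<le> - K * r ^ n"
proof (induction n)
  case (Suc n)
  let ?b = "a + real n * h"
  have \<kappa>0: "0 \<le> \<kappa>" using h k_pos \<kappa> by simp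
  have "0 < K * (1 - \<kappa> - r)" using K c by simp
  then have K0: "0 < K" using r by (simp add: zero_less_mult_iff)
  have b: "1 \<le> ?b" using a h by (meson add_increasing2 mult_nonneg_nonneg of_nat_0_le_iff)
  have rn: "0 < r ^ n" using r by simp
  have "0 \<le> K * r ^ n" using K0 rn by simp
  then have neg: "\<bar>x ?b\<bar> = - x ?b" using Suc by linarith
  have "x (?b + h) \<le> x ?b + (v (?b + h) - v ?b) + \<kappa> * (\<bar>x ?b\<bar> + c * r ^ n)"
    unfolding \<kappa>(1) by (rule drift_over_step[OF b h s]) 
  also have "\<dots> \<le> x ?b + c * r ^ n + \<kappa> * (- x ?b + c * r ^ n)"
    using s[of "?b + h" n] h neg by auto
  also have "\<dots> = (1 - \<kappa>) * x ?b + c * r ^ n + \<kappa> * (c * r ^ n)" by (simp add: algebra_simps)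
  also have "\<dots> \<le> (1 - \<kappa>) * (- K * r ^ n) + c * r ^ n + 1 * (c * r ^ n)"
    using Suc \<kappa> c rn by (intro add_mono mult_left_mono mult_right_mono) auto
  also have "\<dots> = - (r ^ n) * (K * (1 - \<kappa>) - 2 * c)" by (simp add: algebra_simps)
  also have "K * (1 - \<kappa>) - 2 * c = K * r" using K by (simp add: algebra_simps)
  finally show ?case by (simp add: algebra_simps)
qed (use start in simp)

end

section \<open>Convergence to zero or divergence\<close>

locale driven_process = gaussian_noise M F V
  for M :: "'a measure" and F :: "real \<Rightarrow> 'a measure" and V :: "real \<Rightarrow> 'a \<Rightarrow> real" +
  fixes X :: "real \<Rightarrow> 'a \<Rightarrow> real" and k :: real
  assumes k: "0 < k" "k < 1 / 2"
    and X_adapted: "1 \<le> t \<Longrightarrow> X t \<in> borel_measurable (F t)"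
    and X_continuous: "\<omega> \<in> space M \<Longrightarrow> continuous_on {1..} (\<lambda>t. X t \<omega>)"
    and X_eq: "\<omega> \<in> space M \<Longrightarrow> 1 \<le> t \<Longrightarrow> X t \<omega> = X 1 \<omega> + k * integral {1..t} (\<lambda>s. \<bar>X s \<omega>\<bar>) + V t \<omega>"
begin

lemma path: "\<omega> \<in> space M \<Longrightarrow> driven_path k (\<lambda>t. X t \<omega>) (\<lambda>t. V t \<omega>)"
  by (rule driven_path.intro[OF k(1) X_continuous X_eq])

definition "to_zero = {\<omega> \<in> space M. ((\<lambda>t. X t \<omega>) \<longlongrightarrow> 0) at_top}"

definition "to_infinity = {\<omega> \<in> space M. filterlim (\<lambda>t. X t \<omega>) at_top at_top}"

lemma X_measurable: "1 \<le> t \<Longrightarrow> X t \<in> borel_measurable M"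
  using measurable_from_subalg[OF sub X_adapted] .

lemma AE_zero_or_infinity: "AE \<omega> in M. \<omega> \<in> to_zero \<or> \<omega> \<in> to_infinity"
  using AE_V_converges AE_space
  by eventually_elim
    (auto simp: to_zero_def to_infinity_def dest: driven_path.limit_zero_or_infinity[OF path])

lemma AE_remainder_nonpos:
  "AE \<omega> in M. \<omega> \<in> to_zero \<longrightarrow> (\<forall>t\<ge>1. X t \<omega> + (V_inf \<omega> - V t \<omega>) \<le> 0)"
  using AE_V_converges AE_space
proof eventually_elim
  case (elim \<omega>)
  then show ?case
    using driven_path.remainder_nonpos_if_limit_zero[OF path[OF elim(2)] elim(1)] unfolding to_zero_def by blast
qed

text \<open>
  The sigma-algebra \<open>N\<close> is kept general because these events are needed both in \<open>M\<close> and in the sigma-algebra generated by the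
  filtration.
\<close>

lemma limit_events_measurable:
  assumes sp: "space N = space M" and m: "\<And>t. 1 \<le> t \<Longrightarrow> X t \<in> borel_measurable N"
  shows "to_zero \<in> sets N" "to_infinity \<in> sets N"
    and "{\<omega>\<in>space M. \<forall>n::nat. \<exists>q\<in>\<rat> \<inter> {real (Suc n)..}. X q \<omega> > - exp (- q / 2)} \<in> sets N"
proof -
  have Xm: "X q \<in> borel_measurable N" if "q \<in> \<rat> \<inter> {real (Suc n)..}" for q n by (rule m) (use that in auto)
  have cnt: "countable (\<rat> \<inter> {real (Suc n)..})" for n by (intro countable_Int1 countable_rat)
  have "{\<omega>\<in>space N. \<bar>X q \<omega>\<bar> \<le> 1 / real (Suc j)} \<in> sets N" "{\<omega>\<in>space N. real j \<le> X q \<omega>} \<in> sets N"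
    "{\<omega>\<in>space N. X q \<omega> > - exp (- q / 2)} \<in> sets N"
    if "q \<in> \<rat> \<inter> {real (Suc n)..}" for q n and j :: nat
    using Xm[OF that] by measurable
  note * = this
  have "to_zero = {\<omega>\<in>space N. \<forall>j::nat. \<exists>n::nat. \<forall>q\<in>\<rat> \<inter> {real (Suc n)..}. \<bar>X q \<omega>\<bar> \<le> 1 / real (Suc j)}"
    unfolding to_zero_def sp using continuous_tendsto_0_rational_iff[OF X_continuous] by blast
  also have "\<dots> \<in> sets N"
    by (rule sets.sets_Collect_countable_All, rule sets.sets_Collect_countable_Ex, rule sets.sets_Collect_countable_All'[OF *(1) cnt])
  finally show "to_zero \<in> sets N" .
  have "to_infinity = {\<omega>\<in>space N. \<forall>j::nat. \<exists>n::nat. \<forall>q\<in>\<rat> \<inter> {real (Suc n)..}. real j \<le> X q \<omega>}"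
    unfolding to_infinity_def sp using continuous_at_top_rational_iff[OF X_continuous] by blast
  also have "\<dots> \<in> sets N"
    by (rule sets.sets_Collect_countable_All, rule sets.sets_Collect_countable_Ex, rule sets.sets_Collect_countable_All'[OF *(2) cnt])
  finally show "to_infinity \<in> sets N" .
  show "{\<omega>\<in>space M. \<forall>n::nat. \<exists>q\<in>\<rat> \<inter> {real (Suc n)..}. X q \<omega> > - exp (- q / 2)} \<in> sets N"
    unfolding sp[symmetric]
    by (rule sets.sets_Collect_countable_All, rule sets.sets_Collect_countable_Ex'[OF *(3) cnt])
qed

lemma to_zero_measurable[measurable]: "to_zero \<in> sets M"
  and to_infinity_measurable[measurable]: "to_infinity \<in> sets M"
  using limit_events_measurable[OF refl X_measurable] by auto

text \<open>
  The path is not far below \<open>0\<close> on the scale \<open>exp (-t/2)\<close> of the remaining noise, at arbitrarily late times.  The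
  margin \<open>exp (-q/2)\<close> makes the condition open, so that a zero of \<open>X\<close> at an irrational time is detected at rational times.
\<close>

definition "late_returns = {\<omega>\<in>space M. \<forall>n::nat. \<exists>q\<in>\<rat> \<inter> {real (Suc n)..}. X q \<omega> > - exp (- q / 2)}"

text \<open>
  Given the past at a time of the kind described in \<open>late_returns\<close>, convergence to \<open>0\<close> requires the remaining noise
  to be below its standard deviation, an event of conditional probability \<open>\<Phi>(1) < 1\<close>.  An event that belongs to the
  limit of the filtration, and on which arbitrarily late conditional probabilities of it are at most \<open>\<Phi>(1)\<close>, is null.
\<close>

lemma zero_late_returns_null: "prob (to_zero \<inter> late_returns) = 0"
proof -
  let ?D = "to_zero \<inter> late_returns" and ?q = "std_gauss {..<1}"
  \<comment> \<open>up to a null set this is to_zero itself; the added condition links it to the remaining noise at every rational time\<close>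
  define G where "G = to_zero \<inter> {\<omega>\<in>space M. \<forall>q\<in>\<rat> \<inter> {1..}. X q \<omega> + (V_inf \<omega> - V q \<omega>) \<le> 0}"
  interpret N: real_distribution std_normal_distribution by (rule real_dist_normal_dist)
  have q1: "?q < 1"
  proof -
    have "?q + std_gauss {1<..<2} = std_gauss ({..<1} \<union> {1<..<2})" by (rule N.finite_measure_Union[symmetric]) auto
    then show ?thesis using N.prob_le_1[of "{..<1} \<union> {1<..<2}"] std_normal_interval_positive[of 1 2] by linarith
  qed
  have GM[measurable]: "G \<in> sets M"
    unfolding G_def
  proof (intro sets.Int to_zero_measurable sets.sets_Collect_countable_All')
    show "countable (\<rat> \<inter> {1::real..})" by (intro countable_Int1 countable_rat)
    fix q :: real assume "q \<in> \<rat> \<inter> {1..}"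
    then have [measurable]: "X q \<in> borel_measurable M" "V q \<in> borel_measurable M" using X_measurable V_measurable by auto
    show "{\<omega>\<in>space M. X q \<omega> + (V_inf \<omega> - V q \<omega>) \<le> 0} \<in> sets M" by measurable
  qed
  have DM[measurable]: "?D \<in> sets M"
    using limit_events_measurable(3)[OF refl X_measurable] unfolding late_returns_def by auto
  \<comment> \<open>the event depends on the values of X at countably many times only, so it belongs to the limit of the filtration\<close>
  let ?F = "\<lambda>n::nat. F (real (Suc n))"
  let ?N = "sigma (space M) (\<Union>n. sets (?F n))"
  have subF: "(\<Union>n. sets (?F n)) \<subseteq> Pow (space M)"
    using sets.sets_into_space[of _ "?F _"] by (fastforce simp: space_F)
  have XN: "X t \<in> borel_measurable ?N" if t: "1 \<le> t" for t
  proof -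
    obtain n :: nat where "t \<le> real n" using real_arch_simple by blast
    then have "t \<le> real (Suc n)" by simp
    from adapted_mono[OF X_adapted[OF t] this] have "X t \<in> borel_measurable (?F n)" .
    moreover have "sets (?F n) \<subseteq> sets ?N" using subF by (auto simp: sets_measure_of)
    ultimately show ?thesis
      using measurable_mono[of borel borel "?F n" ?N] by (auto simp: space_F space_measure_of_conv)
  qed
  have "?D \<in> sets ?N"
    using limit_events_measurable[OF _ XN] unfolding late_returns_def by (auto simp: space_measure_of_conv)
  then have Dsig: "?D \<in> sigma_sets (space M) (\<Union>n. sets (?F n))" using subF by (simp add: sets_measure_of)
  have key: "prob ?D * (1 - ?q) \<le> 2 * e" if e: "e > 0" for e
  proof -
    obtain n D' where D': "D' \<in> sets (?F n)" "prob (sym_diff ?D D') < e"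
      using filtration_approximation[of ?F, OF _ _ Dsig _ e] sets_F_mono sub
      by (auto simp: subalgebra_def space_F)
    have D'M[measurable]: "D' \<in> sets M" using D'(1) sets_F[of "real (Suc n)"] by simp
    let ?T = "\<rat> \<inter> {real (Suc n)..}"
    let ?E = "\<lambda>t. D' \<inter> {\<omega>\<in>space M. X t \<omega> > - exp (- t / 2)}"
    have t1: "1 \<le> t" "real (Suc n) \<le> t" if "t \<in> ?T" for t using that by auto
    have cnt: "countable ?T" by (intro countable_Int1 countable_rat)
    have E: "?E t \<in> sets (F t)" if t: "t \<in> ?T" for t
    proof -
      have [measurable]: "X t \<in> borel_measurable (F t)" by (rule X_adapted[OF t1(1)[OF t]])
      have "{\<omega>\<in>space (F t). X t \<omega> > - exp (- t / 2)} \<in> sets (F t)" by measurable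
      moreover have "D' \<in> sets (F t)" using D'(1) sets_F_mono[OF t1(2)[OF t]] by blast
      ultimately show ?thesis by (auto simp: space_F)
    qed
    have EM: "(\<Union>t\<in>?T. ?E t) \<in> sets M"
      by (rule sets.countable_UN'[OF cnt]) (use E sets_F t1 in blast)
    have "prob ((\<Union>t\<in>?T. ?E t) \<inter> G) \<le> ?q * prob (\<Union>t\<in>?T. ?E t)"
    proof (rule first_passage[where F=F, OF cnt])
      fix t A assume t: "t \<in> ?T" and A: "A \<in> sets (F t)" "A \<subseteq> ?E t"
      have [measurable]: "V t \<in> borel_measurable M" "A \<in> sets M"
        using V_measurable[OF t1(1)[OF t]] sets_F[OF t1(1)[OF t] A(1)] by auto
      have "prob (A \<inter> G) \<le> prob (A \<inter> {\<omega>\<in>space M. V_inf \<omega> - V t \<omega> \<in> {..<exp (- t / 2)}})"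
      proof (rule finite_measure_mono)
        show "A \<inter> G \<subseteq> A \<inter> {\<omega>\<in>space M. V_inf \<omega> - V t \<omega> \<in> {..<exp (- t / 2)}}"
          using A(2) t t1(1)[OF t] unfolding G_def by force
      qed measurable
      also have "\<dots> = prob A * std_gauss {x. exp (- t / 2) * x \<in> {..<exp (- t / 2)}}"
        by (rule remainder_law[OF t1(1)[OF t] A(1)]) simp
      also have "{x. exp (- t / 2) * x \<in> {..<exp (- t / 2)}} = {..<1}" by auto
      finally show "prob (A \<inter> G) \<le> ?q * prob A" by (simp add: mult.commute)
    next
      fix s t :: real assume "s \<le> t" then show "sets (F s) \<subseteq> sets (F t)" by (rule sets_F_mono)
    next
      fix t assume "t \<in> ?T" then show "sets (F t) \<subseteq> sets M" using sets_F t1 by blast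
    qed (use E GM in auto)
    also have "\<dots> \<le> ?q * prob D'"
      by (intro mult_left_mono finite_measure_mono) auto
    also have "\<dots> \<le> ?q * (prob ?D + e)"
    proof (rule mult_left_mono)
      have "prob D' \<le> prob (?D \<union> sym_diff ?D D')" by (intro finite_measure_mono) auto
      also have "\<dots> \<le> prob ?D + prob (sym_diff ?D D')" by (intro measure_Un_le) auto
      finally show "prob D' \<le> prob ?D + e" using D'(2) by linarith
    qed simp
    finally have up: "prob ((\<Union>t\<in>?T. ?E t) \<inter> G) \<le> ?q * (prob ?D + e)" .
    have "prob ?D \<le> prob (((\<Union>t\<in>?T. ?E t) \<inter> G) \<union> sym_diff ?D D')"
    proof (rule finite_measure_mono_AE)
      show "AE \<omega> in M. \<omega> \<in> ?D \<longrightarrow> \<omega> \<in> ((\<Union>t\<in>?T. ?E t) \<inter> G) \<union> sym_diff ?D D'"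
        using AE_remainder_nonpos
      proof eventually_elim
        case (elim \<omega>)
        show ?case
        proof
          assume \<omega>: "\<omega> \<in> ?D"
          then have sp: "\<omega> \<in> space M" and zero: "\<omega> \<in> to_zero" by (auto simp: late_returns_def)
          have G: "\<omega> \<in> G" using elim zero sp unfolding G_def by auto
          obtain t where t: "t \<in> ?T" "X t \<omega> > - exp (- t / 2)" using \<omega> unfolding late_returns_def by blast
          show "\<omega> \<in> ((\<Union>t\<in>?T. ?E t) \<inter> G) \<union> sym_diff ?D D'"
          proof (cases "\<omega> \<in> D'")
            case True
            then have "\<omega> \<in> (\<Union>t\<in>?T. ?E t)" using t sp by blast
            then show ?thesis using G by blast
          qed (use \<omega> in blast)
        qed
      qed
      show "((\<Union>t\<in>?T. ?E t) \<inter> G) \<union> sym_diff ?D D' \<in> sets M" using EM by auto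
    qed
    also have "\<dots> \<le> prob ((\<Union>t\<in>?T. ?E t) \<inter> G) + prob (sym_diff ?D D')"
      using EM by (intro measure_Un_le) auto
    finally have "prob ?D \<le> ?q * (prob ?D + e) + e" using up D'(2) by linarith
    moreover have "?q * e \<le> 1 * e" using q1 e by (intro mult_right_mono) auto
    ultimately show ?thesis by (simp add: algebra_simps)
  qed
  have "prob ?D * (1 - ?q) \<le> 0"
    by (rule field_le_epsilon) (use key[of "_ / 2"] in auto)
  then have "prob ?D \<le> 0" using q1 by (simp add: mult_le_0_iff)
  then show ?thesis using measure_nonneg[of M ?D] by linarith
qed

text \<open>
  A time with \<open>X \<ge> 0\<close> lies strictly inside the margin that defines \<open>late_returns\<close>.
\<close>

lemma AE_infinity_if_nonneg_infinitely_often: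
  "AE \<omega> in M. (\<exists>\<^sub>F t in at_top. X t \<omega> \<ge> 0) \<longrightarrow> filterlim (\<lambda>t. X t \<omega>) at_top at_top"
proof -
  have "to_zero \<inter> late_returns \<in> sets M"
    using limit_events_measurable(3)[OF refl X_measurable] unfolding late_returns_def by auto
  then have "to_zero \<inter> late_returns \<in> null_sets M"
    using zero_late_returns_null by (auto simp: null_sets_def emeasure_eq_measure)
  then have "AE \<omega> in M. \<omega> \<notin> to_zero \<inter> late_returns" by (rule AE_not_in)
  then show ?thesis
    using AE_zero_or_infinity AE_space
  proof eventually_elim
    case (elim \<omega>)
    show ?case
    proof
      assume freq: "\<exists>\<^sub>F t in at_top. X t \<omega> \<ge> 0"
      have "\<omega> \<in> late_returns"
        unfolding late_returns_def
      proof (intro CollectI conjI allI elim(3))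
        fix n :: nat
        obtain t where t: "t \<ge> real (Suc n)" "X t \<omega> \<ge> 0"
          using freq[unfolded frequently_def eventually_at_top_linorder] by fastforce
        have "X t \<omega> + exp (- t / 2) > 0" using t(2) by (intro add_nonneg_pos) auto
        moreover have "continuous_on {1..} (\<lambda>t. X t \<omega> + exp (- t / 2))"
          by (intro continuous_intros X_continuous[OF elim(3)]) auto
        ultimately obtain q where "q \<in> \<rat>" "real (Suc n) \<le> q" "X q \<omega> + exp (- q / 2) > 0"
          using rational_witness_at_top[of "\<lambda>t. X t \<omega> + exp (- t / 2)" "real (Suc n)" t] t(1) by auto
        then show "\<exists>q\<in>\<rat> \<inter> {real (Suc n)..}. X q \<omega> > - exp (- q / 2)" by (intro bexI[of _ q]) auto
      qed
      then show "filterlim (\<lambda>t. X t \<omega>) at_top at_top"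
        using elim(1,2) unfolding to_infinity_def by blast
    qed
  qed
qed

section \<open>Both outcomes have positive probability\<close>

lemma bounded_with_positive_probability:
  fixes f :: "'a \<Rightarrow> real"
  assumes f: "f \<in> borel_measurable M"
  obtains K where "K > 0" "prob {\<omega>\<in>space M. \<bar>f \<omega>\<bar> \<le> K} > 0"
proof -
  have "(\<lambda>n. prob {\<omega>\<in>space M. \<bar>f \<omega>\<bar> \<le> real (Suc n)}) \<longlonglongrightarrow> prob (\<Union>n. {\<omega>\<in>space M. \<bar>f \<omega>\<bar> \<le> real (Suc n)})"
  proof (rule finite_Lim_measure_incseq)
    show "range (\<lambda>n. {\<omega>\<in>space M. \<bar>f \<omega>\<bar> \<le> real (Suc n)}) \<subseteq> events"
      using f by (intro image_subsetI) measurable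
    show "incseq (\<lambda>n. {\<omega>\<in>space M. \<bar>f \<omega>\<bar> \<le> real (Suc n)})" unfolding incseq_def by auto
  qed
  also have "(\<Union>n. {\<omega>\<in>space M. \<bar>f \<omega>\<bar> \<le> real (Suc n)}) = space M"
  proof -
    have "\<exists>n. \<bar>f \<omega>\<bar> \<le> real (Suc n)" for \<omega>
      using real_arch_simple[of "\<bar>f \<omega>\<bar>"] by (metis le_Suc_eq of_nat_le_iff order_trans order_refl)
    then show ?thesis by auto
  qed
  finally have "\<forall>\<^sub>F n in sequentially. 0 < prob {\<omega>\<in>space M. \<bar>f \<omega>\<bar> \<le> real (Suc n)}"
    by (rule order_tendstoD(1)) (simp add: prob_space)
  then obtain n where "0 < prob {\<omega>\<in>space M. \<bar>f \<omega>\<bar> \<le> real (Suc n)}" unfolding eventually_sequentially by auto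
  then show thesis by (intro that[of "real (Suc n)"]) auto
qed

text \<open>
  If \<open>X 1 + (V_inf - V 1) > 0\<close>, the path cannot tend to \<open>0\<close>.  The two summands are independent and the second one is
  Gaussian, so it exceeds any level \<open>K\<close> with positive probability.
\<close>

lemma to_infinity_positive: "prob to_infinity > 0"
proof -
  obtain K where K: "K > 0" "prob {\<omega>\<in>space M. \<bar>X 1 \<omega>\<bar> \<le> K} > 0"
    by (rule bounded_with_positive_probability[OF X_measurable[of 1]]) auto
  let ?g = "{\<omega>\<in>space M. \<bar>X 1 \<omega>\<bar> \<le> K}" and ?H = "{\<omega>\<in>space M. V_inf \<omega> - V 1 \<omega> \<in> {K<..}}"
  have [measurable]: "X 1 \<in> borel_measurable (F 1)" using X_adapted by simp
  have "{\<omega>\<in>space (F 1). \<bar>X 1 \<omega>\<bar> \<le> K} \<in> sets (F 1)" by measurable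
  then have g: "?g \<in> sets (F 1)" by (simp add: space_F)
  have "prob (?g \<inter> ?H) = prob ?g * std_gauss {x. exp (- 1 / 2) * x \<in> {K<..}}"
    by (rule remainder_law[OF _ g]) auto
  also have "{x. exp (- 1 / 2) * x \<in> {K<..}} = {K / exp (- 1 / 2)<..}"
    by (auto simp: field_simps)
  finally have "prob (?g \<inter> ?H) > 0"
    using K(2) std_normal_ray_positive by simp
  moreover have "prob (?g \<inter> ?H) \<le> prob to_infinity"
  proof (rule finite_measure_mono_AE)
    show "AE \<omega> in M. \<omega> \<in> ?g \<inter> ?H \<longrightarrow> \<omega> \<in> to_infinity"
      using AE_zero_or_infinity AE_remainder_nonpos
    proof eventually_elim
      case (elim \<omega>)
      have "\<omega> \<notin> to_zero" if "\<omega> \<in> ?g \<inter> ?H"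
      proof
        assume "\<omega> \<in> to_zero"
        then have "X 1 \<omega> + (V_inf \<omega> - V 1 \<omega>) \<le> 0" using elim(2) by simp
        then show False using that by auto
      qed
      then show ?case using elim(1) by blast
    qed
  qed measurable
  ultimately show ?thesis by linarith
qed

text \<open>
  The noise is asked to fall below \<open>-N\<close> at the end of the step while staying within \<open>2 N\<close> throughout.  Then the drift over the step
  cannot compensate the fall.  By Levy's inequality the oscillation condition fails with probability at most
  \<open>4 P(Z > 2 a)\<close>, where \<open>a\<close> is \<open>N\<close> in units of the standard deviation, and \<open>std_normal_tail_drops\<close> provides arbitrarily
  large \<open>a\<close> for which this is less than \<open>P(Z > a)\<close>.
\<close>

lemma reaches_deep_level:
  assumes h: "0 < h" "k * h < 1" "k * h / (1 - k * h) \<le> 1 / 4" and K: "0 \<le> K"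
  shows "prob {\<omega>\<in>space M. X (1 + h) \<omega> \<le> - K} > 0"
proof -
  let ?\<sigma> = "sqrt (exp (- 1) - exp (- (1 + h)))"
  have \<sigma>: "?\<sigma> > 0" using h by simp
  obtain K0 where K0: "K0 > 0" "prob {\<omega>\<in>space M. \<bar>X 1 \<omega>\<bar> \<le> K0} > 0"
    by (rule bounded_with_positive_probability[OF X_measurable[of 1]]) auto
  let ?g = "{\<omega>\<in>space M. \<bar>X 1 \<omega>\<bar> \<le> K0}"
  have [measurable]: "X 1 \<in> borel_measurable (F 1)" using X_adapted by simp
  have "{\<omega>\<in>space (F 1). \<bar>X 1 \<omega>\<bar> \<le> K0} \<in> sets (F 1)" by measurable
  then have g: "?g \<in> sets (F 1)" by (simp add: space_F)
  obtain a where a: "a \<ge> (2 * K + 3 * K0) / ?\<sigma>" "std_gauss {a<..} > 4 * std_gauss {2 * a<..}"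
    using std_normal_tail_drops by blast
  define N where "N = ?\<sigma> * a"
  have N: "N \<ge> 2 * K + 3 * K0" using a(1) \<sigma> by (simp add: N_def field_simps)
  have ray: "{x. ?\<sigma> * x > ?\<sigma> * b} = {b<..}" for b using \<sigma> by auto
  let ?P = "{\<omega>\<in>space M. - 1 * (V (1 + h) \<omega> - V 1 \<omega>) \<in> {N<..}}"
  let ?O = "oscillates 1 (1 + h) (2 * N)"
  have "prob (?g \<inter> ?P) = prob ?g * std_gauss {x. ?\<sigma> * x \<in> {N<..}}"
    by (rule V_increment_law) (use h g in auto)
  then have pP: "prob (?g \<inter> ?P) = prob ?g * std_gauss {a<..}"
    unfolding greaterThan_iff N_def ray .
  have "prob (?g \<inter> ?O) \<le> 4 * (prob ?g * std_gauss {x. ?\<sigma> * x > 2 * N})"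
    by (rule levy_inequality) (use h g in auto)
  moreover have "{x. ?\<sigma> * x > 2 * N} = {2 * a<..}"
    using ray[of "2 * a"] by (simp add: N_def mult.left_commute)
  ultimately have pO: "prob (?g \<inter> ?O) \<le> prob ?g * (4 * std_gauss {2 * a<..})" by simp
  have [measurable]: "V 1 \<in> borel_measurable M" "V (1 + h) \<in> borel_measurable M" "?g \<in> sets M" "?O \<in> sets M"
      "X (1 + h) \<in> borel_measurable M"
    using V_measurable h sets_F[OF _ g] oscillates_measurable[of 1 "1 + h" "2 * N"] X_measurable by auto
  have PM: "?g \<inter> ?P \<in> sets M" "?g \<inter> ?O \<in> sets M" by measurable
  have "prob ?g * (4 * std_gauss {2 * a<..}) < prob ?g * std_gauss {a<..}"
    using a(2) K0(2) by (intro mult_strict_left_mono) auto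
  then have "prob (?g \<inter> ?O) < prob (?g \<inter> ?P)" using pP pO by linarith
  also have "prob (?g \<inter> ?P) \<le> prob ((?g \<inter> ?P - ?O) \<union> (?g \<inter> ?O))"
    by (rule finite_measure_mono) (use PM in auto)
  also have "\<dots> \<le> prob (?g \<inter> ?P - ?O) + prob (?g \<inter> ?O)"
    by (intro measure_Un_le) (use PM in auto)
  finally have "0 < prob (?g \<inter> ?P - ?O)" by simp
  also have "\<dots> \<le> prob {\<omega>\<in>space M. X (1 + h) \<omega> \<le> - K}"
  proof (rule finite_measure_mono)
    show "?g \<inter> ?P - ?O \<subseteq> {\<omega>\<in>space M. X (1 + h) \<omega> \<le> - K}"
    proof
      fix \<omega> assume \<omega>: "\<omega> \<in> ?g \<inter> ?P - ?O"
      then have sp: "\<omega> \<in> space M" and x1: "\<bar>X 1 \<omega>\<bar> \<le> K0" and dv: "V (1 + h) \<omega> - V 1 \<omega> < - N" by auto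
      have osc: "\<bar>V t \<omega> - V 1 \<omega>\<bar> \<le> 2 * N" if "t \<in> {1..1 + h}" for t
        using \<omega> that unfolding oscillates_def by force
      have "X (1 + h) \<omega> \<le> X 1 \<omega> + (V (1 + h) \<omega> - V 1 \<omega>) + k * h / (1 - k * h) * (\<bar>X 1 \<omega>\<bar> + 2 * N)"
        by (rule driven_path.drift_over_step[OF path[OF sp]]) (use h osc in auto)
      moreover have "k * h / (1 - k * h) * (\<bar>X 1 \<omega>\<bar> + 2 * N) \<le> 1 / 4 * (K0 + 2 * N)"
        using h(3) x1 N K K0(1) by (intro mult_mono) auto
      ultimately have "X (1 + h) \<omega> \<le> X 1 \<omega> + (V (1 + h) \<omega> - V 1 \<omega>) + 1 / 4 * (K0 + 2 * N)"
        by (meson add_left_mono order_trans)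
      moreover have "X 1 \<omega> \<le> K0" using x1 by simp
      ultimately have "X (1 + h) \<omega> \<le> - K" using dv N K0(1) K by argo
      then show "\<omega> \<in> {\<omega>\<in>space M. X (1 + h) \<omega> \<le> - K}" using sp by simp
    qed
  qed measurable
  finally show ?thesis .
qed

text \<open>
  As \<open>h\<close> tends to \<open>0\<close>, the loss \<open>k h / (1 - k h)\<close> is about \<open>k h\<close> and \<open>1 - exp (-h/2)\<close> is about \<open>h/2\<close>.  This is where
  \<open>k < 1/2\<close> enters.
\<close>

lemma step_length_exists:
  "\<exists>h>0. k * h < 1 \<and> k * h / (1 - k * h) \<le> 1 / 4 \<and> exp (- h / 2) < 1 - k * h / (1 - k * h)"
proof -
  define h where "h = (1 - 2 * k) / 2"
  have h: "0 < h" "h < 1 / 2" "k = 1 / 2 - h" using k by (auto simp: h_def field_simps)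
  have kh: "k * h \<le> 1 / 16"
    using zero_le_power2[of "h - 1 / 4"] by (simp add: h(3) power2_eq_square algebra_simps)
  have "x / (1 - x) \<le> 1 / 4" if "x \<le> 1 / 16" for x :: real
    using that by (simp add: pos_divide_le_eq)
  from this[OF kh] have \<kappa>: "k * h / (1 - k * h) \<le> 1 / 4" .
  have "exp (- h / 2) \<le> 1 - h / 2 + h\<^sup>2 / 8"
  proof -
    have "1 + h / 2 + (h / 2)\<^sup>2 / 2 \<le> exp (h / 2)" using h exp_lower_Taylor_quadratic[of "h / 2"] by simp
    moreover have "(1 - h / 2 + h\<^sup>2 / 8) * (1 + h / 2 + (h / 2)\<^sup>2 / 2) = 1 + (h\<^sup>2)\<^sup>2 / 64"
      by (simp add: power2_eq_square field_simps)
    then have "1 \<le> (1 - h / 2 + h\<^sup>2 / 8) * (1 + h / 2 + (h / 2)\<^sup>2 / 2)" by simp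
    moreover have pos: "0 < 1 - h / 2 + h\<^sup>2 / 8" using h by (intro add_pos_nonneg) auto
    ultimately have "1 \<le> (1 - h / 2 + h\<^sup>2 / 8) * exp (h / 2)"
      by (meson less_imp_le mult_left_mono order_trans)
    then have "exp (- (h / 2)) * 1 \<le> exp (- (h / 2)) * ((1 - h / 2 + h\<^sup>2 / 8) * exp (h / 2))"
      by (intro mult_left_mono) auto
    then show ?thesis by (simp add: exp_minus field_simps)
  qed
  moreover have "k * h / (1 - k * h) < h / 2 - h\<^sup>2 / 8"
  proof -
    have "k < (1 / 2 - h / 8) * (1 - k * h)"
    proof -
      have "k * h * (1 / 2 - h / 8) \<le> 1 / 2 * h * (1 / 2)"
        using k h by (intro mult_mono) auto
      moreover have "(1 / 2 - h / 8) * (1 - k * h) = 1 / 2 - h / 8 - k * h * (1 / 2 - h / 8)"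
        by (simp add: field_simps)
      ultimately show ?thesis using h by linarith
    qed
    then have "k * h < (1 / 2 - h / 8) * (1 - k * h) * h" using h by (intro mult_strict_right_mono) auto
    also have "\<dots> = (h / 2 - h\<^sup>2 / 8) * (1 - k * h)" by (simp add: power2_eq_square field_simps)
    finally show ?thesis using kh by (simp add: pos_divide_less_eq)
  qed
  ultimately show ?thesis using h(1) kh \<kappa> by (intro exI[of _ h]) auto
qed

text \<open>
  Start from a low level reached at time \<open>a\<close>.  On the \<open>n\<close>-th step the noise has standard deviation at most
  \<open>exp (-n h/2)\<close>, so it exceeds \<open>c r\<^sup>n\<close> with a probability that is summable in \<open>n\<close> and small for large \<open>c\<close>.  Otherwise
  \<open>stays_negative\<close> keeps \<open>X\<close> negative at all grid times, which excludes divergence to infinity.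
\<close>

lemma to_zero_positive: "prob to_zero > 0"
proof -
  obtain h where h: "h > 0" "k * h < 1" "k * h / (1 - k * h) \<le> 1 / 4"
    and gap: "exp (- h / 2) < 1 - k * h / (1 - k * h)"
    using step_length_exists by blast
  define \<kappa> where "\<kappa> = k * h / (1 - k * h)"
  have \<kappa>1: "\<kappa> \<le> 1" using h(3) unfolding \<kappa>_def by linarith
  define r where "r = (exp (- h / 2) + (1 - \<kappa>)) / 2"
  have r: "exp (- h / 2) < r" "r < 1 - \<kappa>" "0 < r"
    using gap by (auto simp: r_def \<kappa>_def[symmetric] add_pos_pos)
      (smt (verit) exp_gt_zero field_sum_of_halves)
  define \<theta> where "\<theta> = exp (- h) / r\<^sup>2"
  have "exp (- h) = (exp (- h / 2))\<^sup>2" by (simp add: power2_eq_square mult_exp_exp)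
  also have "\<dots> < r\<^sup>2" by (rule power_strict_mono[OF r(1)]) auto
  finally have \<theta>: "0 < \<theta>" "\<theta> < 1" using r(3) by (auto simp: \<theta>_def)
  \<comment> \<open>makes the sum over all steps of the exceptional probabilities one half of that of the starting event\<close>
  define c where "c = sqrt (8 / (1 - \<theta>))"
  have c: "c > 0" "c\<^sup>2 = 8 / (1 - \<theta>)" using \<theta> by (auto simp: c_def)
  define K where "K = 2 * c / (1 - \<kappa> - r)"
  have K: "K * (1 - \<kappa> - r) = 2 * c" "K > 0" using r c by (auto simp: K_def)
  define a where "a = 1 + h"
  let ?g = "{\<omega>\<in>space M. X a \<omega> \<le> - K}"
  have a1: "1 \<le> a" using h by (simp add: a_def)
  have pg: "prob ?g > 0" unfolding a_def by (rule reaches_deep_level) (use h K in auto)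
  have [measurable]: "X a \<in> borel_measurable (F a)" using X_adapted a1 by simp
  have "{\<omega>\<in>space (F a). X a \<omega> \<le> - K} \<in> sets (F a)" by measurable
  then have g: "?g \<in> sets (F a)" by (simp add: space_F)
  define t where "t n = a + real n * h" for n
  have t1: "1 \<le> t n" "a \<le> t n" for n using a1 h by (auto simp: t_def add_increasing2)
  let ?O = "\<lambda>n. oscillates (t n) (t n + h) (c * r ^ n)"
  have OM: "?O n \<in> sets M" for n by (rule oscillates_measurable) (use t1 h in auto)
  have gM: "?g \<in> sets M" by (rule sets_F[OF a1 g])
  have bound: "prob (?g \<inter> ?O n) \<le> 4 * prob ?g / c\<^sup>2 * \<theta> ^ n" for n
  proof -
    have gn: "?g \<in> sets (F (t n))" using g sets_F_mono[OF t1(2)] by blast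
    have "prob (?g \<inter> ?O n) \<le> 4 * prob ?g * exp (- t n) / (c * r ^ n)\<^sup>2"
      by (rule oscillation_bound[OF t1(1) _ gn]) (use h c r in auto)
    also have "\<dots> \<le> 4 * prob ?g * exp (- h) ^ n / (c * r ^ n)\<^sup>2"
    proof (intro divide_right_mono mult_left_mono)
      have "exp (- t n) \<le> exp (real n * (- h))" using a1 by (simp add: t_def)
      then show "exp (- t n) \<le> exp (- h) ^ n" unfolding exp_of_nat_mult .
    qed auto
    also have "\<dots> = 4 * prob ?g / c\<^sup>2 * \<theta> ^ n"
      by (simp add: \<theta>_def power_divide power_mult_distrib power_mult[symmetric] mult.commute)
    finally show ?thesis .
  qed
  have "prob (\<Union>n. ?g \<inter> ?O n) \<le> (\<Sum>n. prob (?g \<inter> ?O n))"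
  proof (rule finite_measure_subadditive_countably)
    show "range (\<lambda>n. ?g \<inter> ?O n) \<subseteq> events" using OM gM by auto
    show "summable (\<lambda>n. prob (?g \<inter> ?O n))"
      by (rule summable_comparison_test'[of "\<lambda>n. 4 * prob ?g / c\<^sup>2 * \<theta> ^ n"])
        (use \<theta> bound in \<open>auto intro!: summable_mult summable_geometric\<close>)
  qed
  also have "\<dots> \<le> (\<Sum>n. 4 * prob ?g / c\<^sup>2 * \<theta> ^ n)"
  proof (rule suminf_le[OF bound])
    show sg: "summable (\<lambda>n. 4 * prob ?g / c\<^sup>2 * \<theta> ^ n)" using \<theta> by (intro summable_mult summable_geometric) auto
    show "summable (\<lambda>n. prob (?g \<inter> ?O n))"
      by (rule summable_comparison_test'[OF sg]) (use bound in auto)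
  qed
  also have "\<dots> = 4 * prob ?g / c\<^sup>2 * (1 / (1 - \<theta>))"
    using \<theta> by (subst suminf_mult) (auto simp: suminf_geometric summable_geometric)
  also have "\<dots> = prob ?g / 2" unfolding c(2) using \<theta> by (simp add: field_simps)
  finally have pU: "prob (\<Union>n. ?g \<inter> ?O n) \<le> prob ?g / 2" .
  have UM: "(\<Union>n. ?g \<inter> ?O n) \<in> sets M" using OM gM by (intro sets.countable_UN) auto
  have "prob ?g \<le> prob ((?g - (\<Union>n. ?g \<inter> ?O n)) \<union> (\<Union>n. ?g \<inter> ?O n))"
    by (rule finite_measure_mono) (use gM UM in auto)
  also have "\<dots> \<le> prob (?g - (\<Union>n. ?g \<inter> ?O n)) + prob (\<Union>n. ?g \<inter> ?O n)"
    by (intro measure_Un_le) (use gM UM in auto)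
  finally have "0 < prob (?g - (\<Union>n. ?g \<inter> ?O n))" using pU pg by linarith
  also have "\<dots> \<le> prob to_zero"
  proof (rule finite_measure_mono_AE[OF _ to_zero_measurable])
    show "AE \<omega> in M. \<omega> \<in> ?g - (\<Union>n. ?g \<inter> ?O n) \<longrightarrow> \<omega> \<in> to_zero"
      using AE_zero_or_infinity
    proof eventually_elim
      case (elim \<omega>)
      show ?case
      proof
        assume \<omega>: "\<omega> \<in> ?g - (\<Union>n. ?g \<inter> ?O n)"
        then have sp: "\<omega> \<in> space M" and start: "X a \<omega> \<le> - K" by auto
        have calm: "\<bar>V u \<omega> - V (a + real n * h) \<omega>\<bar> \<le> c * r ^ n" if "u \<in> {a + real n * h..a + real n * h + h}" for n u
        proof -
          have "\<omega> \<notin> ?O n" using \<omega> by blast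
          then show ?thesis using that sp unfolding oscillates_def t_def by force
        qed
        have neg: "X (a + real n * h) \<omega> \<le> - K * r ^ n" for n
          by (rule driven_path.stays_negative[OF path[OF sp] a1 less_imp_le[OF h(1)] h(2) \<kappa>_def \<kappa>1 r(3,2) c(1) K(1) start calm])
        have "\<omega> \<notin> to_infinity"
        proof
          assume "\<omega> \<in> to_infinity"
          then have "\<forall>\<^sub>F u in at_top. 0 \<le> X u \<omega>" unfolding to_infinity_def filterlim_at_top by blast
          then obtain u0 where u0: "\<And>u. u \<ge> u0 \<Longrightarrow> 0 \<le> X u \<omega>" unfolding eventually_at_top_linorder by blast
          obtain n :: nat where "u0 / h \<le> real n" using real_arch_simple by blast
          then have "u0 \<le> real n * h" using h(1) by (simp add: pos_divide_le_eq)
          then have "0 \<le> X (a + real n * h) \<omega>" using a1 by (intro u0) linarith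
          moreover have "- K * r ^ n < 0" using K(2) r(3) by simp
          ultimately show False using neg[of n] by linarith
        qed
        then show "\<omega> \<in> to_zero" using elim by blast
      qed
    qed
  qed
  finally show ?thesis .
qed

end

section \<open>The solution of the stochastic differential equation\<close>

theorem theorem3p7:
  fixes M :: "'a measure" and F :: "real \<Rightarrow> 'a measure"
    and W X :: "real \<Rightarrow> 'a \<Rightarrow> real" and k :: real and A B :: "'a set"
  assumes "brownian_motion M F W"
    and "0 < k" and "k < 1 / 2"
    and "sde_solution M F W 1 (\<lambda>t x. k * \<bar>x\<bar>) (\<lambda>t. exp (- t / 2)) X"
    and "A = {\<omega> \<in> space M. ((\<lambda>t. X t \<omega>) \<longlongrightarrow> 0) at_top}"
    and "B = {\<omega> \<in> space M. filterlim (\<lambda>t. X t \<omega>) at_top at_top}"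
  shows "A \<in> sets M \<and> B \<in> sets M \<and>
    measure M (A \<union> B) = 1 \<and>
    (measure M A > 0 \<and> measure M B > 0) \<and>
    (AE \<omega> in M. (\<exists>\<^sub>F t in at_top. X t \<omega> \<ge> 0) \<longrightarrow> filterlim (\<lambda>t. X t \<omega>) at_top at_top)"
proof -
  interpret BM: brownian_motion M F W by (rule assms(1))
  from assms(4) obtain I where X_adapted: "\<And>t. 1 \<le> t \<Longrightarrow> X t \<in> borel_measurable (F t)"
    and X_continuous: "\<And>\<omega>. \<omega> \<in> space M \<Longrightarrow> continuous_on {1..} (\<lambda>t. X t \<omega>)"
    and ito: "\<And>t. 1 \<le> t \<Longrightarrow> ito_integral M F W 1 t (\<lambda>s \<omega>. exp (- s / 2)) (I t)"
    and eq: "AE \<omega> in M. \<forall>t\<ge>1. set_integrable lborel {1..t} (\<lambda>s. k * \<bar>X s \<omega>\<bar>) \<and>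
      X t \<omega> = X 1 \<omega> + (LBINT s:{1..t}. k * \<bar>X s \<omega>\<bar>) + I t \<omega>"
    unfolding sde_solution_def by blast
  \<comment> \<open>this version of the Ito integral is continuous and adapted on all of the space, not only almost surely\<close>
  define V where "V t \<omega> = X t \<omega> - X 1 \<omega> - k * integral {1..t} (\<lambda>s. \<bar>X s \<omega>\<bar>)" for t \<omega>
  have V_eq: "AE \<omega> in M. \<forall>t\<ge>1. I t \<omega> = V t \<omega>"
    using eq
  proof eventually_elim
    case (elim \<omega>)
    show ?case
    proof (intro allI impI)
      fix t :: real assume t: "1 \<le> t"
      have int: "set_integrable lborel {1..t} (\<lambda>s. k * \<bar>X s \<omega>\<bar>)"
        and X: "X t \<omega> = X 1 \<omega> + (LBINT s:{1..t}. k * \<bar>X s \<omega>\<bar>) + I t \<omega>"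
        using elim[rule_format, OF t] by auto
      have "(LBINT s:{1..t}. k * \<bar>X s \<omega>\<bar>) = integral {1..t} (\<lambda>s. k * \<bar>X s \<omega>\<bar>)"
        by (rule set_borel_integral_eq_integral(2)[OF int])
      also have "\<dots> = k * integral {1..t} (\<lambda>s. \<bar>X s \<omega>\<bar>)" by (rule integral_mult_right)
      finally show "I t \<omega> = V t \<omega>" using X unfolding V_def by linarith
    qed
  qed
  have sub: "subalgebra M (F t)" if "1 \<le> t" for t using BM.F_subalgebra that by simp
  have V_adapted: "V t \<in> borel_measurable (F t)" if t: "1 \<le> t" for t
  proof -
    have Xm: "(\<lambda>\<omega>. \<bar>X s \<omega>\<bar>) \<in> borel_measurable (F t)" if "s \<in> {1..t}" for s
      using BM.measurable_F_mono[OF X_adapted, of s t] that by simp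
    have "(\<lambda>\<omega>. integral {1..t} (\<lambda>s. \<bar>X s \<omega>\<bar>)) \<in> borel_measurable (F t)"
    proof (rule borel_measurable_pathwise_integral[OF t Xm])
      fix \<omega> assume "\<omega> \<in> space (F t)"
      then show "continuous_on {1..t} (\<lambda>s. \<bar>X s \<omega>\<bar>)"
        by (intro continuous_intros continuous_on_subset[OF X_continuous]) (auto simp: BM.space_F)
    qed
    then show ?thesis
      unfolding V_def[abs_def] using X_adapted[OF t] BM.measurable_F_mono[OF X_adapted, of 1 t] t by simp
  qed
  have V_continuous: "continuous_on {1..} (\<lambda>t. V t \<omega>)" if \<omega>: "\<omega> \<in> space M" for \<omega>
  proof -
    have "continuous_on {1..} (\<lambda>t. integral {1..t} (\<lambda>s. \<bar>X s \<omega>\<bar>))"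
      unfolding continuous_on_eq_continuous_within
    proof
      fix t :: real assume t: "t \<in> {1..}"
      have "continuous_on {1..t + 1} (\<lambda>t. integral {1..t} (\<lambda>s. \<bar>X s \<omega>\<bar>))"
        by (intro indefinite_integral_continuous_1 integrable_continuous_interval continuous_intros
          continuous_on_subset[OF X_continuous[OF \<omega>]]) auto
      then have "continuous (at t within {1..t + 1}) (\<lambda>t. integral {1..t} (\<lambda>s. \<bar>X s \<omega>\<bar>))"
        using t unfolding continuous_on_eq_continuous_within by auto
      moreover have "at t within {1..t + 1} = at t within {1..}"
        by (rule at_within_nhd[where S="{..<t + 1}"]) auto
      ultimately show "continuous (at t within {1..}) (\<lambda>t. integral {1..t} (\<lambda>s. \<bar>X s \<omega>\<bar>))"
        by (simp add: continuous_within)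
    qed
    then show ?thesis unfolding V_def by (intro continuous_intros X_continuous[OF \<omega>])
  qed
  interpret driven_process M F V X k
  proof unfold_locales
    fix s t :: real assume st: "1 \<le> s" "s \<le> t"
    show "BM.gauss_indep (F s) (\<lambda>\<omega>. V t \<omega> - V s \<omega>) (exp (- s) - exp (- t))"
    proof (rule BM.gauss_indep_AE_cong[OF BM.ito_increment_gauss_indep[OF ito ito st] _ _ sub])
      show "(\<lambda>\<omega>. V t \<omega> - V s \<omega>) \<in> borel_measurable M"
        using st by (intro borel_measurable_diff measurable_from_subalg[OF sub V_adapted]) auto
      show "AE \<omega> in M. I t \<omega> - I s \<omega> = V t \<omega> - V s \<omega>"
        using V_eq by eventually_elim (use st in auto)
    qed (use st in auto)
  next
    show "X t \<omega> = X 1 \<omega> + k * integral {1..t} (\<lambda>s. \<bar>X s \<omega>\<bar>) + V t \<omega>" for t \<omega> by (simp add: V_def)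
  qed (use assms(2,3) sub V_adapted V_continuous X_adapted X_continuous in auto)
  have A: "A = to_zero" and B: "B = to_infinity"
    unfolding assms(5,6) to_zero_def to_infinity_def by auto
  have "measure M (A \<union> B) = 1"
    unfolding A B by (subst BM.prob_eq_1) (use AE_zero_or_infinity in auto)
  then show ?thesis
    using to_zero_measurable to_infinity_measurable to_zero_positive to_infinity_positive AE_infinity_if_nonneg_infinitely_often
    unfolding A B by blast
qed

end
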